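(* Let $Y=(Y_{ij})_{i\ge1,j\ge1}$ be a row-column exchangeable (RCE) matrix and let $h$ be a quadruplet kernel such that $\mathbb{E}[h(Y_{(1,2;1,2)})^2]<\infty$. Let $(U^h_N)_{N\ge1}$ be the associated sequence of $U$-statistics, $\mathcal{F}_N=\sigma\big(U^h_{k,l},\ k\ge m_N,\ l\ge n_N\big)$, $\mathcal{F}_\infty=\bigcap_{N=1}^\infty\mathcal{F}_N$, $U^h_\infty=\mathbb{E}[h(Y_{(1,2;1,2)})\mid\mathcal{F}_\infty]$ and $$V=\frac{4}{c}\,\mathrm{Cov}\big(h(Y_{(1,2;1,2)}),h(Y_{(1,3;3,4)})\,\big|\,\mathcal{F}_\infty\big)+\frac{4}{1-c}\,\mathrm{Cov}\big(h(Y_{(1,2;1,2)}),h(Y_{(3,4;1,3)})\,\big|\,\mathcal{F}_\infty\big).$$ Assume $\mathbb{P}(V>0)>0$. If in addition $Y$ is dissociated, then $U^h_\infty$ and $V$ are (almost surely) constant, and $$\sqrt N\,(U^h_N-U^h_\infty)\xrightarrow[N\to\infty]{\mathcal D}\mathcal N(0,V).$$ More precisely, almost surely, 1. $U^h_\infty=\mathbb{E}[h(Y_{(1,2;1,2)})]$; 2. $V=\frac4c\,\mathrm{Cov}\big(h(Y_{(1,2;1,2)}),h(Y_{(1,3;3,4)})\big)+\frac4{1-c}\,\mathrm{Cov}\big(h(Y_{(1,2;1,2)}),h(Y_{(3,4;1,3)})\big)$.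
   Context: RCE matrix: an infinite matrix $Y=(Y_{ij})_{i,j\ge1}$ of real random variables such that for all finite permutations $\sigma_1,\sigma_2$ of $\{1,2,\dots\}$, $(Y_{\sigma_1(i)\sigma_2(j)})_{i,j\ge1}$ has the same distribution as $Y$. Dissociated: $Y$ is dissociated if for all $m,n$, $(Y_{ij})_{1\le i\le m,1\le j\le n}$ is independent of $(Y_{ij})_{i>m,j>n}$. Quadruplets: $Y_{(i_1,i_2;j_1,j_2)}=\begin{pmatrix}Y_{i_1j_1}&Y_{i_1j_2}\\ Y_{i_2j_1}&Y_{i_2j_2}\end{pmatrix}$. A quadruplet kernel is a (measurable) real function $h$ of $2\times2$ real matrices that is invariant under swapping the two rows and under swapping the two columns. $U$-statistics: for $m,n\ge2$, $U^h_{m,n}=\binom m2^{-1}\binom n2^{-1}\sum_{1\le i_1<i_2\le m,\ 1\le j_1<j_2\le n}h(Y_{(i_1,i_2;j_1,j_2)})$. Dimensions: $c\in(0,1)$ is a fixed irrational number, $m_N=2+\lfloor c(N+1)\rfloor$, $n_N=2+\lfloor(1-c)(N+1)\rfloor$, and $U^h_N:=U^h_{m_N,n_N}$. The conditional covariance is $\mathrm{Cov}(A,B\mid\mathcal F)=\mathbb{E}[AB\mid\mathcal F]-\mathbb{E}[A\mid\mathcal F]\,\mathbb{E}[B\mid\mathcal F]$. *)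

theory Defs
  imports "HOL-Probability.Probability"
begin

text \<open>
  An infinite random matrix on \<open>M\<close> is a function \<open>Y :: nat \<Rightarrow> nat \<Rightarrow> 'w \<Rightarrow> real\<close>; rows and columns
  are indexed by \<open>1, 2, \<dots>\<close>, and the values of \<open>Y\<close> at index \<open>0\<close> are never used.
\<close>

definition random_matrix :: "'w measure \<Rightarrow> (nat \<Rightarrow> nat \<Rightarrow> 'w \<Rightarrow> real) \<Rightarrow> bool" where
  "random_matrix M Y \<longleftrightarrow> (\<forall>i\<ge>1. \<forall>j\<ge>1. Y i j \<in> borel_measurable M)"

definition submatrix_space :: "nat set \<Rightarrow> nat set \<Rightarrow> (nat \<times> nat \<Rightarrow> real) measure" where
  "submatrix_space I J = (\<Pi>\<^sub>M p\<in>I \<times> J. borel)"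

definition submatrix ::
    "(nat \<Rightarrow> nat \<Rightarrow> 'w \<Rightarrow> real) \<Rightarrow> nat set \<Rightarrow> nat set \<Rightarrow> 'w \<Rightarrow> (nat \<times> nat \<Rightarrow> real)" where
  "submatrix Y I J \<omega> = (\<lambda>(i, j)\<in>I \<times> J. Y i j \<omega>)"

definition finite_permutation :: "(nat \<Rightarrow> nat) \<Rightarrow> bool" where
  "finite_permutation \<sigma> \<longleftrightarrow> \<sigma> permutes {1..} \<and> finite {i. \<sigma> i \<noteq> i}"

definition RCE :: "'w measure \<Rightarrow> (nat \<Rightarrow> nat \<Rightarrow> 'w \<Rightarrow> real) \<Rightarrow> bool" where
  "RCE M Y \<longleftrightarrow> random_matrix M Y \<and>
     (\<forall>\<sigma>\<^sub>1 \<sigma>\<^sub>2. finite_permutation \<sigma>\<^sub>1 \<longrightarrow> finite_permutation \<sigma>\<^sub>2 \<longrightarrow>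
        distr M (submatrix_space {1..} {1..}) (submatrix (\<lambda>i j. Y (\<sigma>\<^sub>1 i) (\<sigma>\<^sub>2 j)) {1..} {1..}) =
        distr M (submatrix_space {1..} {1..}) (submatrix Y {1..} {1..}))"

definition dissociated :: "'w measure \<Rightarrow> (nat \<Rightarrow> nat \<Rightarrow> 'w \<Rightarrow> real) \<Rightarrow> bool" where
  "dissociated M Y \<longleftrightarrow>
     (\<forall>m\<ge>1. \<forall>n\<ge>1. prob_space.indep_var M
        (submatrix_space {1..m} {1..n}) (submatrix Y {1..m} {1..n})
        (submatrix_space {m<..} {n<..}) (submatrix Y {m<..} {n<..}))"

definition mat22 :: "real \<Rightarrow> real \<Rightarrow> real \<Rightarrow> real \<Rightarrow> real^2^2" where
  "mat22 a b c d = vector [vector [a, b], vector [c, d]]"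

definition quadruplet ::
    "(nat \<Rightarrow> nat \<Rightarrow> 'w \<Rightarrow> real) \<Rightarrow> nat \<Rightarrow> nat \<Rightarrow> nat \<Rightarrow> nat \<Rightarrow> 'w \<Rightarrow> real^2^2" where
  "quadruplet Y i\<^sub>1 i\<^sub>2 j\<^sub>1 j\<^sub>2 \<omega> = mat22 (Y i\<^sub>1 j\<^sub>1 \<omega>) (Y i\<^sub>1 j\<^sub>2 \<omega>) (Y i\<^sub>2 j\<^sub>1 \<omega>) (Y i\<^sub>2 j\<^sub>2 \<omega>)"

definition quadruplet_kernel :: "(real^2^2 \<Rightarrow> real) \<Rightarrow> bool" where
  "quadruplet_kernel h \<longleftrightarrow> h \<in> borel_measurable borel \<and>
     (\<forall>a b c d. h (mat22 c d a b) = h (mat22 a b c d)) \<and>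
     (\<forall>a b c d. h (mat22 b a d c) = h (mat22 a b c d))"

definition U_stat ::
    "(real^2^2 \<Rightarrow> real) \<Rightarrow> (nat \<Rightarrow> nat \<Rightarrow> 'w \<Rightarrow> real) \<Rightarrow> nat \<Rightarrow> nat \<Rightarrow> 'w \<Rightarrow> real" where
  "U_stat h Y m n \<omega> = inverse (real (m choose 2)) * inverse (real (n choose 2)) *
     (\<Sum>(i\<^sub>1, i\<^sub>2) \<in> {(i\<^sub>1, i\<^sub>2). 1 \<le> i\<^sub>1 \<and> i\<^sub>1 < i\<^sub>2 \<and> i\<^sub>2 \<le> m}.
      \<Sum>(j\<^sub>1, j\<^sub>2) \<in> {(j\<^sub>1, j\<^sub>2). 1 \<le> j\<^sub>1 \<and> j\<^sub>1 < j\<^sub>2 \<and> j\<^sub>2 \<le> n}.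
        h (quadruplet Y i\<^sub>1 i\<^sub>2 j\<^sub>1 j\<^sub>2 \<omega>))"

definition m_dim :: "real \<Rightarrow> nat \<Rightarrow> nat" where
  "m_dim c N = 2 + nat \<lfloor>c * (real N + 1)\<rfloor>"

definition n_dim :: "real \<Rightarrow> nat \<Rightarrow> nat" where
  "n_dim c N = 2 + nat \<lfloor>(1 - c) * (real N + 1)\<rfloor>"

definition U_seq ::
    "real \<Rightarrow> (real^2^2 \<Rightarrow> real) \<Rightarrow> (nat \<Rightarrow> nat \<Rightarrow> 'w \<Rightarrow> real) \<Rightarrow> nat \<Rightarrow> 'w \<Rightarrow> real" where
  "U_seq c h Y N = U_stat h Y (m_dim c N) (n_dim c N)"

text \<open>
  Sub-\<open>\<sigma>\<close>-algebras are encoded, as \<^const>\<open>real_cond_exp\<close> expects, by measures of which only the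
  space and the measurable sets matter.
\<close>

definition F_N ::
    "'w measure \<Rightarrow> real \<Rightarrow> (real^2^2 \<Rightarrow> real) \<Rightarrow> (nat \<Rightarrow> nat \<Rightarrow> 'w \<Rightarrow> real) \<Rightarrow> nat \<Rightarrow> 'w measure" where
  "F_N M c h Y N = sigma (space M)
     {U_stat h Y k l -` B \<inter> space M | k l B. k \<ge> m_dim c N \<and> l \<ge> n_dim c N \<and> B \<in> sets borel}"

definition F_inf ::
    "'w measure \<Rightarrow> real \<Rightarrow> (real^2^2 \<Rightarrow> real) \<Rightarrow> (nat \<Rightarrow> nat \<Rightarrow> 'w \<Rightarrow> real) \<Rightarrow> 'w measure" where
  "F_inf M c h Y = sigma (space M) (\<Inter>N\<in>{1..}. sets (F_N M c h Y N))"

lemma space_F_N [simp]: "space (F_N M c h Y N) = space M"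
  by (auto simp: F_N_def intro!: space_measure_of)

lemma space_F_inf [simp]: "space (F_inf M c h Y) = space M"
  unfolding F_inf_def
  by (rule space_measure_of) (use sets.sets_into_space[of _ "F_N M c h Y 1"] in fastforce)

text \<open>The intersection is already a \<open>\<sigma>\<close>-algebra, so \<^const>\<open>sigma\<close> adds no sets.\<close>

lemma sets_F_inf: "sets (F_inf M c h Y) = (\<Inter>N\<in>{1..}. sets (F_N M c h Y N))"
proof -
  let ?A = "\<Inter>N\<in>{1..}. sets (F_N M c h Y N)"
  have sub: "?A \<subseteq> Pow (space M)"
    using sets.sets_into_space[of _ "F_N M c h Y 1"] by fastforce
  have "sigma_sets (space M) ?A \<subseteq> sets (F_N M c h Y N)" if "N \<ge> 1" for N
    using sets.sigma_sets_subset[of ?A "F_N M c h Y N"] that by auto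
  then have "sigma_sets (space M) ?A = ?A" by auto
  then show ?thesis using sub by (simp add: F_inf_def)
qed

definition U_inf ::
    "'w measure \<Rightarrow> real \<Rightarrow> (real^2^2 \<Rightarrow> real) \<Rightarrow> (nat \<Rightarrow> nat \<Rightarrow> 'w \<Rightarrow> real) \<Rightarrow> 'w \<Rightarrow> real" where
  "U_inf M c h Y = real_cond_exp M (F_inf M c h Y) (\<lambda>\<omega>. h (quadruplet Y 1 2 1 2 \<omega>))"

definition cov :: "'w measure \<Rightarrow> ('w \<Rightarrow> real) \<Rightarrow> ('w \<Rightarrow> real) \<Rightarrow> real" where
  "cov M A B = (\<integral>\<omega>. A \<omega> * B \<omega> \<partial>M) - (\<integral>\<omega>. A \<omega> \<partial>M) * (\<integral>\<omega>. B \<omega> \<partial>M)"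

definition cond_cov ::
    "'w measure \<Rightarrow> 'w measure \<Rightarrow> ('w \<Rightarrow> real) \<Rightarrow> ('w \<Rightarrow> real) \<Rightarrow> 'w \<Rightarrow> real" where
  "cond_cov M F A B \<omega> = real_cond_exp M F (\<lambda>\<omega>. A \<omega> * B \<omega>) \<omega>
     - real_cond_exp M F A \<omega> * real_cond_exp M F B \<omega>"

definition V_var ::
    "'w measure \<Rightarrow> real \<Rightarrow> (real^2^2 \<Rightarrow> real) \<Rightarrow> (nat \<Rightarrow> nat \<Rightarrow> 'w \<Rightarrow> real) \<Rightarrow> 'w \<Rightarrow> real" where
  "V_var M c h Y \<omega> =
     4 / c * cond_cov M (F_inf M c h Y)
       (\<lambda>\<omega>. h (quadruplet Y 1 2 1 2 \<omega>)) (\<lambda>\<omega>. h (quadruplet Y 1 3 3 4 \<omega>)) \<omega>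
   + 4 / (1 - c) * cond_cov M (F_inf M c h Y)
       (\<lambda>\<omega>. h (quadruplet Y 1 2 1 2 \<omega>)) (\<lambda>\<omega>. h (quadruplet Y 3 4 1 3 \<omega>)) \<omega>"

text \<open>Second argument: the variance. The density is the Gaussian one only for positive variance.\<close>

definition normal_distribution :: "real \<Rightarrow> real \<Rightarrow> real measure" where
  "normal_distribution \<mu> v = density lborel (normal_density \<mu> (sqrt v))"

end

theory Submission
  imports Defs "HOL-Real_Asymp.Real_Asymp"
begin

text \<open>
  Write \<open>H\<^sub>q\<close> for the centred kernel at a quadruplet \<open>q\<close> of two rows and two columns. By
  exchangeability the covariance of \<open>H\<^sub>q\<close> and \<open>H\<^bsub>q'\<^esub>\<close> depends only on how many rows and how many columns
  \<open>q\<close> and \<open>q'\<close> share, and by dissociation it vanishes if they share nothing. Among the pairs of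
  quadruplets in an \<open>m \<times> n\<close> matrix, those sharing exactly one row, or exactly one column, have
  proportion of order \<open>1/m\<close> and \<open>1/n\<close>; every richer overlap is of order \<open>1/N\<^sup>2\<close>. Hence
  \<open>N Var U\<^sub>N\<close> tends to the number \<open>V\<close> built from the one-row and the one-column covariances.

  For the limit law, \<open>U\<^sub>N\<close> is compared with a sum of genuinely independent variables. The
  classical candidate for the contribution of row \<open>i\<close> is the conditional expectation of the kernel
  given a latent row variable, which would call for an Aldous--Hoover representation. Instead, row
  \<open>i\<close> contributes the average of \<open>K\<close> values of the kernel at quadruplets that contain row \<open>i\<close> and
  otherwise use rows and columns occurring nowhere else, and similarly for column \<open>j\<close>. These block
  averages live on pairwise disjoint rows and disjoint columns, so dissociation makes them
  independent (\<open>char_block_sum\<close>). The law of \<open>U\<^sub>N\<close> does not change if its rows and columns are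
  spread out so as to leave room for the fresh indices (\<open>U_law\<close>). A computation of
  second moments with the overlap counts (\<open>block_approx_error\<close>) shows that \<open>U\<^sub>N\<close> minus the
  sum of blocks has second moment at most \<open>O(1/N\<^sup>2) + O(1/(N K))\<close>. For fixed \<open>K\<close> the sum of blocks obeys the
  central limit theorem (\<open>block_approx_limit\<close>); letting \<open>N\<close> and then \<open>K\<close> tend to
  infinity gives the characteristic function of the limit (\<open>U_char_limit\<close>), and Levy's
  continuity theorem concludes.

  The tail \<open>\<sigma>\<close>-algebra is trivial: an event in it is invariant under permutations of any finite number
  of rows and columns, so it has the same correlation \<open>a\<close> with each of \<open>K\<close> independent copies of a
  bounded centred function of a finite block. Bessel's inequality then bounds \<open>K a\<^sup>2\<close>
  independently of \<open>K\<close>, so \<open>a = 0\<close> (\<open>zero_if_many_orthogonal\<close>). Conditional expectations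
  given the tail are therefore plain expectations, and the conditional covariances in \<open>V\<close> are
  covariances.
\<close>

section \<open>Functionals of a finite block of the matrix\<close>

text \<open>
  Working with functionals of a matrix \<open>y :: nat \<Rightarrow> nat \<Rightarrow> real\<close> rather than with random variables
  allows the same functional to be evaluated at \<open>Y\<close> and at a relabelled \<open>Y\<close>. The witness \<open>g\<close> records
  in one go that only the entries in \<open>I \<times> J\<close> matter and that the dependence on them is measurable.
\<close>

definition block_functional ::
    "nat set \<Rightarrow> nat set \<Rightarrow> 'b measure \<Rightarrow> ((nat \<Rightarrow> nat \<Rightarrow> real) \<Rightarrow> 'b) \<Rightarrow> bool" where
  "block_functional I J N G \<longleftrightarrow>
     (\<exists>g \<in> measurable (submatrix_space I J) N. G = (\<lambda>y. g (\<lambda>(i, j)\<in>I \<times> J. y i j)))"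

lemma block_functionalI:
  assumes "g \<in> measurable (submatrix_space I J) N" "\<And>y. G y = g (\<lambda>(i, j)\<in>I \<times> J. y i j)"
  shows "block_functional I J N G"
  unfolding block_functional_def using assms by blast

lemma block_functionalE:
  assumes "block_functional I J N G"
  obtains g where "g \<in> measurable (submatrix_space I J) N" "G = (\<lambda>y. g (\<lambda>(i, j)\<in>I \<times> J. y i j))"
  using assms unfolding block_functional_def by blast

lemma block_functional_entry:
  assumes "i \<in> I" "j \<in> J"
  shows "block_functional I J borel (\<lambda>y. y i j)"
proof (rule block_functionalI)
  show "(\<lambda>x. x (i, j)) \<in> borel_measurable (submatrix_space I J)"
    unfolding submatrix_space_def by (rule measurable_component_singleton) (simp add: assms)
qed (simp add: assms)

lemma block_functional_compose:
  assumes "block_functional I J N G" "f \<in> measurable N N'"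
  shows "block_functional I J N' (\<lambda>y. f (G y))"
proof (rule block_functionalE[OF assms(1)])
  fix g assume g: "g \<in> measurable (submatrix_space I J) N"
    "G = (\<lambda>y. g (\<lambda>(i, j)\<in>I \<times> J. y i j))"
  show ?thesis
    by (rule block_functionalI[of "\<lambda>x. f (g x)"]) (use g(1) assms(2) in \<open>simp_all add: g(2)\<close>)
qed

lemma block_functional_Pair:
  assumes "block_functional I J N G" "block_functional I J N' G'"
  shows "block_functional I J (N \<Otimes>\<^sub>M N') (\<lambda>y. (G y, G' y))"
proof -
  obtain g where g: "g \<in> measurable (submatrix_space I J) N"
    "G = (\<lambda>y. g (\<lambda>(i, j)\<in>I \<times> J. y i j))" using assms(1) by (rule block_functionalE)
  obtain g' where g': "g' \<in> measurable (submatrix_space I J) N'"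
    "G' = (\<lambda>y. g' (\<lambda>(i, j)\<in>I \<times> J. y i j))" using assms(2) by (rule block_functionalE)
  show ?thesis
    by (rule block_functionalI[of "\<lambda>x. (g x, g' x)"]) (use g(1) g'(1) in \<open>simp_all add: g(2) g'(2)\<close>)
qed

lemma block_functional_binary:
  assumes "block_functional I J N G" "block_functional I J N' G'"
    and "case_prod f \<in> measurable (N \<Otimes>\<^sub>M N') L"
  shows "block_functional I J L (\<lambda>y. f (G y) (G' y))"
  using block_functional_compose[OF block_functional_Pair[OF assms(1,2)] assms(3)] by simp

lemma block_functional_const:
  "c \<in> space N \<Longrightarrow> block_functional I J N (\<lambda>_. c)"
  by (rule block_functionalI[of "\<lambda>_. c"]) simp_all

lemma block_functional_sum:
  fixes G :: "'k \<Rightarrow> (nat \<Rightarrow> nat \<Rightarrow> real) \<Rightarrow> real"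
  assumes "\<And>k. k \<in> S \<Longrightarrow> block_functional I J borel (G k)"
  shows "block_functional I J borel (\<lambda>y. \<Sum>k\<in>S. G k y)"
  using assms
proof (induction S rule: infinite_finite_induct)
  case (insert k S)
  then have "block_functional I J borel (\<lambda>y. G k y + (\<Sum>k\<in>S. G k y))"
    by (intro block_functional_binary[where f="(+)" and N=borel and N'=borel]) auto
  with insert show ?case by simp
qed (auto intro: block_functional_const)

lemma restrict_block_measurable:
  assumes "I \<subseteq> I'" "J \<subseteq> J'"
  shows "(\<lambda>x. restrict x (I \<times> J)) \<in> measurable (submatrix_space I' J') (submatrix_space I J)"
  unfolding submatrix_space_def
  by (rule measurable_restrict_subset) (use assms in auto)

lemma block_functional_mono:
  assumes "block_functional I J N G" "I \<subseteq> I'" "J \<subseteq> J'"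
  shows "block_functional I' J' N G"
proof -
  obtain g where g: "g \<in> measurable (submatrix_space I J) N"
    "G = (\<lambda>y. g (\<lambda>(i, j)\<in>I \<times> J. y i j))" using assms(1) by (rule block_functionalE)
  have eq: "restrict (\<lambda>(i, j)\<in>I' \<times> J'. y i j) (I \<times> J) = (\<lambda>(i, j)\<in>I \<times> J. y i j)"
    for y :: "nat \<Rightarrow> nat \<Rightarrow> real"
    using assms(2,3) by (auto simp: restrict_def fun_eq_iff)
  show ?thesis
    by (rule block_functionalI[of "\<lambda>x. g (restrict x (I \<times> J))"])
       (use measurable_compose[OF restrict_block_measurable[OF assms(2,3)] g(1)] in \<open>simp_all only: g(2) eq\<close>)
qed

lemma block_functional_relabel:
  assumes "block_functional I J N G" "\<rho> ` I \<subseteq> I'" "\<kappa> ` J \<subseteq> J'"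
  shows "block_functional I' J' N (\<lambda>y. G (\<lambda>i j. y (\<rho> i) (\<kappa> j)))"
proof -
  obtain g where g: "g \<in> measurable (submatrix_space I J) N"
    "G = (\<lambda>y. g (\<lambda>(i, j)\<in>I \<times> J. y i j))" using assms(1) by (rule block_functionalE)
  let ?s = "\<lambda>x. \<lambda>p\<in>I \<times> J. x (\<rho> (fst p), \<kappa> (snd p)) :: real"
  have s: "?s \<in> measurable (submatrix_space I' J') (submatrix_space I J)"
    unfolding submatrix_space_def
    by (rule measurable_restrict) (use assms(2,3) in \<open>auto intro!: measurable_component_singleton\<close>)
  have eq: "?s (\<lambda>(i, j)\<in>I' \<times> J'. y i j) = (\<lambda>(i, j)\<in>I \<times> J. y (\<rho> i) (\<kappa> j))"
    for y :: "nat \<Rightarrow> nat \<Rightarrow> real"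
    using assms(2,3) by (auto simp: restrict_def fun_eq_iff)
  show ?thesis
    by (rule block_functionalI[of "\<lambda>x. g (?s x)"])
       (use measurable_compose[OF s g(1)] in \<open>simp_all only: g(2) eq\<close>)
qed

lemma submatrix_measurable:
  assumes "random_matrix M Y" "I \<subseteq> {1..}" "J \<subseteq> {1..}"
  shows "submatrix Y I J \<in> measurable M (submatrix_space I J)"
proof -
  have "(\<lambda>\<omega>. \<lambda>p\<in>I \<times> J. Y (fst p) (snd p) \<omega>) \<in> measurable M (submatrix_space I J)"
    unfolding submatrix_space_def
  proof (rule measurable_restrict)
    fix p assume "p \<in> I \<times> J"
    then have "1 \<le> fst p" "1 \<le> snd p" using assms(2,3) by auto
    then show "Y (fst p) (snd p) \<in> borel_measurable M"
      using assms(1) by (simp add: random_matrix_def)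
  qed
  moreover have "(\<lambda>\<omega>. \<lambda>p\<in>I \<times> J. Y (fst p) (snd p) \<omega>) = submatrix Y I J"
    by (auto simp: submatrix_def fun_eq_iff restrict_def)
  ultimately show ?thesis by simp
qed

lemma block_functional_measurable:
  assumes "random_matrix M Y" "block_functional I J N G" "I \<subseteq> {1..}" "J \<subseteq> {1..}"
  shows "(\<lambda>\<omega>. G (\<lambda>i j. Y i j \<omega>)) \<in> measurable M N"
proof -
  obtain g where g: "g \<in> measurable (submatrix_space I J) N"
    "G = (\<lambda>y. g (\<lambda>(i, j)\<in>I \<times> J. y i j))" using assms(2) by (rule block_functionalE)
  have "(\<lambda>\<omega>. g (submatrix Y I J \<omega>)) \<in> measurable M N"
    using submatrix_measurable[OF assms(1,3,4)] g(1) by (rule measurable_compose)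
  then show ?thesis by (simp add: g(2) submatrix_def)
qed

text \<open>
  An injection of a finite set extends to a permutation of \<open>I \<union> \<rho> ` I\<close>: the complements of \<open>I\<close> and of
  \<open>\<rho> ` I\<close> in that set have equally many elements.
\<close>

lemma finite_permutation_extends:
  assumes "finite I" "I \<subseteq> {1..}" "inj_on \<rho> I" "\<rho> ` I \<subseteq> {1..}"
  obtains \<sigma> where "finite_permutation \<sigma>" "\<And>i. i \<in> I \<Longrightarrow> \<sigma> i = \<rho> i"
    "\<And>i. i \<notin> I \<union> \<rho> ` I \<Longrightarrow> \<sigma> i = i"
proof -
  let ?S = "I \<union> \<rho> ` I"
  have fin: "finite ?S" using assms by simp
  have "card (?S - I) = card (?S - \<rho> ` I)"
    using assms by (simp add: card_Diff_subset card_image)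
  then obtain f where f: "bij_betw f (?S - I) (?S - \<rho> ` I)"
    using finite_same_card_bij[of "?S - I" "?S - \<rho> ` I"] fin by auto
  define \<sigma> where "\<sigma> i = (if i \<in> I then \<rho> i else if i \<in> ?S then f i else i)" for i
  have b1: "bij_betw \<sigma> I (\<rho> ` I)"
    by (rule iffD1[OF bij_betw_cong[of I \<rho>]]) (use assms in \<open>auto simp: \<sigma>_def bij_betw_def\<close>)
  have b2: "bij_betw \<sigma> (?S - I) (?S - \<rho> ` I)"
    by (rule iffD1[OF bij_betw_cong[of "?S - I" f]]) (use f in \<open>auto simp: \<sigma>_def\<close>)
  have "bij_betw \<sigma> (I \<union> (?S - I)) (\<rho> ` I \<union> (?S - \<rho> ` I))"
    by (rule bij_betw_combine[OF b1 b2]) auto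
  moreover have "I \<union> (?S - I) = ?S" "\<rho> ` I \<union> (?S - \<rho> ` I) = ?S" by auto
  ultimately have "bij_betw \<sigma> ?S ?S" by simp
  then have p: "\<sigma> permutes ?S"
    by (rule bij_imp_permutes) (auto simp: \<sigma>_def)
  have "\<sigma> permutes {1..}" by (rule permutes_subset[OF p]) (use assms in auto)
  moreover have "finite {i. \<sigma> i \<noteq> i}"
    by (rule finite_subset[OF _ fin]) (auto simp: \<sigma>_def)
  ultimately have "finite_permutation \<sigma>" by (simp add: finite_permutation_def)
  then show ?thesis by (rule that) (auto simp: \<sigma>_def)
qed

lemma random_matrix_relabel:
  assumes "random_matrix M Y" "\<rho> ` {1..} \<subseteq> {1..}" "\<kappa> ` {1..} \<subseteq> {1..}"
  shows "random_matrix M (\<lambda>i j. Y (\<rho> i) (\<kappa> j))"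
  using assms by (auto simp: random_matrix_def image_subset_iff)

lemma block_functional_cong:
  assumes "block_functional I J N G" "\<And>i j. i \<in> I \<Longrightarrow> j \<in> J \<Longrightarrow> y i j = y' i j"
  shows "G y = G y'"
proof -
  obtain g where g: "g \<in> measurable (submatrix_space I J) N"
    "G = (\<lambda>y. g (\<lambda>(i, j)\<in>I \<times> J. y i j))" using assms(1) by (rule block_functionalE)
  have "(\<lambda>(i, j)\<in>I \<times> J. y i j) = (\<lambda>(i, j)\<in>I \<times> J. y' i j)"
    using assms(2) by (auto simp: restrict_def fun_eq_iff)
  then show ?thesis by (simp only: g(2))
qed

locale rce_matrix = prob_space M for M :: "'w measure" +
  fixes Y :: "nat \<Rightarrow> nat \<Rightarrow> 'w \<Rightarrow> real"
  assumes rce: "RCE M Y"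
begin

lemma random_matrix: "random_matrix M Y"
  using rce by (simp add: RCE_def)

abbreviation (input) at_Y :: "((nat \<Rightarrow> nat \<Rightarrow> real) \<Rightarrow> 'b) \<Rightarrow> 'w \<Rightarrow> 'b" where
  "at_Y G \<omega> \<equiv> G (\<lambda>i j. Y i j \<omega>)"

abbreviation (input) at_relabelled ::
    "(nat \<Rightarrow> nat) \<Rightarrow> (nat \<Rightarrow> nat) \<Rightarrow> ((nat \<Rightarrow> nat \<Rightarrow> real) \<Rightarrow> 'b) \<Rightarrow> 'w \<Rightarrow> 'b" where
  "at_relabelled \<rho> \<kappa> G \<omega> \<equiv> G (\<lambda>i j. Y (\<rho> i) (\<kappa> j) \<omega>)"

lemmas functional_measurable = block_functional_measurable[OF random_matrix]

lemma finite_permutation_law: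
  assumes "finite_permutation \<sigma>" "finite_permutation \<tau>" "g \<in> measurable (submatrix_space {1..} {1..}) N"
  shows "distr M N (\<lambda>\<omega>. g (submatrix (\<lambda>i j. Y (\<sigma> i) (\<tau> j)) {1..} {1..} \<omega>)) =
         distr M N (\<lambda>\<omega>. g (submatrix Y {1..} {1..} \<omega>))"
proof -
  let ?S = "submatrix_space {1..} {1..}"
  have perm: "\<pi> ` {1..} \<subseteq> {1..}" if "finite_permutation \<pi>" for \<pi>
    using that permutes_image[of \<pi> "{1..}"] by (auto simp: finite_permutation_def)
  have m: "submatrix (\<lambda>i j. Y (\<sigma> i) (\<tau> j)) {1..} {1..} \<in> measurable M ?S"
    by (rule submatrix_measurable[OF random_matrix_relabel[OF random_matrix
          perm[OF assms(1)] perm[OF assms(2)]]]) auto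
  have m': "submatrix Y {1..} {1..} \<in> measurable M ?S"
    by (intro submatrix_measurable random_matrix) auto
  have "distr M ?S (submatrix (\<lambda>i j. Y (\<sigma> i) (\<tau> j)) {1..} {1..}) = distr M ?S (submatrix Y {1..} {1..})"
    using rce[unfolded RCE_def, THEN conjunct2, rule_format, OF assms(1,2)] .
  then have "distr (distr M ?S (submatrix (\<lambda>i j. Y (\<sigma> i) (\<tau> j)) {1..} {1..})) N g =
    distr (distr M ?S (submatrix Y {1..} {1..})) N g" by simp
  then show ?thesis
    unfolding distr_distr[OF assms(3) m] distr_distr[OF assms(3) m'] comp_def .
qed

text \<open>
  Exchangeability is postulated for finite permutations only. A finite block sees no difference
  between an injective relabelling and a finite permutation extending it, which gives invariance
  under arbitrary relabellings that are injective on the block.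
\<close>

lemma relabel_law:
  assumes G: "block_functional I J N G" and fin: "finite I" "finite J"
    and I: "I \<subseteq> {1..}" "inj_on \<rho> I" "\<rho> ` I \<subseteq> {1..}"
    and J: "J \<subseteq> {1..}" "inj_on \<kappa> J" "\<kappa> ` J \<subseteq> {1..}"
  shows "distr M N (at_relabelled \<rho> \<kappa> G) = distr M N (at_Y G)"
proof -
  obtain \<sigma> where \<sigma>: "finite_permutation \<sigma>" "\<And>i. i \<in> I \<Longrightarrow> \<sigma> i = \<rho> i"
    by (rule finite_permutation_extends[OF fin(1) I]) (rule that)
  obtain \<tau> where \<tau>: "finite_permutation \<tau>" "\<And>j. j \<in> J \<Longrightarrow> \<tau> j = \<kappa> j"
    by (rule finite_permutation_extends[OF fin(2) J]) (rule that)
  obtain g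
    where g: "g \<in> measurable (submatrix_space {1..} {1..}) N"
      "G = (\<lambda>y. g (\<lambda>(i, j)\<in>{1..} \<times> {1..}. y i j))"
    using block_functional_mono[OF G I(1) J(1)] by (rule block_functionalE)
  have "G (\<lambda>i j. Y (\<rho> i) (\<kappa> j) \<omega>) = G (\<lambda>i j. Y (\<sigma> i) (\<tau> j) \<omega>)" for \<omega>
    by (rule block_functional_cong[OF G]) (use \<sigma> \<tau> in auto)
  then have "distr M N (at_relabelled \<rho> \<kappa> G) =
    distr M N (\<lambda>\<omega>. g (submatrix (\<lambda>i j. Y (\<sigma> i) (\<tau> j)) {1..} {1..} \<omega>))"
    by (simp add: g(2) submatrix_def)
  also have "\<dots> = distr M N (\<lambda>\<omega>. g (submatrix Y {1..} {1..} \<omega>))"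
    by (rule finite_permutation_law[OF \<sigma>(1) \<tau>(1) g(1)])
  also have "\<dots> = distr M N (at_Y G)"
    by (simp add: g(2) submatrix_def)
  finally show ?thesis .
qed

lemma relabelled_measurable:
  assumes "block_functional I J N G" "\<rho> ` I \<subseteq> {1..}" "\<kappa> ` J \<subseteq> {1..}"
  shows "at_relabelled \<rho> \<kappa> G \<in> measurable M N"
  by (rule functional_measurable[OF block_functional_relabel[OF assms(1) order.refl order.refl] assms(2,3)])

lemma relabel_integral:
  fixes G :: "(nat \<Rightarrow> nat \<Rightarrow> real) \<Rightarrow> real"
  assumes G: "block_functional I J borel G" and fin: "finite I" "finite J"
    and I: "I \<subseteq> {1..}" "inj_on \<rho> I" "\<rho> ` I \<subseteq> {1..}"
    and J: "J \<subseteq> {1..}" "inj_on \<kappa> J" "\<kappa> ` J \<subseteq> {1..}"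
  shows "integrable M (at_relabelled \<rho> \<kappa> G) \<longleftrightarrow> integrable M (at_Y G)"
    and "expectation (at_relabelled \<rho> \<kappa> G) = expectation (at_Y G)"
proof -
  note meas[measurable] = relabelled_measurable[OF G I(3) J(3)] functional_measurable[OF G I(1) J(1)]
  note eq = relabel_law[OF assms]
  show "integrable M (at_relabelled \<rho> \<kappa> G) \<longleftrightarrow> integrable M (at_Y G)"
    using arg_cong[OF eq, of "\<lambda>D. integrable D (\<lambda>x. x)"] by (simp add: integrable_distr_eq)
  show "expectation (at_relabelled \<rho> \<kappa> G) = expectation (at_Y G)"
    using arg_cong[OF eq, of "\<lambda>D. integral\<^sup>L D (\<lambda>x. x)"] by (simp add: integral_distr)
qed

end

locale dissociated_rce_matrix = rce_matrix +
  assumes dissociated: "dissociated M Y"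
begin

text \<open>
  Dissociation is postulated for an initial block and the complementary infinite corner. Joint laws of
  two finite blocks are invariant under relabelling, so blocks with disjoint rows and disjoint columns can be
  moved into this position.
\<close>

lemma block_indep:
  assumes G: "block_functional I J N G" and G': "block_functional I' J' N' G'"
    and fin: "finite I" "finite J" "finite I'" "finite J'"
    and pos: "I \<subseteq> {1..}" "J \<subseteq> {1..}" "I' \<subseteq> {1..}" "J' \<subseteq> {1..}"
    and disj: "I \<inter> I' = {}" "J \<inter> J' = {}"
  shows "indep_var N (at_Y G) N' (at_Y G')"
proof -
  \<comment> \<open>Shift the second block past the first one in both directions.\<close>
  obtain m where m: "m \<ge> 1" "I \<subseteq> {1..m}"
  proof -
    have "I \<subseteq> {1..Suc (Max (insert 0 I))}"
      using pos(1) fin(1) by (auto intro!: le_SucI Max_ge)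
    then show ?thesis by (intro that) auto
  qed
  obtain n where n: "n \<ge> 1" "J \<subseteq> {1..n}"
  proof -
    have "J \<subseteq> {1..Suc (Max (insert 0 J))}"
      using pos(2) fin(2) by (auto intro!: le_SucI Max_ge)
    then show ?thesis by (intro that) auto
  qed
  define \<rho> where "\<rho> i = (if i \<in> I then i else m + i)" for i
  define \<kappa> where "\<kappa> j = (if j \<in> J then j else n + j)" for j
  have P: "block_functional (I \<union> I') (J \<union> J') (N \<Otimes>\<^sub>M N') (\<lambda>y. (G y, G' y))"
    by (intro block_functional_Pair block_functional_mono[OF G] block_functional_mono[OF G']) auto
  have in_m: "\<And>i. i \<in> I \<Longrightarrow> 1 \<le> i \<and> i \<le> m" and in_n: "\<And>j. j \<in> J \<Longrightarrow> 1 \<le> j \<and> j \<le> n"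
    and in_I': "\<And>i. i \<in> I' \<Longrightarrow> 1 \<le> i \<and> i \<notin> I" and in_J': "\<And>j. j \<in> J' \<Longrightarrow> 1 \<le> j \<and> j \<notin> J"
    using m n pos disj by auto
  have \<rho>_inj: "inj_on \<rho> (I \<union> I')"
  proof (rule inj_onI)
    fix i i' assume "i \<in> I \<union> I'" "i' \<in> I \<union> I'" "\<rho> i = \<rho> i'"
    then show "i = i'" using in_m[of i] in_m[of i'] in_I'[of i] in_I'[of i']
      by (auto simp: \<rho>_def split: if_splits)
  qed
  have \<kappa>_inj: "inj_on \<kappa> (J \<union> J')"
  proof (rule inj_onI)
    fix i i' assume "i \<in> J \<union> J'" "i' \<in> J \<union> J'" "\<kappa> i = \<kappa> i'"
    then show "i = i'" using in_n[of i] in_n[of i'] in_J'[of i] in_J'[of i']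
      by (auto simp: \<kappa>_def split: if_splits)
  qed
  have \<rho>: "\<rho> ` I \<subseteq> {1..}" "\<rho> ` I' \<subseteq> {1..}" "\<rho> ` I \<subseteq> {1..m}" "\<rho> ` I' \<subseteq> {m<..}"
    "inj_on \<rho> I" "inj_on \<rho> I'"
    using m(1) in_m in_I' inj_on_subset[OF \<rho>_inj] by (auto simp: \<rho>_def Suc_le_eq)
  have \<kappa>: "\<kappa> ` J \<subseteq> {1..}" "\<kappa> ` J' \<subseteq> {1..}" "\<kappa> ` J \<subseteq> {1..n}" "\<kappa> ` J' \<subseteq> {n<..}"
    "inj_on \<kappa> J" "inj_on \<kappa> J'"
    using n(1) in_n in_J' inj_on_subset[OF \<kappa>_inj] by (auto simp: \<kappa>_def Suc_le_eq)
  obtain g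
    where g: "g \<in> measurable (submatrix_space {1..m} {1..n}) N"
      "(\<lambda>y. G (\<lambda>i j. y (\<rho> i) (\<kappa> j))) = (\<lambda>y. g (\<lambda>(i, j)\<in>{1..m} \<times> {1..n}. y i j))"
    using block_functional_relabel[OF G \<rho>(3) \<kappa>(3)] by (rule block_functionalE)
  obtain g'
    where g': "g' \<in> measurable (submatrix_space {m<..} {n<..}) N'"
      "(\<lambda>y. G' (\<lambda>i j. y (\<rho> i) (\<kappa> j))) = (\<lambda>y. g' (\<lambda>(i, j)\<in>{m<..} \<times> {n<..}. y i j))"
    using block_functional_relabel[OF G' \<rho>(4) \<kappa>(4)] by (rule block_functionalE)
  have "indep_var N (g \<circ> submatrix Y {1..m} {1..n}) N' (g' \<circ> submatrix Y {m<..} {n<..})"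
    by (rule indep_var_compose[OF _ g(1) g'(1)])
       (use dissociated m(1) n(1) in \<open>simp add: dissociated_def\<close>)
  moreover have "g \<circ> submatrix Y {1..m} {1..n} = at_relabelled \<rho> \<kappa> G"
    using fun_cong[OF g(2), of "\<lambda>i j. Y i j _"] by (simp add: submatrix_def fun_eq_iff)
  moreover have "g' \<circ> submatrix Y {m<..} {n<..} = at_relabelled \<rho> \<kappa> G'"
    using fun_cong[OF g'(2), of "\<lambda>i j. Y i j _"] by (simp add: submatrix_def fun_eq_iff)
  ultimately have ind: "indep_var N (at_relabelled \<rho> \<kappa> G) N' (at_relabelled \<rho> \<kappa> G')"
    by simp
  have "distr M N (at_relabelled \<rho> \<kappa> G) = distr M N (at_Y G)"
    by (rule relabel_law[OF G fin(1,2) pos(1) \<rho>(5,1) pos(2) \<kappa>(5,1)])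
  moreover have "distr M N' (at_relabelled \<rho> \<kappa> G') = distr M N' (at_Y G')"
    by (rule relabel_law[OF G' fin(3,4) pos(3) \<rho>(6,2) pos(4) \<kappa>(6,2)])
  moreover have "distr M (N \<Otimes>\<^sub>M N') (at_relabelled \<rho> \<kappa> (\<lambda>y. (G y, G' y))) =
      distr M (N \<Otimes>\<^sub>M N') (at_Y (\<lambda>y. (G y, G' y)))"
    by (rule relabel_law[OF P _ _ _ \<rho>_inj _ _ \<kappa>_inj]) (use fin pos \<rho>(1,2) \<kappa>(1,2) in \<open>simp_all add: image_Un\<close>)
  ultimately show ?thesis
    using ind functional_measurable[OF G pos(1,2)] functional_measurable[OF G' pos(3,4)]
    by (simp add: indep_var_distribution_eq)
qed

end

section \<open>Symmetric kernels and U-statistics\<close>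

text \<open>
  The generic matrix: an expression built from \<open>Y\<close>, taken at \<open>entries\<close>, is the
  corresponding functional of a deterministic matrix.
\<close>

abbreviation entries :: "nat \<Rightarrow> nat \<Rightarrow> (nat \<Rightarrow> nat \<Rightarrow> real) \<Rightarrow> real" where
  "entries \<equiv> (\<lambda>i j y. y i j)"

definition pairs :: "nat \<Rightarrow> (nat \<times> nat) set" where
  "pairs m = {(i\<^sub>1, i\<^sub>2). 1 \<le> i\<^sub>1 \<and> i\<^sub>1 < i\<^sub>2 \<and> i\<^sub>2 \<le> m}"

lemma finite_pairs [simp]: "finite (pairs m)"
  by (rule finite_subset[of _ "{1..m} \<times> {1..m}"]) (auto simp: pairs_def)

text \<open>
  Sums over ordered pairs of distinct indices are easier to reindex and to count than sums over
  \<open>i\<^sub>1 < i\<^sub>2\<close>.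
\<close>

lemma sum_pairs_symmetric:
  fixes f :: "nat \<Rightarrow> nat \<Rightarrow> real"
  assumes "\<And>i i'. f i i' = f i' i"
  shows "2 * (\<Sum>(i\<^sub>1, i\<^sub>2)\<in>pairs m. f i\<^sub>1 i\<^sub>2) = (\<Sum>i\<in>{1..m}. \<Sum>i'\<in>{1..m} - {i}. f i i')"
proof -
  let ?swap = "\<lambda>(i, i'). (i', i) :: nat \<times> nat"
  have "(\<Sum>i\<in>{1..m}. \<Sum>i'\<in>{1..m} - {i}. f i i') =
        (\<Sum>(i, i')\<in>(SIGMA i:{1..m}. {1..m} - {i}). f i i')"
    by (rule sum.Sigma) auto
  also have "(SIGMA i:{1..m}. {1..m} - {i}) = pairs m \<union> ?swap ` pairs m"
    by (auto simp: pairs_def image_iff)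
  also have "(\<Sum>(i, i')\<in>pairs m \<union> ?swap ` pairs m. f i i') =
      (\<Sum>(i, i')\<in>pairs m. f i i') + (\<Sum>(i, i')\<in>?swap ` pairs m. f i i')"
    by (rule sum.union_disjoint, simp, simp) (auto simp: pairs_def)
  also have "(\<Sum>(i, i')\<in>?swap ` pairs m. f i i') = (\<Sum>(i, i')\<in>pairs m. f i i')"
    by (subst sum.reindex) (auto simp: inj_on_def assms intro!: sum.cong)
  finally show ?thesis by simp
qed

lemma sum_pairs_permute:
  fixes f :: "nat \<Rightarrow> nat \<Rightarrow> real"
  assumes sym: "\<And>i i'. f i i' = f i' i" and \<sigma>: "\<sigma> permutes {1..m}"
  shows "(\<Sum>(i\<^sub>1, i\<^sub>2)\<in>pairs m. f (\<sigma> i\<^sub>1) (\<sigma> i\<^sub>2)) = (\<Sum>(i\<^sub>1, i\<^sub>2)\<in>pairs m. f i\<^sub>1 i\<^sub>2)"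
proof -
  have "(\<Sum>i\<in>{1..m}. \<Sum>i'\<in>{1..m} - {i}. f (\<sigma> i) (\<sigma> i')) =
      (\<Sum>i\<in>{1..m}. \<Sum>i'\<in>{1..m} - {\<sigma> i}. f (\<sigma> i) i')"
  proof (rule sum.cong[OF refl])
    fix i assume i: "i \<in> {1..m}"
    have "bij_betw \<sigma> ({1..m} - {i}) ({1..m} - {\<sigma> i})"
      using bij_betw_DiffI[OF permutes_imp_bij[OF \<sigma>], of "{i}" "{\<sigma> i}"] i
        permutes_in_image[OF \<sigma>, of i]
      by (simp add: bij_betw_def)
    from sum.reindex_bij_betw[OF this, of "f (\<sigma> i)"]
    show "(\<Sum>i'\<in>{1..m} - {i}. f (\<sigma> i) (\<sigma> i')) = (\<Sum>i'\<in>{1..m} - {\<sigma> i}. f (\<sigma> i) i')" .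
  qed
  also have "\<dots> = (\<Sum>i\<in>{1..m}. \<Sum>i'\<in>{1..m} - {i}. f i i')"
    by (rule sum.reindex_bij_betw[OF permutes_imp_bij[OF \<sigma>]])
  finally show ?thesis
    using sum_pairs_symmetric[of f m] sum_pairs_symmetric[of "\<lambda>i i'. f (\<sigma> i) (\<sigma> i')" m] sym
    by simp
qed

lemma U_stat_pairs:
  "U_stat h Y m n \<omega> = inverse (real (m choose 2)) * inverse (real (n choose 2)) *
     (\<Sum>(i\<^sub>1, i\<^sub>2)\<in>pairs m. \<Sum>(j\<^sub>1, j\<^sub>2)\<in>pairs n. h (quadruplet Y i\<^sub>1 i\<^sub>2 j\<^sub>1 j\<^sub>2 \<omega>))"
  by (simp add: U_stat_def pairs_def)

lemma quadruplet_kernel_swap: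
  assumes "quadruplet_kernel h"
  shows "h (quadruplet Y i\<^sub>2 i\<^sub>1 j\<^sub>1 j\<^sub>2 \<omega>) = h (quadruplet Y i\<^sub>1 i\<^sub>2 j\<^sub>1 j\<^sub>2 \<omega>)"
    and "h (quadruplet Y i\<^sub>1 i\<^sub>2 j\<^sub>2 j\<^sub>1 \<omega>) = h (quadruplet Y i\<^sub>1 i\<^sub>2 j\<^sub>1 j\<^sub>2 \<omega>)"
  using assms by (simp_all add: quadruplet_kernel_def quadruplet_def)

lemma U_stat_permute:
  assumes h: "quadruplet_kernel h" and \<sigma>: "\<sigma> permutes {1..m}" and \<tau>: "\<tau> permutes {1..n}"
  shows "U_stat h (\<lambda>i j. Y (\<sigma> i) (\<tau> j)) m n \<omega> = U_stat h Y m n \<omega>"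
proof -
  let ?q = "\<lambda>i\<^sub>1 i\<^sub>2 j\<^sub>1 j\<^sub>2. h (quadruplet Y i\<^sub>1 i\<^sub>2 j\<^sub>1 j\<^sub>2 \<omega>)"
  have "(\<Sum>(i\<^sub>1, i\<^sub>2)\<in>pairs m. \<Sum>(j\<^sub>1, j\<^sub>2)\<in>pairs n. ?q (\<sigma> i\<^sub>1) (\<sigma> i\<^sub>2) (\<tau> j\<^sub>1) (\<tau> j\<^sub>2)) =
     (\<Sum>(i\<^sub>1, i\<^sub>2)\<in>pairs m. \<Sum>(j\<^sub>1, j\<^sub>2)\<in>pairs n. ?q (\<sigma> i\<^sub>1) (\<sigma> i\<^sub>2) j\<^sub>1 j\<^sub>2)"
    by (intro sum.cong refl)
       (simp only: split_def, subst sum_pairs_permute[OF _ \<tau>, unfolded split_def],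
         simp_all add: quadruplet_kernel_swap[OF h])
  also have "\<dots> = (\<Sum>(i\<^sub>1, i\<^sub>2)\<in>pairs m. \<Sum>(j\<^sub>1, j\<^sub>2)\<in>pairs n. ?q i\<^sub>1 i\<^sub>2 j\<^sub>1 j\<^sub>2)"
    by (rule sum_pairs_permute[OF _ \<sigma>, of "\<lambda>i\<^sub>1 i\<^sub>2. \<Sum>(j\<^sub>1, j\<^sub>2)\<in>pairs n. ?q i\<^sub>1 i\<^sub>2 j\<^sub>1 j\<^sub>2"])
       (simp add: quadruplet_kernel_swap[OF h])
  finally show ?thesis
    by (simp add: U_stat_pairs quadruplet_def)
qed

text \<open>
  Reduces the measurability of the random matrix \<open>mat22\<close> to that of its entries.
\<close>

lemma mat22_linear:
  "mat22 a b c d = a *\<^sub>R mat22 1 0 0 0 + b *\<^sub>R mat22 0 1 0 0 + c *\<^sub>R mat22 0 0 1 0 + d *\<^sub>R mat22 0 0 0 1"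
  by (simp add: mat22_def vec_eq_iff forall_2)

lemma block_functional_quadruplet:
  assumes "quadruplet_kernel h" "i\<^sub>1 \<in> I" "i\<^sub>2 \<in> I" "j\<^sub>1 \<in> J" "j\<^sub>2 \<in> J"
  shows "block_functional I J borel (\<lambda>y. h (quadruplet entries i\<^sub>1 i\<^sub>2 j\<^sub>1 j\<^sub>2 y))"
proof (rule block_functional_compose[where f=h and G="quadruplet entries i\<^sub>1 i\<^sub>2 j\<^sub>1 j\<^sub>2" and N=borel])
  show "h \<in> borel_measurable borel" using assms(1) by (simp add: quadruplet_kernel_def)
  have *: "block_functional I J borel (\<lambda>y. y i j *\<^sub>R e)" if "i \<in> I" "j \<in> J" for i j and e :: "real^2^2"
    by (rule block_functional_compose[OF block_functional_entry[OF that]]) simp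
  have add: "block_functional I J borel (\<lambda>y. f y + g y)"
    if "block_functional I J borel f" "block_functional I J borel g"
    for f g :: "(nat \<Rightarrow> nat \<Rightarrow> real) \<Rightarrow> real^2^2"
    using that by (intro block_functional_binary[where f="(+)" and N=borel and N'=borel]) auto
  have eq: "quadruplet entries i\<^sub>1 i\<^sub>2 j\<^sub>1 j\<^sub>2 = (\<lambda>y. y i\<^sub>1 j\<^sub>1 *\<^sub>R mat22 1 0 0 0 +
      y i\<^sub>1 j\<^sub>2 *\<^sub>R mat22 0 1 0 0 + y i\<^sub>2 j\<^sub>1 *\<^sub>R mat22 0 0 1 0 + y i\<^sub>2 j\<^sub>2 *\<^sub>R mat22 0 0 0 1)"
    unfolding quadruplet_def[abs_def] by (rule ext) (rule mat22_linear)
  show "block_functional I J borel (quadruplet entries i\<^sub>1 i\<^sub>2 j\<^sub>1 j\<^sub>2)"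
    unfolding eq by (intro add * assms)
qed

lemma block_functional_U_stat:
  assumes "quadruplet_kernel h"
  shows "block_functional {1..m} {1..n} borel (U_stat h entries m n)"
proof -
  have "block_functional {1..m} {1..n} borel
     (\<lambda>y. \<Sum>p\<in>pairs m. \<Sum>r\<in>pairs n. h (quadruplet entries (fst p) (snd p) (fst r) (snd r) y))"
    by (intro block_functional_sum block_functional_quadruplet[OF assms]) (auto simp: pairs_def)
  from block_functional_compose[OF this, of "\<lambda>x. inverse (real (m choose 2)) * inverse (real (n choose 2)) * x" borel]
  show ?thesis
    by (simp add: U_stat_pairs[abs_def] split_def)
qed

lemma U_stat_entries: "U_stat h entries m n (\<lambda>i j. Y i j \<omega>) = U_stat h Y m n \<omega>"
  by (simp add: U_stat_def quadruplet_def)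

lemma quadruplet_entries: "quadruplet entries i i' j j' (\<lambda>i j. Y i j \<omega>) = quadruplet Y i i' j j' \<omega>"
  by (simp add: quadruplet_def)

section \<open>Triviality of the tail\<close>

text \<open>
  This is Bessel's inequality for orthogonal \<open>g\<^sub>k\<close> with equal inner products \<open>a\<close> with \<open>1\<^sub>A\<close>:
  \<open>K a\<^sup>2 \<le> L\<^sup>2\<close>, obtained by expanding the square of \<open>\<Sum>g\<^sub>k - K a 1\<^sub>A\<close>. It is the form of the law of large numbers
  that makes invariant events independent of finite blocks.
\<close>

lemma (in prob_space) zero_if_many_orthogonal:
  fixes a L :: real
  assumes A: "A \<in> sets M"
    and ex: "\<And>K. \<exists>g :: nat \<Rightarrow> 'a \<Rightarrow> real. (\<forall>k<K. g k \<in> borel_measurable M \<and> (\<forall>\<omega>. \<bar>g k \<omega>\<bar> \<le> L) \<and>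
       expectation (\<lambda>\<omega>. g k \<omega> * indicator A \<omega>) = a) \<and>
       (\<forall>k<K. \<forall>k'<K. k \<noteq> k' \<longrightarrow> expectation (\<lambda>\<omega>. g k \<omega> * g k' \<omega>) = 0)"
  shows "a = 0"
proof (rule ccontr)
  assume "a \<noteq> 0"
  then obtain K :: nat where K: "L\<^sup>2 < real K * a\<^sup>2"
    using reals_Archimedean3[of "a\<^sup>2", THEN spec, of "L\<^sup>2"] by auto
  obtain g :: "nat \<Rightarrow> 'a \<Rightarrow> real" where m: "\<And>k. k < K \<Longrightarrow> g k \<in> borel_measurable M"
    and b: "\<And>k \<omega>. k < K \<Longrightarrow> \<bar>g k \<omega>\<bar> \<le> L"
    and a: "\<And>k. k < K \<Longrightarrow> expectation (\<lambda>\<omega>. g k \<omega> * indicator A \<omega>) = a"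
    and o: "\<And>k k'. k < K \<Longrightarrow> k' < K \<Longrightarrow> k \<noteq> k' \<Longrightarrow> expectation (\<lambda>\<omega>. g k \<omega> * g k' \<omega>) = 0"
    using ex[of K] by blast
  have K0: "K > 0" using K by (cases K) auto
  have L: "0 \<le> L" using b[OF K0] abs_ge_zero order_trans by blast
  have gg: "integrable M (\<lambda>\<omega>. g k \<omega> * g k' \<omega>)" if "k < K" "k' < K" for k k'
    using m[OF that(1)] m[OF that(2)] b[OF that(1)] b[OF that(2)] L
    by (intro integrable_const_bound[where B="L * L"]) (auto simp: abs_mult intro!: mult_mono)
  have gA: "integrable M (\<lambda>\<omega>. g k \<omega> * indicator A \<omega>)" if "k < K" for k
    using m[OF that] b[OF that] A L
    by (intro integrable_const_bound[where B="L"]) (auto simp: abs_mult indicator_def)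
  have sq: "expectation (\<lambda>\<omega>. g k \<omega> * g k \<omega>) \<le> L\<^sup>2" if "k < K" for k
  proof -
    have "g k \<omega> * g k \<omega> \<le> L\<^sup>2" for \<omega>
      using b[OF that, of \<omega>] abs_le_square_iff[of "g k \<omega>" L] L by (simp add: power2_eq_square)
    then have "expectation (\<lambda>\<omega>. g k \<omega> * g k \<omega>) \<le> expectation (\<lambda>_. L\<^sup>2)"
      using integral_mono[OF gg[OF that that], of "\<lambda>_. L\<^sup>2"]
      by (simp add: prob_space)
    then show ?thesis by (simp add: prob_space)
  qed
  let ?S = "\<lambda>\<omega>. (\<Sum>k<K. g k \<omega>)" and ?c = "real K * a"
  have "0 \<le> expectation (\<lambda>\<omega>. (?S \<omega> - ?c * indicator A \<omega>)\<^sup>2)"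
    by (rule integral_nonneg_AE) simp
  also have "(\<lambda>\<omega>. (?S \<omega> - ?c * indicator A \<omega>)\<^sup>2) = (\<lambda>\<omega>. (\<Sum>k<K. \<Sum>k'<K. g k \<omega> * g k' \<omega>)
       - 2 * ?c * (\<Sum>k<K. g k \<omega> * indicator A \<omega>) + ?c\<^sup>2 * indicator A \<omega>)"
  proof
    fix \<omega>
    have "(\<Sum>k<K. \<Sum>k'<K. g k \<omega> * g k' \<omega>) = ?S \<omega> * ?S \<omega>" by (simp add: sum_product)
    moreover have "(\<Sum>k<K. g k \<omega> * indicator A \<omega>) = ?S \<omega> * indicator A \<omega>"
      by (simp add: sum_distrib_right)
    ultimately show "(?S \<omega> - ?c * indicator A \<omega>)\<^sup>2 = (\<Sum>k<K. \<Sum>k'<K. g k \<omega> * g k' \<omega>)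
       - 2 * ?c * (\<Sum>k<K. g k \<omega> * indicator A \<omega>) + ?c\<^sup>2 * indicator A \<omega>"
      by (simp add: power2_eq_square algebra_simps indicator_def)
  qed
  also have "expectation \<dots> = (\<Sum>k<K. \<Sum>k'<K. expectation (\<lambda>\<omega>. g k \<omega> * g k' \<omega>))
       - 2 * ?c * (\<Sum>k<K. expectation (\<lambda>\<omega>. g k \<omega> * indicator A \<omega>)) + ?c\<^sup>2 * prob A"
  proof -
    have I: "integrable M (\<lambda>\<omega>. \<Sum>k<K. \<Sum>k'<K. g k \<omega> * g k' \<omega>)"
      "integrable M (\<lambda>\<omega>. \<Sum>k<K. g k \<omega> * indicator A \<omega>)"
      by (intro Bochner_Integration.integrable_sum gg gA; simp)+
    have lin: "expectation (\<lambda>\<omega>. P \<omega> - x * Q \<omega> + y * R \<omega>) =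
      expectation P - x * expectation Q + y * expectation R"
      if "integrable M P" "integrable M Q" "integrable M R" for P Q R :: "'a \<Rightarrow> real" and x y
      using that by simp
    have "expectation (\<lambda>\<omega>. \<Sum>k<K. \<Sum>k'<K. g k \<omega> * g k' \<omega>) =
        (\<Sum>k<K. \<Sum>k'<K. expectation (\<lambda>\<omega>. g k \<omega> * g k' \<omega>))"
      by (subst Bochner_Integration.integral_sum, intro Bochner_Integration.integrable_sum gg, simp, simp,
          intro sum.cong refl Bochner_Integration.integral_sum gg) simp_all
    moreover have "expectation (\<lambda>\<omega>. \<Sum>k<K. g k \<omega> * indicator A \<omega>) =
        (\<Sum>k<K. expectation (\<lambda>\<omega>. g k \<omega> * indicator A \<omega>))"
      by (intro Bochner_Integration.integral_sum gA) simp
    moreover have "integrable M (indicator A :: 'a \<Rightarrow> real)" "expectation (indicator A) = prob A"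
      using A by (auto intro!: integrable_const_bound[where B=1])
    ultimately show ?thesis by (simp only: lin[OF I])
  qed
  also have "(\<Sum>k<K. \<Sum>k'<K. expectation (\<lambda>\<omega>. g k \<omega> * g k' \<omega>)) = (\<Sum>k<K. expectation (\<lambda>\<omega>. g k \<omega> * g k \<omega>))"
  proof (rule sum.cong[OF refl])
    fix k assume "k \<in> {..<K}"
    then have "(\<Sum>k'<K. expectation (\<lambda>\<omega>. g k \<omega> * g k' \<omega>)) =
      (\<Sum>k'<K. if k' = k then expectation (\<lambda>\<omega>. g k \<omega> * g k \<omega>) else 0)"
      by (intro sum.cong) (auto simp: o)
    then show "(\<Sum>k'<K. expectation (\<lambda>\<omega>. g k \<omega> * g k' \<omega>)) = expectation (\<lambda>\<omega>. g k \<omega> * g k \<omega>)"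
      using \<open>k \<in> {..<K}\<close> by simp
  qed
  also have "\<dots> \<le> real K * L\<^sup>2" using sum_bounded_above[of "{..<K}" _ "L\<^sup>2"] sq by simp
  also have "(\<Sum>k<K. expectation (\<lambda>\<omega>. g k \<omega> * indicator A \<omega>)) = real K * a"
    using a by simp
  also have "?c\<^sup>2 * prob A \<le> ?c\<^sup>2 * 1" by (intro mult_left_mono) auto
  finally have "0 \<le> real K * L\<^sup>2 - 2 * ?c * (real K * a) + ?c\<^sup>2 * 1" by simp
  then have "real K * (real K * a\<^sup>2) \<le> real K * L\<^sup>2"
    by (simp add: power2_eq_square algebra_simps)
  then show False using K K0 by simp
qed

lemma m_dim_unbounded:
  assumes "0 < c"
  shows "\<exists>N\<^sub>0. \<forall>N\<ge>N\<^sub>0. R \<le> m_dim c N"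
proof -
  obtain N\<^sub>0 :: nat where N\<^sub>0: "real R < real N\<^sub>0 * c"
    using reals_Archimedean3[OF assms, THEN spec, of "real R"] by auto
  have "R \<le> m_dim c N" if "N \<ge> N\<^sub>0" for N
  proof -
    have "real N\<^sub>0 * c \<le> c * (real N + 1)" using that assms
      by (subst mult.commute) (intro mult_left_mono, auto)
    with N\<^sub>0 have "int R \<le> \<lfloor>c * (real N + 1)\<rfloor>" by (simp add: le_floor_iff)
    then show ?thesis by (simp add: m_dim_def)
  qed
  then show ?thesis by blast
qed

lemma n_dim_unbounded:
  assumes "c < 1"
  shows "\<exists>N\<^sub>0. \<forall>N\<ge>N\<^sub>0. R \<le> n_dim c N"
  using m_dim_unbounded[of "1 - c" R] assms by (simp add: m_dim_def n_dim_def)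

locale kernel_matrix = dissociated_rce_matrix +
  fixes h :: "real^2^2 \<Rightarrow> real"
  assumes kernel: "quadruplet_kernel h"
    and square_integrable: "integrable M (\<lambda>\<omega>. (h (quadruplet Y 1 2 1 2 \<omega>))\<^sup>2)"
begin

text \<open>
  The events \<open>B\<close> for which both preimages agree form a \<open>\<sigma>\<close>-algebra, so it suffices to treat the
  generators. There \<open>k \<ge> m\<close> and \<open>l \<ge> n\<close>, so \<open>\<sigma>\<close> and \<open>\<tau>\<close> merely permute the summands of \<open>U\<^sub>k\<^sub>,\<^sub>l\<close>.
\<close>

lemma F_N_invariant:
  assumes \<sigma>: "\<sigma> permutes {1..m_dim c N}" and \<tau>: "\<tau> permutes {1..n_dim c N}"
    and A: "A \<in> sets (F_N M c h Y N)"
  obtains B where "B \<in> sets (submatrix_space {1..} {1..})"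
    "A = submatrix Y {1..} {1..} -` B \<inter> space M"
    "A = submatrix (\<lambda>i j. Y (\<sigma> i) (\<tau> j)) {1..} {1..} -` B \<inter> space M"
proof -
  let ?S = "submatrix_space {1..} {1..}"
  let ?Y = "submatrix Y {1..} {1..}" and ?Y' = "submatrix (\<lambda>i j. Y (\<sigma> i) (\<tau> j)) {1..} {1..}"
  let ?G = "{U_stat h Y k l -` B \<inter> space M | k l B. k \<ge> m_dim c N \<and> l \<ge> n_dim c N \<and> B \<in> sets borel}"
  have sp: "submatrix Z {1..} {1..} \<omega> \<in> space ?S" for Z :: "nat \<Rightarrow> nat \<Rightarrow> 'a \<Rightarrow> real" and \<omega>
    by (auto simp: submatrix_def submatrix_space_def space_PiM PiE_def)
  have "?G \<subseteq> Pow (space M)" by auto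
  then have "A \<in> sigma_sets (space M) ?G" using A by (simp add: F_N_def)
  then have "\<exists>B\<in>sets ?S. A = ?Y -` B \<inter> space M \<and> A = ?Y' -` B \<inter> space M"
  proof induction
    case (Basic A)
    then obtain k l S where kl: "k \<ge> m_dim c N" "l \<ge> n_dim c N" and S: "S \<in> sets borel"
      and A: "A = U_stat h Y k l -` S \<inter> space M" by auto
    have "block_functional {1..} {1..} borel (U_stat h entries k l)"
      by (rule block_functional_mono[OF block_functional_U_stat[OF kernel]]) auto
    then obtain g where g: "g \<in> borel_measurable ?S"
      "U_stat h entries k l = (\<lambda>y. g (\<lambda>(i, j)\<in>{1..} \<times> {1..}. y i j))"
      by (rule block_functionalE)
    have gY: "g (submatrix Z {1..} {1..} \<omega>) = U_stat h Z k l \<omega>" for Z \<omega>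
      using fun_cong[OF g(2), of "\<lambda>i j. Z i j \<omega>"] U_stat_entries[of h k l Z \<omega>]
      by (simp add: submatrix_def)
    have "\<sigma> permutes {1..k}" "\<tau> permutes {1..l}"
      using kl by (auto intro!: permutes_subset[OF \<sigma>] permutes_subset[OF \<tau>])
    then have inv: "U_stat h (\<lambda>i j. Y (\<sigma> i) (\<tau> j)) k l \<omega> = U_stat h Y k l \<omega>" for \<omega>
      by (rule U_stat_permute[OF kernel])
    show ?case
    proof (rule bexI[of _ "g -` S \<inter> space ?S"])
      show "A = ?Y -` (g -` S \<inter> space ?S) \<inter> space M \<and> A = ?Y' -` (g -` S \<inter> space ?S) \<inter> space M"
        unfolding A using sp by (auto simp: gY[unfolded One_nat_def] inv)
      show "g -` S \<inter> space ?S \<in> sets ?S" by (rule measurable_sets[OF g(1) S])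
    qed
  next
    case Empty
    show ?case by (rule bexI[of _ "{}"]) auto
  next
    case (Compl A)
    then obtain B where B: "B \<in> sets ?S" "A = ?Y -` B \<inter> space M" "A = ?Y' -` B \<inter> space M" by auto
    have "space M - A = ?Y -` (space ?S - B) \<inter> space M"
      unfolding B(2) using sp[of Y] by blast
    moreover have "space M - A = ?Y' -` (space ?S - B) \<inter> space M"
      unfolding B(3) using sp[of "\<lambda>i j. Y (\<sigma> i) (\<tau> j)"] by blast
    ultimately show ?case using B(1) by (intro bexI[of _ "space ?S - B"]) simp_all
  next
    case (Union A)
    have "\<forall>i. \<exists>B. B \<in> sets ?S \<and> A i = ?Y -` B \<inter> space M \<and> A i = ?Y' -` B \<inter> space M"
      by (rule allI) (rule Union.IH[unfolded Bex_def])
    from choice[OF this] obtain B where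
      all: "\<forall>i. B i \<in> sets ?S \<and> A i = ?Y -` B i \<inter> space M \<and> A i = ?Y' -` B i \<inter> space M" ..
    have B: "\<And>i. B i \<in> sets ?S" "\<And>i. A i = ?Y -` B i \<inter> space M"
      "\<And>i. A i = ?Y' -` B i \<inter> space M"
      using all[THEN spec, THEN conjunct1] all[THEN spec, THEN conjunct2, THEN conjunct1]
        all[THEN spec, THEN conjunct2, THEN conjunct2] .
    show ?case
    proof (rule bexI[of _ "\<Union>i. B i"])
      have "(\<Union>i. A i) = ?Y -` (\<Union>i. B i) \<inter> space M"
        unfolding B(2) by blast
      moreover have "(\<Union>i. A i) = ?Y' -` (\<Union>i. B i) \<inter> space M"
        unfolding B(3) by blast
      ultimately show "(\<Union>i. A i) = ?Y -` (\<Union>i. B i) \<inter> space M \<and> (\<Union>i. A i) = ?Y' -` (\<Union>i. B i) \<inter> space M"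
        by (rule conjI)
      show "(\<Union>i. B i) \<in> sets ?S" using B(1) by (intro sets.countable_UN) blast
    qed
  qed
  then obtain B where "B \<in> sets ?S" "A = ?Y -` B \<inter> space M" "A = ?Y' -` B \<inter> space M"
    by blast
  then show ?thesis by (rule that)
qed

lemma sets_F_N_subset: "sets (F_N M c h Y N) \<subseteq> sets M"
proof
  fix A assume A: "A \<in> sets (F_N M c h Y N)"
  obtain B where "B \<in> sets (submatrix_space {1..} {1..})"
    "A = submatrix Y {1..} {1..} -` B \<inter> space M"
    by (rule F_N_invariant[OF permutes_id permutes_id A]) (rule that)
  then show "A \<in> sets M"
    using measurable_sets[OF submatrix_measurable[OF random_matrix, of "{1..}" "{1..}"]] by auto
qed

lemma subalgebra_F_inf: "subalgebra M (F_inf M c h Y)"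
  using sets_F_N_subset[of c 1] by (auto simp: subalgebra_def sets_F_inf)

text \<open>
  The block \<open>{1..r} \<times> {1..r}\<close> is moved down the diagonal by multiples of \<open>r\<close>. The copies are pairwise
  independent by dissociation, and each has the same inner product with \<open>1\<^sub>A\<close> because the shift
  is a finite permutation leaving \<open>A\<close> invariant.
\<close>

lemma bounded_block_indep_tail:
  fixes G :: "(nat \<Rightarrow> nat \<Rightarrow> real) \<Rightarrow> real"
  assumes c: "0 < c" "c < 1" and A: "A \<in> sets (F_inf M c h Y)"
    and G: "block_functional {1..r} {1..r} borel G" and L: "\<And>y. \<bar>G y\<bar> \<le> L"
  shows "expectation (\<lambda>\<omega>. at_Y G \<omega> * indicator A \<omega>) = expectation (at_Y G) * prob A"
proof -
  define p where "p = expectation (at_Y G)"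
  define H where "H y = G y - p" for y
  have AM: "A \<in> sets M" using A subalgebra_F_inf[of c] by (auto simp: subalgebra_def)
  have H: "block_functional {1..r} {1..r} borel H"
    unfolding H_def by (rule block_functional_compose[OF G]) simp
  have HL: "\<bar>H y\<bar> \<le> L + \<bar>p\<bar>" for y using L[of y] by (simp add: H_def)
  have meas: "at_Y G \<in> borel_measurable M" by (rule functional_measurable[OF G]) auto
  have int: "integrable M (at_Y G)"
    using meas L by (intro integrable_const_bound[where B=L]) auto
  have intA: "integrable M (\<lambda>\<omega>. at_Y G \<omega> * indicator A \<omega>)"
    using integrable_mult_indicator[OF AM int] by (simp add: mult.commute)
  have EH: "expectation (at_Y H) = 0"
    using int by (simp add: H_def p_def prob_space)
  let ?a = "expectation (\<lambda>\<omega>. at_Y H \<omega> * indicator A \<omega>)"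
  have "?a = 0"
  proof (rule zero_if_many_orthogonal[OF AM])
    fix K
    define s where "s k i = i + k * r" for k i :: nat
    let ?g = "\<lambda>k. at_relabelled (s k) (s k) H"
    have pos: "{1..r} \<subseteq> {1..}" by auto
    have shift: "inj_on (s k) {1..r}" "s k ` {1..r} \<subseteq> {1..}" for k
      by (auto simp: s_def inj_on_def)
    obtain N\<^sub>1 N\<^sub>2 where N12: "\<forall>N\<ge>N\<^sub>1. K * r \<le> m_dim c N" "\<forall>N\<ge>N\<^sub>2. K * r \<le> n_dim c N"
      using m_dim_unbounded[OF c(1)] n_dim_unbounded[OF c(2)] by blast
    define N where "N = max 1 (max N\<^sub>1 N\<^sub>2)"
    have N: "N \<ge> 1" "K * r \<le> m_dim c N" "K * r \<le> n_dim c N"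
      using N12 by (auto simp: N_def)
    have AN: "A \<in> sets (F_N M c h Y N)" using A N(1) by (auto simp: sets_F_inf)
    have "?g k \<in> borel_measurable M" for k
      by (rule relabelled_measurable[OF H shift(2) shift(2)])
    moreover have "expectation (\<lambda>\<omega>. ?g k \<omega> * indicator A \<omega>) = ?a" if k: "k < K" for k
    proof -
      obtain \<sigma> where \<sigma>: "finite_permutation \<sigma>" "\<And>i. i \<in> {1..r} \<Longrightarrow> \<sigma> i = s k i"
        "\<And>i. i \<notin> {1..r} \<union> s k ` {1..r} \<Longrightarrow> \<sigma> i = i"
        by (rule finite_permutation_extends[OF finite_atLeastAtMost pos shift]) (rule that)
      have sub: "{1..r} \<union> s k ` {1..r} \<subseteq> {1..K * r}"
      proof -
        have "Suc k * r \<le> K * r" using k by (intro mult_right_mono) auto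
        then show ?thesis using mult_right_mono[of 1 K r] k by (auto simp: s_def)
      qed
      have "\<sigma> permutes {1..K * r}"
      proof (rule permutes_superset)
        show "\<sigma> permutes {1..}" using \<sigma>(1) by (simp add: finite_permutation_def)
        show "\<sigma> i = i" if "i \<in> {1..} - {1..K * r}" for i
          by (rule \<sigma>(3)) (use that sub in blast)
      qed
      then have perm: "\<sigma> permutes {1..m_dim c N}" "\<sigma> permutes {1..n_dim c N}"
        using N by (auto elim!: permutes_subset)
      obtain B where B: "B \<in> sets (submatrix_space {1..} {1..})"
        "A = submatrix Y {1..} {1..} -` B \<inter> space M"
        "A = submatrix (\<lambda>i j. Y (\<sigma> i) (\<sigma> j)) {1..} {1..} -` B \<inter> space M"
        by (rule F_N_invariant[OF perm AN]) (rule that)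
      have "block_functional {1..} {1..} borel H"
        by (rule block_functional_mono[OF H]) auto
      then obtain f where f: "f \<in> borel_measurable (submatrix_space {1..} {1..})"
        "H = (\<lambda>y. f (\<lambda>(i, j)\<in>{1..} \<times> {1..}. y i j))" by (rule block_functionalE)
      have fY: "f (submatrix Z {1..} {1..} \<omega>) = H (\<lambda>i j. Z i j \<omega>)" for Z \<omega>
        using fun_cong[OF f(2), of "\<lambda>i j. Z i j \<omega>"] by (simp add: submatrix_def)
      let ?\<Phi> = "\<lambda>x. f x * indicator B x"
      have \<Phi>: "?\<Phi> \<in> borel_measurable (submatrix_space {1..} {1..})"
        using f(1) B(1) by simp
      have mY: "submatrix Y {1..} {1..} \<in> measurable M (submatrix_space {1..} {1..})"
        by (rule submatrix_measurable[OF random_matrix]) auto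
      have im: "\<sigma> ` {1..} \<subseteq> {1..}"
        using \<sigma>(1) permutes_image[of \<sigma> "{1..}"] by (auto simp: finite_permutation_def)
      have mY': "submatrix (\<lambda>i j. Y (\<sigma> i) (\<sigma> j)) {1..} {1..} \<in> measurable M (submatrix_space {1..} {1..})"
        by (rule submatrix_measurable[OF random_matrix_relabel[OF random_matrix im im]]) auto
      have "expectation (\<lambda>\<omega>. ?\<Phi> (submatrix (\<lambda>i j. Y (\<sigma> i) (\<sigma> j)) {1..} {1..} \<omega>)) =
            expectation (\<lambda>\<omega>. ?\<Phi> (submatrix Y {1..} {1..} \<omega>))"
      proof -
        have id: "(\<lambda>x. x) \<in> borel_measurable (borel :: real measure)" by simp
        show ?thesis
          using arg_cong[OF finite_permutation_law[OF \<sigma>(1) \<sigma>(1) \<Phi>], of "\<lambda>D. integral\<^sup>L D (\<lambda>x. x)"]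
          unfolding integral_distr[OF measurable_compose[OF mY \<Phi>] id]
            integral_distr[OF measurable_compose[OF mY' \<Phi>] id] .
      qed
      also have "expectation (\<lambda>\<omega>. ?\<Phi> (submatrix Y {1..} {1..} \<omega>)) = ?a"
        by (rule Bochner_Integration.integral_cong[OF refl]) (subst B(2), simp add: fY[unfolded One_nat_def] indicator_def)
      also have "expectation (\<lambda>\<omega>. ?\<Phi> (submatrix (\<lambda>i j. Y (\<sigma> i) (\<sigma> j)) {1..} {1..} \<omega>)) =
          expectation (\<lambda>\<omega>. ?g k \<omega> * indicator A \<omega>)"
      proof (rule Bochner_Integration.integral_cong[OF refl])
        fix \<omega> assume "\<omega> \<in> space M"
        moreover have "H (\<lambda>i j. Y (\<sigma> i) (\<sigma> j) \<omega>) = ?g k \<omega>"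
          by (rule block_functional_cong[OF H]) (simp add: \<sigma>(2))
        ultimately show "?\<Phi> (submatrix (\<lambda>i j. Y (\<sigma> i) (\<sigma> j)) {1..} {1..} \<omega>) = ?g k \<omega> * indicator A \<omega>"
          by (subst B(3)) (simp add: fY[unfolded One_nat_def] indicator_def)
      qed
      finally show ?thesis .
    qed
    moreover have "expectation (\<lambda>\<omega>. ?g k \<omega> * ?g k' \<omega>) = 0" if kk: "k \<noteq> k'" for k k'
    proof -
      have disj: "s k ` {1..r} \<inter> s k' ` {1..r} = {}"
      proof -
        have aux: "i + k * r \<noteq> i' + k' * r" if "i \<in> {1..r}" "i' \<in> {1..r}" "k < k'" for i i' k k'
        proof -
          have "Suc k * r \<le> k' * r" using that(3) by (intro mult_right_mono) auto
          then show ?thesis using that by auto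
        qed
        have "s k i \<noteq> s k' i'" if "i \<in> {1..r}" "i' \<in> {1..r}" for i i'
        proof (cases "k < k'")
          case True
          then show ?thesis using aux[OF that True] by (simp add: s_def)
        next
          case False
          then have "k' < k" using kk by simp
          then show ?thesis using aux[OF that(2,1)] by (metis s_def)
        qed
        then show ?thesis by blast
      qed
      have rel: "block_functional (s k ` {1..r}) (s k ` {1..r}) borel (\<lambda>y. H (\<lambda>i j. y (s k i) (s k j)))" for k
        by (rule block_functional_relabel[OF H]) auto
      have ind: "indep_var borel (?g k) borel (?g k')"
        by (rule block_indep[OF rel[of k] rel[of k']]) (use disj shift(2) in auto)
      have E0: "integrable M (?g k)" "expectation (?g k) = 0" for k
        using relabel_integral[OF H finite_atLeastAtMost finite_atLeastAtMost pos shift pos shift] EH int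
        by (simp_all add: H_def)
      show ?thesis using indep_var_lebesgue_integral[OF ind E0(1) E0(1)] E0(2) by simp
    qed
    ultimately show "\<exists>g :: nat \<Rightarrow> 'a \<Rightarrow> real. (\<forall>k<K. g k \<in> borel_measurable M \<and> (\<forall>\<omega>. \<bar>g k \<omega>\<bar> \<le> L + \<bar>p\<bar>) \<and>
       expectation (\<lambda>\<omega>. g k \<omega> * indicator A \<omega>) = ?a) \<and>
       (\<forall>k<K. \<forall>k'<K. k \<noteq> k' \<longrightarrow> expectation (\<lambda>\<omega>. g k \<omega> * g k' \<omega>) = 0)"
      using HL by (intro exI[of _ ?g]) simp
  qed
  moreover have "?a = expectation (\<lambda>\<omega>. at_Y G \<omega> * indicator A \<omega>) - p * prob A"
  proof -
    have "integrable M (indicator A :: 'a \<Rightarrow> real)"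
      using AM by (auto intro!: integrable_const_bound[where B=1])
    with intA AM show ?thesis by (simp add: H_def left_diff_distrib)
  qed
  ultimately show ?thesis by (simp add: p_def)
qed

text \<open>
  Truncation extends independence to integrable functionals: the kernel being square integrable, a product of
  two of its values, as in the conditional covariances, is merely integrable.
\<close>

lemma block_indep_tail:
  fixes G :: "(nat \<Rightarrow> nat \<Rightarrow> real) \<Rightarrow> real"
  assumes c: "0 < c" "c < 1" and A: "A \<in> sets (F_inf M c h Y)"
    and G: "block_functional {1..r} {1..r} borel G" and int: "integrable M (at_Y G)"
  shows "expectation (\<lambda>\<omega>. at_Y G \<omega> * indicator A \<omega>) = expectation (at_Y G) * prob A"
proof -
  define T where "T l y = max (- real l) (min (real l) (G y))" for l y
  have AM: "A \<in> sets M" using A subalgebra_F_inf[of c] by (auto simp: subalgebra_def)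
  have T: "block_functional {1..r} {1..r} borel (T l)" for l
    unfolding T_def by (rule block_functional_compose[OF G]) simp
  have meas[measurable]: "at_Y G \<in> borel_measurable M" "at_Y (T l) \<in> borel_measurable M" for l
    by (rule functional_measurable[OF G], auto) (rule functional_measurable[OF T], auto)
  have lim: "(\<lambda>l. T l y) \<longlonglongrightarrow> G y" for y
  proof -
    obtain l\<^sub>0 :: nat where "\<bar>G y\<bar> \<le> real l\<^sub>0" using real_arch_simple by blast
    then have "eventually (\<lambda>l. T l y = G y) sequentially"
      by (intro eventually_sequentiallyI[of l\<^sub>0]) (auto simp: T_def max_def min_def)
    then show ?thesis by (rule tendsto_eventually)
  qed
  have bound: "\<bar>T l y\<bar> \<le> \<bar>G y\<bar>" for l y by (auto simp: T_def max_def min_def)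
  note [measurable] = AM
  have "(\<lambda>l. expectation (\<lambda>\<omega>. at_Y (T l) \<omega> * indicator A \<omega>)) \<longlonglongrightarrow>
      expectation (\<lambda>\<omega>. at_Y G \<omega> * indicator A \<omega>)"
    using lim bound int
    by (intro integral_dominated_convergence[where w="\<lambda>\<omega>. \<bar>at_Y G \<omega>\<bar>"])
       (auto intro!: tendsto_intros simp: indicator_def)
  moreover have "(\<lambda>l. expectation (at_Y (T l))) \<longlonglongrightarrow> expectation (at_Y G)"
    using lim bound int
    by (intro integral_dominated_convergence[where w="\<lambda>\<omega>. \<bar>at_Y G \<omega>\<bar>"]) auto
  then have "(\<lambda>l. expectation (at_Y (T l)) * prob A) \<longlonglongrightarrow> expectation (at_Y G) * prob A"
    by (intro tendsto_intros)
  moreover have "expectation (\<lambda>\<omega>. at_Y (T l) \<omega> * indicator A \<omega>) = expectation (at_Y (T l)) * prob A" for l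
    by (rule bounded_block_indep_tail[OF c A T, where L="real l"]) (auto simp: T_def max_def min_def)
  ultimately show ?thesis by (simp add: LIMSEQ_unique)
qed

lemma cond_exp_tail:
  fixes G :: "(nat \<Rightarrow> nat \<Rightarrow> real) \<Rightarrow> real"
  assumes c: "0 < c" "c < 1"
    and G: "block_functional {1..r} {1..r} borel G" and int: "integrable M (at_Y G)"
  shows "AE \<omega> in M. real_cond_exp M (F_inf M c h Y) (at_Y G) \<omega> = expectation (at_Y G)"
proof -
  interpret finite_measure_subalgebra M "F_inf M c h Y"
    by standard (rule subalgebra_F_inf)
  show ?thesis
  proof (rule real_cond_exp_charact)
    fix A assume A: "A \<in> sets (F_inf M c h Y)"
    then have "A \<in> sets M" using subalgebra_F_inf[of c] by (auto simp: subalgebra_def)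
    then show "(\<integral>\<omega>\<in>A. at_Y G \<omega> \<partial>M) = (\<integral>\<omega>\<in>A. expectation (at_Y G) \<partial>M)"
      using block_indep_tail[OF c A G int]
      by (simp add: set_lebesgue_integral_def mult.commute)
  qed (use int in auto)
qed

end

section \<open>Covariances of the kernel at two quadruplets\<close>

type_synonym quad = "(nat \<times> nat) \<times> (nat \<times> nat)"

text \<open>
  For pairs of distinct indices this is the number of common indices, in \<open>{0, 1, 2}\<close>. The sum of
  indicators makes it additive, so that it can be summed over all pairs without cases.
\<close>

definition overlap :: "nat \<times> nat \<Rightarrow> nat \<times> nat \<Rightarrow> real" where
  "overlap p p' = of_bool (fst p = fst p') + of_bool (fst p = snd p') +
     of_bool (snd p = fst p') + of_bool (snd p = snd p')"

lemma overlap_eq_0: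
  "overlap (a, b) (a', b') = 0 \<longleftrightarrow> a \<noteq> a' \<and> a \<noteq> b' \<and> b \<noteq> a' \<and> b \<noteq> b'"
  by (simp add: overlap_def)

lemma overlap_eq_1:
  assumes "a \<noteq> b" "a' \<noteq> b'" "overlap (a, b) (a', b') = 1"
  obtains "a = a'" "b \<noteq> b'" "a \<noteq> b'" | "a = b'" "b \<noteq> a'" "a \<noteq> a'"
    | "b = a'" "a \<noteq> b'" "b \<noteq> b'" | "b = b'" "a \<noteq> a'" "b \<noteq> a'"
proof (cases "a = a' \<or> a = b'")
  case True
  then show ?thesis using assms that(1,2) by (elim disjE) (simp_all add: overlap_def)
next
  case False
  then show ?thesis using assms that(3,4) by (cases "b = a'") (simp_all add: overlap_def)
qed

definition valid_quad :: "quad \<Rightarrow> bool" where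
  "valid_quad q \<longleftrightarrow> fst (fst q) \<noteq> snd (fst q) \<and> fst (snd q) \<noteq> snd (snd q) \<and>
     1 \<le> fst (fst q) \<and> 1 \<le> snd (fst q) \<and> 1 \<le> fst (snd q) \<and> 1 \<le> snd (snd q)"

context kernel_matrix
begin

definition kernel_mean :: real where
  "kernel_mean = expectation (\<lambda>\<omega>. h (quadruplet Y 1 2 1 2 \<omega>))"

definition centred :: "quad \<Rightarrow> (nat \<Rightarrow> nat \<Rightarrow> real) \<Rightarrow> real" where
  "centred q y =
     h (quadruplet entries (fst (fst q)) (snd (fst q)) (fst (snd q)) (snd (snd q)) y) - kernel_mean"

abbreviation H :: "quad \<Rightarrow> 'a \<Rightarrow> real" where
  "H q \<omega> \<equiv> centred q (\<lambda>i j. Y i j \<omega>)"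

definition \<Gamma> :: "quad \<Rightarrow> quad \<Rightarrow> real" where
  "\<Gamma> q q' = expectation (\<lambda>\<omega>. H q \<omega> * H q' \<omega>)"

definition kernel_var :: real where
  "kernel_var = \<Gamma> ((1, 2), (1, 2)) ((1, 2), (1, 2))"

definition row_cov :: real where
  "row_cov = \<Gamma> ((1, 2), (1, 2)) ((1, 3), (3, 4))"

definition col_cov :: real where
  "col_cov = \<Gamma> ((1, 2), (1, 2)) ((3, 4), (1, 3))"

lemma block_functional_centred:
  assumes "fst (fst q) \<in> I" "snd (fst q) \<in> I" "fst (snd q) \<in> J" "snd (snd q) \<in> J"
  shows "block_functional I J borel (centred q)"
  unfolding centred_def[abs_def]
  by (rule block_functional_compose[OF block_functional_quadruplet[OF kernel assms], of "\<lambda>x. x - kernel_mean"]) simp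

lemma block_functional_times:
  fixes F G :: "(nat \<Rightarrow> nat \<Rightarrow> real) \<Rightarrow> real"
  assumes "block_functional I J borel F" "block_functional I J borel G"
  shows "block_functional I J borel (\<lambda>y. F y * G y)"
  using assms by (intro block_functional_binary[where f="(*)" and N=borel and N'=borel]) auto

lemma H_measurable [measurable]:
  assumes "valid_quad q"
  shows "H q \<in> borel_measurable M"
  by (rule functional_measurable[OF block_functional_centred[of q "{1..}" "{1..}"]])
     (use assms in \<open>auto simp: valid_quad_def\<close>)

lemma H_swap:
  "H ((i', i), r) \<omega> = H ((i, i'), r) \<omega>" "H (p, (j', j)) \<omega> = H (p, (j, j')) \<omega>"
  by (simp_all add: centred_def quadruplet_kernel_swap[OF kernel])

lemma kernel_integrable: "integrable M (\<lambda>\<omega>. h (quadruplet Y 1 2 1 2 \<omega>))"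
proof (rule square_integrable_imp_integrable)
  have "H ((1, 2), (1, 2)) \<in> borel_measurable M"
    by (rule H_measurable) (simp add: valid_quad_def)
  then have "(\<lambda>\<omega>. H ((1, 2), (1, 2)) \<omega> + kernel_mean) \<in> borel_measurable M"
    by simp
  then show "(\<lambda>\<omega>. h (quadruplet Y 1 2 1 2 \<omega>)) \<in> borel_measurable M"
    by (simp add: centred_def quadruplet_def)
qed (rule square_integrable)

lemma base_moments:
  shows "integrable M (H ((1, 2), (1, 2)))" "expectation (H ((1, 2), (1, 2))) = 0"
    "integrable M (\<lambda>\<omega>. (H ((1, 2), (1, 2)) \<omega>)\<^sup>2)"
proof -
  have eq: "H ((1, 2), (1, 2)) \<omega> = h (quadruplet Y 1 2 1 2 \<omega>) - kernel_mean" for \<omega>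
    by (simp add: centred_def quadruplet_def)
  show "integrable M (H ((1, 2), (1, 2)))" "expectation (H ((1, 2), (1, 2))) = 0"
    unfolding eq using kernel_integrable by (simp_all add: kernel_mean_def prob_space)
  show "integrable M (\<lambda>\<omega>. (H ((1, 2), (1, 2)) \<omega>)\<^sup>2)"
    unfolding eq power2_diff using kernel_integrable square_integrable by simp
qed

lemma relabel_quad:
  assumes q: "valid_quad q" and F: "F \<in> borel_measurable borel"
  shows "integrable M (\<lambda>\<omega>. F (H q \<omega>)) \<longleftrightarrow> integrable M (\<lambda>\<omega>. F (H ((1, 2), (1, 2)) \<omega>) :: real)"
    and "expectation (\<lambda>\<omega>. F (H q \<omega>)) = expectation (\<lambda>\<omega>. F (H ((1, 2), (1, 2)) \<omega>))"
proof -
  define \<rho> where "\<rho> i = (if i = 1 then fst (fst q) else snd (fst q))" for i :: nat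
  define \<kappa> where "\<kappa> j = (if j = 1 then fst (snd q) else snd (snd q))" for j :: nat
  have G: "block_functional {1, 2} {1, 2} borel (\<lambda>y. F (centred ((1, 2), (1, 2)) y))"
    by (rule block_functional_compose[OF block_functional_centred F]) simp_all
  have inj: "inj_on \<rho> {1, 2}" "inj_on \<kappa> {1, 2}" "\<rho> ` {1, 2} \<subseteq> {1..}" "\<kappa> ` {1, 2} \<subseteq> {1..}"
    "{1, 2} \<subseteq> {1 :: nat..}" "finite {1, 2 :: nat}"
    using q by (auto simp: \<rho>_def \<kappa>_def inj_on_def valid_quad_def)
  have eq: "centred ((1, 2), (1, 2)) (\<lambda>i j. Y (\<rho> i) (\<kappa> j) \<omega>) = H q \<omega>" for \<omega>
    by (simp add: centred_def quadruplet_def \<rho>_def \<kappa>_def)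
  note R = relabel_integral[OF G inj(6,6) inj(5,1,3) inj(5,2,4), unfolded eq]
  show "integrable M (\<lambda>\<omega>. F (H q \<omega>)) \<longleftrightarrow> integrable M (\<lambda>\<omega>. F (H ((1, 2), (1, 2)) \<omega>))"
    "expectation (\<lambda>\<omega>. F (H q \<omega>)) = expectation (\<lambda>\<omega>. F (H ((1, 2), (1, 2)) \<omega>))"
    by (rule R)+
qed

lemma H_moments:
  assumes "valid_quad q"
  shows "integrable M (H q)" "expectation (H q) = 0"
    "integrable M (\<lambda>\<omega>. (H q \<omega>)\<^sup>2)" "expectation (\<lambda>\<omega>. (H q \<omega>)\<^sup>2) = kernel_var"
  using relabel_quad[OF assms, of "\<lambda>x. x"] relabel_quad[OF assms, of "\<lambda>x. x\<^sup>2"] base_moments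
  by (simp_all add: kernel_var_def \<Gamma>_def power2_eq_square)

lemma H_product_integrable:
  assumes "valid_quad q" "valid_quad q'"
  shows "integrable M (\<lambda>\<omega>. H q \<omega> * H q' \<omega>)"
proof (rule Bochner_Integration.integrable_bound)
  show "integrable M (\<lambda>\<omega>. (H q \<omega>)\<^sup>2 + (H q' \<omega>)\<^sup>2)"
    using H_moments[OF assms(1)] H_moments[OF assms(2)] by simp
  have "\<bar>x * y\<bar> \<le> x\<^sup>2 + y\<^sup>2" for x y :: real
  proof -
    have "0 \<le> \<bar>x\<bar> * \<bar>y\<bar>" by simp
    moreover have "2 * \<bar>x\<bar> * \<bar>y\<bar> \<le> x\<^sup>2 + y\<^sup>2" using sum_squares_bound[of "\<bar>x\<bar>" "\<bar>y\<bar>"] by simp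
    ultimately show ?thesis unfolding abs_mult by linarith
  qed
  then show "AE \<omega> in M. norm (H q \<omega> * H q' \<omega>) \<le> norm ((H q \<omega>)\<^sup>2 + (H q' \<omega>)\<^sup>2)" by simp
qed (use assms in measurable)

lemma \<Gamma>_bound:
  assumes "valid_quad q" "valid_quad q'"
  shows "\<bar>\<Gamma> q q'\<bar> \<le> kernel_var"
proof -
  have "\<bar>\<Gamma> q q'\<bar> \<le> expectation (\<lambda>\<omega>. \<bar>H q \<omega> * H q' \<omega>\<bar>)"
    unfolding \<Gamma>_def by (rule integral_abs_bound)
  also have "\<dots> \<le> expectation (\<lambda>\<omega>. ((H q \<omega>)\<^sup>2 + (H q' \<omega>)\<^sup>2) / 2)"
  proof (rule integral_mono)
    show "\<bar>H q \<omega> * H q' \<omega>\<bar> \<le> ((H q \<omega>)\<^sup>2 + (H q' \<omega>)\<^sup>2) / 2" for \<omega>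
      using sum_squares_bound[of "\<bar>H q \<omega>\<bar>" "\<bar>H q' \<omega>\<bar>"] by (simp add: abs_mult)
  qed (use H_product_integrable[OF assms] H_moments[OF assms(1)] H_moments[OF assms(2)] in auto)
  also have "\<dots> = kernel_var"
    using H_moments[OF assms(1)] H_moments[OF assms(2)] by simp
  finally show ?thesis .
qed

lemma \<Gamma>_diagonal: "valid_quad q \<Longrightarrow> \<Gamma> q q = kernel_var"
  using H_moments(4)[of q] by (simp add: \<Gamma>_def power2_eq_square)

lemma kernel_var_nonneg: "0 \<le> kernel_var"
  unfolding kernel_var_def \<Gamma>_def by (rule integral_nonneg_AE) simp

lemma \<Gamma>_disjoint:
  assumes "valid_quad q" "valid_quad q'" "overlap (fst q) (fst q') = 0" "overlap (snd q) (snd q') = 0"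
  shows "\<Gamma> q q' = 0"
proof -
  obtain i i' j j' where q: "q = ((i, i'), (j, j'))" by (metis surj_pair)
  obtain k k' l l' where q': "q' = ((k, k'), (l, l'))" by (metis surj_pair)
  have ind: "indep_var borel (H q) borel (H q')"
  proof (rule block_indep)
    show "block_functional {i, i'} {j, j'} borel (centred q)"
      by (rule block_functional_centred) (simp_all add: q)
    show "block_functional {k, k'} {l, l'} borel (centred q')"
      by (rule block_functional_centred) (simp_all add: q')
    show "{i, i'} \<inter> {k, k'} = {}" "{j, j'} \<inter> {l, l'} = {}"
      using assms(3,4) unfolding q q' fst_conv snd_conv overlap_eq_0 by blast+
  qed (use assms(1,2) in \<open>auto simp: valid_quad_def q q'\<close>)
  have "\<Gamma> q q' = expectation (H q) * expectation (H q')"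
    unfolding \<Gamma>_def
    by (rule indep_var_lebesgue_integral[OF ind H_moments(1)[OF assms(1)] H_moments(1)[OF assms(2)]])
  then show ?thesis using H_moments(2)[OF assms(1)] by simp
qed

lemma \<Gamma>_common_row:
  assumes "distinct [i, i\<^sub>1, i\<^sub>2]" "distinct [j\<^sub>1, j\<^sub>2, j\<^sub>3, j\<^sub>4]" "0 \<notin> {i, i\<^sub>1, i\<^sub>2, j\<^sub>1, j\<^sub>2, j\<^sub>3, j\<^sub>4}"
  shows "\<Gamma> ((i, i\<^sub>1), (j\<^sub>1, j\<^sub>2)) ((i, i\<^sub>2), (j\<^sub>3, j\<^sub>4)) = row_cov"
proof -
  define \<rho> where "\<rho> k = (if k = 1 then i else if k = 2 then i\<^sub>1 else i\<^sub>2)" for k :: nat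
  define \<kappa> where "\<kappa> k = (if k = 1 then j\<^sub>1 else if k = 2 then j\<^sub>2 else if k = 3 then j\<^sub>3 else j\<^sub>4)" for k :: nat
  let ?I = "{1, 2, 3 :: nat}" and ?J = "{1, 2, 3, 4 :: nat}"
  have G: "block_functional ?I ?J borel
      (\<lambda>y. centred ((1, 2), (1, 2)) y * centred ((1, 3), (3, 4)) y)"
    by (intro block_functional_times block_functional_centred) simp_all
  have inj: "inj_on \<rho> ?I" "inj_on \<kappa> ?J" "\<rho> ` ?I \<subseteq> {1..}" "\<kappa> ` ?J \<subseteq> {1..}" "?I \<subseteq> {1..}" "?J \<subseteq> {1..}"
    "finite ?I" "finite ?J"
  proof -
    have "distinct (map \<rho> [1, 2, 3])" "distinct (map \<kappa> [1, 2, 3, 4])"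
      using assms(1,2) by (simp_all add: \<rho>_def \<kappa>_def)
    then show "inj_on \<rho> ?I" "inj_on \<kappa> ?J" unfolding distinct_map by simp_all
    show "\<rho> ` ?I \<subseteq> {1..}" "\<kappa> ` ?J \<subseteq> {1..}" using assms(3) by (simp_all add: \<rho>_def \<kappa>_def Suc_le_eq)
  qed simp_all
  show ?thesis
    using relabel_integral(2)[OF G inj(7,8) inj(5,1,3) inj(6,2,4)]
    by (simp add: row_cov_def \<Gamma>_def centred_def quadruplet_def \<rho>_def \<kappa>_def)
qed

lemma \<Gamma>_common_col:
  assumes "distinct [j, j\<^sub>1, j\<^sub>2]" "distinct [i\<^sub>1, i\<^sub>2, i\<^sub>3, i\<^sub>4]" "0 \<notin> {j, j\<^sub>1, j\<^sub>2, i\<^sub>1, i\<^sub>2, i\<^sub>3, i\<^sub>4}"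
  shows "\<Gamma> ((i\<^sub>1, i\<^sub>2), (j, j\<^sub>1)) ((i\<^sub>3, i\<^sub>4), (j, j\<^sub>2)) = col_cov"
proof -
  define \<kappa> where "\<kappa> k = (if k = 1 then j else if k = 2 then j\<^sub>1 else j\<^sub>2)" for k :: nat
  define \<rho> where "\<rho> k = (if k = 1 then i\<^sub>1 else if k = 2 then i\<^sub>2 else if k = 3 then i\<^sub>3 else i\<^sub>4)" for k :: nat
  let ?J = "{1, 2, 3 :: nat}" and ?I = "{1, 2, 3, 4 :: nat}"
  have G: "block_functional ?I ?J borel
      (\<lambda>y. centred ((1, 2), (1, 2)) y * centred ((3, 4), (1, 3)) y)"
    by (intro block_functional_times block_functional_centred) simp_all
  have inj: "inj_on \<rho> ?I" "inj_on \<kappa> ?J" "\<rho> ` ?I \<subseteq> {1..}" "\<kappa> ` ?J \<subseteq> {1..}" "?I \<subseteq> {1..}" "?J \<subseteq> {1..}"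
    "finite ?I" "finite ?J"
  proof -
    have "distinct (map \<rho> [1, 2, 3, 4])" "distinct (map \<kappa> [1, 2, 3])"
      using assms(1,2) by (simp_all add: \<rho>_def \<kappa>_def)
    then show "inj_on \<rho> ?I" "inj_on \<kappa> ?J" unfolding distinct_map by simp_all
    show "\<rho> ` ?I \<subseteq> {1..}" "\<kappa> ` ?J \<subseteq> {1..}" using assms(3) by (simp_all add: \<rho>_def \<kappa>_def Suc_le_eq)
  qed simp_all
  show ?thesis
    using relabel_integral(2)[OF G inj(7,8) inj(5,1,3) inj(6,2,4)]
    by (simp add: col_cov_def \<Gamma>_def centred_def quadruplet_def \<rho>_def \<kappa>_def)
qed

lemma \<Gamma>_swap:
  "\<Gamma> ((i', i), r) q = \<Gamma> ((i, i'), r) q" "\<Gamma> (p, (j', j)) q = \<Gamma> (p, (j, j')) q"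
  "\<Gamma> q ((i', i), r) = \<Gamma> q ((i, i'), r)" "\<Gamma> q (p, (j', j)) = \<Gamma> q (p, (j, j'))"
  by (simp_all only: \<Gamma>_def H_swap)

lemma \<Gamma>_one_row:
  assumes "valid_quad q" "valid_quad q'" "overlap (fst q) (fst q') = 1" "overlap (snd q) (snd q') = 0"
  shows "\<Gamma> q q' = row_cov"
proof -
  obtain i i' j j' where q: "q = ((i, i'), (j, j'))" by (metis surj_pair)
  obtain k k' l l' where q': "q' = ((k, k'), (l, l'))" by (metis surj_pair)
  have d: "distinct [j, j', l, l']" "0 \<notin> {i, i', k, k', j, j', l, l'}" and ne: "i \<noteq> i'" "k \<noteq> k'"
    using assms(1,2,4) by (auto simp: overlap_eq_0 q q' valid_quad_def)
  have "overlap (i, i') (k, k') = 1" using assms(3) by (simp add: q q')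
  with ne show ?thesis
  proof (cases rule: overlap_eq_1)
    case 1
    show ?thesis unfolding q q' 1(1)[symmetric]
      by (rule \<Gamma>_common_row[OF _ d(1)], use ne 1 in simp, use d(2) in simp)
  next
    case 2
    show ?thesis unfolding q q' 2(1)[symmetric]
      by (rule trans[OF \<Gamma>_swap(3) \<Gamma>_common_row[OF _ d(1)]], use ne 2 in simp, use d(2) in simp)
  next
    case 3
    show ?thesis unfolding q q' 3(1)[symmetric]
      by (rule trans[OF \<Gamma>_swap(1) \<Gamma>_common_row[OF _ d(1)]], use ne 3 in simp, use d(2) in simp)
  next
    case 4
    show ?thesis unfolding q q' 4(1)[symmetric]
      by (rule trans[OF \<Gamma>_swap(1) trans[OF \<Gamma>_swap(3) \<Gamma>_common_row[OF _ d(1)]]], use ne 4 in simp, use d(2) in simp)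
  qed
qed

lemma \<Gamma>_one_col:
  assumes "valid_quad q" "valid_quad q'" "overlap (fst q) (fst q') = 0" "overlap (snd q) (snd q') = 1"
  shows "\<Gamma> q q' = col_cov"
proof -
  obtain i i' j j' where q: "q = ((j, j'), (i, i'))" by (metis surj_pair)
  obtain k k' l l' where q': "q' = ((l, l'), (k, k'))" by (metis surj_pair)
  have d: "distinct [j, j', l, l']" "0 \<notin> {i, i', k, k', j, j', l, l'}" and ne: "i \<noteq> i'" "k \<noteq> k'"
    using assms(1,2,3) by (auto simp: overlap_eq_0 q q' valid_quad_def)
  have "overlap (i, i') (k, k') = 1" using assms(4) by (simp add: q q')
  with ne show ?thesis
  proof (cases rule: overlap_eq_1)
    case 1
    show ?thesis unfolding q q' 1(1)[symmetric]
      by (rule \<Gamma>_common_col[OF _ d(1)], use ne 1 in simp, use d(2) in simp)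
  next
    case 2
    show ?thesis unfolding q q' 2(1)[symmetric]
      by (rule trans[OF \<Gamma>_swap(4) \<Gamma>_common_col[OF _ d(1)]], use ne 2 in simp, use d(2) in simp)
  next
    case 3
    show ?thesis unfolding q q' 3(1)[symmetric]
      by (rule trans[OF \<Gamma>_swap(2) \<Gamma>_common_col[OF _ d(1)]], use ne 3 in simp, use d(2) in simp)
  next
    case 4
    show ?thesis unfolding q q' 4(1)[symmetric]
      by (rule trans[OF \<Gamma>_swap(2) trans[OF \<Gamma>_swap(4) \<Gamma>_common_col[OF _ d(1)]]], use ne 4 in simp, use d(2) in simp)
  qed
qed

text \<open>
  The main terms are linear in the overlaps, which makes their sum over all pairs of quadruplets
  exact. The remaining term vanishes at overlaps \<open>(0,0)\<close>, \<open>(1,0)\<close> and \<open>(0,1)\<close>, and the constant \<open>3\<close> is what overlap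
  \<open>(1,1)\<close> needs: there the covariance is at most the variance, while the linear part may be as small as
  minus twice the variance.
\<close>

lemma \<Gamma>_upper:
  assumes q: "valid_quad q" and q': "valid_quad q'"
  defines "a \<equiv> overlap (fst q) (fst q')" and "b \<equiv> overlap (snd q) (snd q')"
  shows "\<Gamma> q q' \<le> row_cov * a + col_cov * b +
    3 * kernel_var * (a * (a - 1) + b * (b - 1) + a * b)"
proof -
  have a: "a \<in> {0, 1, 2}" and b: "b \<in> {0, 1, 2}"
    using q q' by (auto simp: a_def b_def overlap_def valid_quad_def of_bool_def)
  have G: "\<Gamma> q q' \<le> kernel_var" using \<Gamma>_bound[OF q q'] by simp
  have "valid_quad ((1, 2), (1, 2))" "valid_quad ((1, 3), (3, 4))" "valid_quad ((3, 4), (1, 3))"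
    by (simp_all add: valid_quad_def)
  then have "- kernel_var \<le> row_cov" "- kernel_var \<le> col_cov"
    using \<Gamma>_bound[of "((1, 2), (1, 2))"] by (auto simp: row_cov_def col_cov_def abs_le_iff minus_le_iff)
  then show ?thesis
    using a b G kernel_var_nonneg \<Gamma>_disjoint[OF q q', folded a_def b_def]
      \<Gamma>_one_row[OF q q', folded a_def b_def] \<Gamma>_one_col[OF q q', folded a_def b_def]
    by auto
qed

lemma H_sums:
  assumes "finite S" "finite T" "\<And>s. s \<in> S \<Longrightarrow> valid_quad (f s)" "\<And>t. t \<in> T \<Longrightarrow> valid_quad (g t)"
  shows "integrable M (\<lambda>\<omega>. (\<Sum>s\<in>S. H (f s) \<omega>) * (\<Sum>t\<in>T. H (g t) \<omega>))"
    and "expectation (\<lambda>\<omega>. (\<Sum>s\<in>S. H (f s) \<omega>) * (\<Sum>t\<in>T. H (g t) \<omega>)) = (\<Sum>s\<in>S. \<Sum>t\<in>T. \<Gamma> (f s) (g t))"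
proof -
  have I: "integrable M (\<lambda>\<omega>. H (f s) \<omega> * H (g t) \<omega>)" if "s \<in> S" "t \<in> T" for s t
    by (rule H_product_integrable[OF assms(3)[OF that(1)] assms(4)[OF that(2)]])
  show "integrable M (\<lambda>\<omega>. (\<Sum>s\<in>S. H (f s) \<omega>) * (\<Sum>t\<in>T. H (g t) \<omega>))"
    unfolding sum_product by (intro Bochner_Integration.integrable_sum I)
  have I': "integrable M (\<lambda>\<omega>. \<Sum>t\<in>T. H (f s) \<omega> * H (g t) \<omega>)" if "s \<in> S" for s
    by (intro Bochner_Integration.integrable_sum I that)
  have "expectation (\<lambda>\<omega>. (\<Sum>s\<in>S. H (f s) \<omega>) * (\<Sum>t\<in>T. H (g t) \<omega>)) =
      (\<Sum>s\<in>S. expectation (\<lambda>\<omega>. \<Sum>t\<in>T. H (f s) \<omega> * H (g t) \<omega>))"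
    unfolding sum_product by (rule Bochner_Integration.integral_sum[OF I'])
  also have "\<dots> = (\<Sum>s\<in>S. \<Sum>t\<in>T. \<Gamma> (f s) (g t))"
    unfolding \<Gamma>_def by (rule sum.cong[OF refl], rule Bochner_Integration.integral_sum[OF I])
  finally show "expectation (\<lambda>\<omega>. (\<Sum>s\<in>S. H (f s) \<omega>) * (\<Sum>t\<in>T. H (g t) \<omega>)) = (\<Sum>s\<in>S. \<Sum>t\<in>T. \<Gamma> (f s) (g t))" .
qed

end

section \<open>Counting overlaps\<close>

lemma pairs_choose: "real (m choose 2) = real m * (real m - 1) / 2"
proof (cases m)
  case (Suc k)
  have "real (m choose 2) = real (m * (m - 1) div 2)" by (simp add: choose_two)
  also have "\<dots> = real (m * (m - 1)) / 2"
    using real_of_nat_div[of 2 "m * (m - 1)"] by (simp add: Suc)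
  finally show ?thesis by (simp add: Suc algebra_simps)
qed simp

lemma card_pairs: "real (card (pairs m)) = real (m choose 2)"
  using sum_pairs_symmetric[of "\<lambda>_ _. 1" m] by (cases m) (simp_all add: pairs_choose)

lemma sum_pairs_containing:
  assumes "a \<in> {1..m}"
  shows "(\<Sum>p\<in>pairs m. of_bool (a = fst p) + of_bool (a = snd p) :: real) = real m - 1"
proof -
  have "2 * (\<Sum>(i, i')\<in>pairs m. of_bool (a = i) + of_bool (a = i') :: real) =
    (\<Sum>i\<in>{1..m}. \<Sum>i'\<in>{1..m} - {i}. of_bool (a = i) + of_bool (a = i'))"
    by (rule sum_pairs_symmetric) simp
  also have "\<dots> = (\<Sum>i\<in>{1..m}. if i = a then real m - 1 else 1)"
  proof (rule sum.cong[OF refl])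
    fix i assume i: "i \<in> {1..m}"
    then have c: "real (card ({1..m} - {i})) = real m - 1" by (cases m) simp_all
    show "(\<Sum>i'\<in>{1..m} - {i}. of_bool (a = i) + of_bool (a = i') :: real) = (if i = a then real m - 1 else 1)"
    proof (cases "i = a")
      case True
      then have "(\<Sum>i'\<in>{1..m} - {i}. of_bool (a = i) + of_bool (a = i') :: real) = (\<Sum>i'\<in>{1..m} - {i}. 1)"
        by (intro sum.cong) auto
      with True c show ?thesis by simp
    next
      case False
      then have "(\<Sum>i'\<in>{1..m} - {i}. of_bool (a = i) + of_bool (a = i') :: real) =
        (\<Sum>i'\<in>{1..m} - {i}. if i' = a then 1 else 0)"
        by (intro sum.cong) auto
      with False assms show ?thesis by simp
    qed
  qed
  also have "\<dots> = 2 * (real m - 1)"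
    using assms by (subst sum.remove[of _ a]) (auto simp: of_nat_diff)
  finally show ?thesis by (simp add: split_def)
qed

lemma sum_overlap:
  assumes "p \<in> pairs m"
  shows "(\<Sum>p'\<in>pairs m. overlap p p') = 2 * (real m - 1)"
proof -
  have "(\<Sum>p'\<in>pairs m. overlap p p') =
    (\<Sum>p'\<in>pairs m. of_bool (fst p = fst p') + of_bool (fst p = snd p')) +
    (\<Sum>p'\<in>pairs m. of_bool (snd p = fst p') + of_bool (snd p = snd p'))"
    unfolding sum.distrib[symmetric] by (simp add: overlap_def add.assoc)
  also have "\<dots> = 2 * (real m - 1)"
    using assms by (subst (1 2) sum_pairs_containing) (auto simp: pairs_def)
  finally show ?thesis .
qed

lemma sum_overlap_falling:
  assumes "p \<in> pairs m"
  shows "(\<Sum>p'\<in>pairs m. overlap p p' * (overlap p p' - 1)) = 2"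
proof -
  have "(\<Sum>p'\<in>pairs m. overlap p p' * (overlap p p' - 1)) = (\<Sum>p'\<in>pairs m. if p' = p then 2 else 0)"
  proof (rule sum.cong[OF refl])
    fix p' assume p': "p' \<in> pairs m"
    obtain a b where p: "p = (a, b)" "a < b" using assms by (auto simp: pairs_def)
    obtain a' b' where p': "p' = (a', b')" "a' < b'" using p' by (auto simp: pairs_def)
    consider "a = a'" "a \<noteq> b'" "b \<noteq> a'" | "a \<noteq> a'" "a = b'" "b \<noteq> a'" "b \<noteq> b'"
      | "a \<noteq> a'" "a \<noteq> b'" "b = a'" "b \<noteq> b'" | "a \<noteq> a'" "a \<noteq> b'" "b \<noteq> a'"
      using p(2) p'(2) by linarith
    then show "overlap p p' * (overlap p p' - 1) = (if p' = p then 2 else 0)"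
      unfolding p(1) p'(1) by cases (simp_all add: overlap_def of_bool_def)
  qed
  then show ?thesis using assms by simp
qed

section \<open>Approximation by sums of independent blocks\<close>

text \<open>
  Rows and columns are relabelled by triples. Kind \<open>0\<close> carries the rows and columns of the
  \<open>U\<close>-statistic; \<open>node s i k\<close> with \<open>s > 0\<close> is a fresh index reserved for the \<open>k\<close>-th quadruplet of block
  \<open>i\<close>.
\<close>

definition node :: "nat \<Rightarrow> nat \<Rightarrow> nat \<Rightarrow> nat" where
  "node s i k = Suc (prod_encode (s, prod_encode (i, k)))"

lemma node_eq [simp]: "node s i k = node s' i' k' \<longleftrightarrow> s = s' \<and> i = i' \<and> k = k'"
  by (simp add: node_def)

lemma node_pos [simp]: "Suc 0 \<le> node s i k" "node s i k \<noteq> 0"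
  by (simp_all add: node_def)

definition embed :: "quad \<Rightarrow> quad" where
  "embed q = ((node 0 (fst (fst q)) 0, node 0 (snd (fst q)) 0),
              (node 0 (fst (snd q)) 0, node 0 (snd (snd q)) 0))"

text \<open>
  The \<open>k\<close>-th quadruplet of row \<open>i\<close>, and below that of column \<open>j\<close>. Row blocks use rows of kinds \<open>0, 1\<close> and
  columns of kinds \<open>1, 2\<close>, column blocks use rows of kinds \<open>2, 3\<close> and columns of kinds \<open>0, 3\<close>;
  so a row block and a column block never meet.
\<close>

definition row_quad :: "nat \<times> nat \<Rightarrow> quad" where
  "row_quad = (\<lambda>(i, k). ((node 0 i 0, node 1 i k), (node 1 i k, node 2 i k)))"

definition col_quad :: "nat \<times> nat \<Rightarrow> quad" where
  "col_quad = (\<lambda>(j, k). ((node 2 j k, node 3 j k), (node 0 j 0, node 3 j k)))"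

lemma valid_quads:
  assumes "q \<in> pairs m \<times> pairs n"
  shows "valid_quad (embed q)"
  using assms by (auto simp: valid_quad_def embed_def pairs_def)

lemma valid_block_quads: "valid_quad (row_quad x)" "valid_quad (col_quad x)"
  by (cases x; simp add: valid_quad_def row_quad_def col_quad_def)+

context kernel_matrix
begin

definition U_sum :: "nat \<Rightarrow> nat \<Rightarrow> 'a \<Rightarrow> real" where
  "U_sum m n \<omega> = (\<Sum>q\<in>pairs m \<times> pairs n. H (embed q) \<omega>)"

definition row_sum :: "nat \<Rightarrow> nat \<Rightarrow> 'a \<Rightarrow> real" where
  "row_sum m K \<omega> = (\<Sum>x\<in>{1..m} \<times> {..<K}. H (row_quad x) \<omega>)"

definition col_sum :: "nat \<Rightarrow> nat \<Rightarrow> 'a \<Rightarrow> real" where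
  "col_sum n K \<omega> = (\<Sum>x\<in>{1..n} \<times> {..<K}. H (col_quad x) \<omega>)"

text \<open>
  The centred \<open>U\<close>-statistic of the relabelled matrix; it has the law of the original one.
\<close>

definition U_centred :: "nat \<Rightarrow> nat \<Rightarrow> 'a \<Rightarrow> real" where
  "U_centred m n \<omega> = inverse (real (m choose 2)) * inverse (real (n choose 2)) * U_sum m n \<omega>"

text \<open>
  The factor \<open>2\<close> is the number of rows, and of columns, in a quadruplet: each row occurs in a
  proportion \<open>2 / m\<close> of the summands of the \<open>U\<close>-statistic.
\<close>

definition block_approx :: "nat \<Rightarrow> nat \<Rightarrow> nat \<Rightarrow> 'a \<Rightarrow> real" where
  "block_approx K m n \<omega> = 2 / (real m * real K) * row_sum m K \<omega> + 2 / (real n * real K) * col_sum n K \<omega>"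

text \<open>
  The fresh columns of a row block prevent common columns, so only the row \<open>i\<close> itself can be shared.
\<close>

lemma \<Gamma>_embed_row:
  assumes "q \<in> pairs m \<times> pairs n"
  shows "\<Gamma> (row_quad (i, k)) (embed q) =
    row_cov * (of_bool (i = fst (fst q)) + of_bool (i = snd (fst q)))"
proof -
  note v = valid_block_quads(1)[of "(i, k)"] valid_quads[OF assms]
  have s: "overlap (snd (row_quad (i, k))) (snd (embed q)) = 0"
    by (simp add: overlap_def row_quad_def embed_def)
  have f: "overlap (fst (row_quad (i, k))) (fst (embed q)) =
      of_bool (i = fst (fst q)) + of_bool (i = snd (fst q))"
    by (simp add: overlap_def row_quad_def embed_def)
  have "fst (fst q) \<noteq> snd (fst q)" using assms by (auto simp: pairs_def)
  then show ?thesis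
    using \<Gamma>_disjoint[OF v _ s] \<Gamma>_one_row[OF v _ s] unfolding f
    by (cases "i = fst (fst q)"; cases "i = snd (fst q)"; simp)
qed

lemma \<Gamma>_embed_col:
  assumes "q \<in> pairs m \<times> pairs n"
  shows "\<Gamma> (col_quad (j, k)) (embed q) =
    col_cov * (of_bool (j = fst (snd q)) + of_bool (j = snd (snd q)))"
proof -
  note v = valid_block_quads(2)[of "(j, k)"] valid_quads[OF assms]
  have s: "overlap (fst (col_quad (j, k))) (fst (embed q)) = 0"
    by (simp add: overlap_def col_quad_def embed_def)
  have f: "overlap (snd (col_quad (j, k))) (snd (embed q)) =
      of_bool (j = fst (snd q)) + of_bool (j = snd (snd q))"
    by (simp add: overlap_def col_quad_def embed_def)
  have "fst (snd q) \<noteq> snd (snd q)" using assms by (auto simp: pairs_def)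
  then show ?thesis
    using \<Gamma>_disjoint[OF v s] \<Gamma>_one_col[OF v s] unfolding f
    by (cases "j = fst (snd q)"; cases "j = snd (snd q)"; simp)
qed

lemma \<Gamma>_row_row:
  "\<Gamma> (row_quad (i, k)) (row_quad (i', k')) =
    (if i' = i then row_cov + (if k' = k then kernel_var - row_cov else 0) else 0)"
proof (cases "i' = i \<and> k' = k")
  case True
  then show ?thesis using \<Gamma>_diagonal[OF valid_block_quads(1)] by simp
next
  case False
  note v = valid_block_quads(1)[of "(i, k)"] valid_block_quads(1)[of "(i', k')"]
  have s: "overlap (snd (row_quad (i, k))) (snd (row_quad (i', k'))) = 0"
    using False by (auto simp: overlap_def row_quad_def)
  have "overlap (fst (row_quad (i, k))) (fst (row_quad (i', k'))) = of_bool (i = i')"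
    using False by (auto simp: overlap_def row_quad_def)
  then show ?thesis using False \<Gamma>_disjoint[OF v _ s] \<Gamma>_one_row[OF v _ s] by auto
qed

lemma \<Gamma>_col_col:
  "\<Gamma> (col_quad (j, k)) (col_quad (j', k')) =
    (if j' = j then col_cov + (if k' = k then kernel_var - col_cov else 0) else 0)"
proof (cases "j' = j \<and> k' = k")
  case True
  then show ?thesis using \<Gamma>_diagonal[OF valid_block_quads(2)] by simp
next
  case False
  note v = valid_block_quads(2)[of "(j, k)"] valid_block_quads(2)[of "(j', k')"]
  have s: "overlap (fst (col_quad (j, k))) (fst (col_quad (j', k'))) = 0"
    using False by (auto simp: overlap_def col_quad_def)
  have "overlap (snd (col_quad (j, k))) (snd (col_quad (j', k'))) = of_bool (j = j')"
    using False by (auto simp: overlap_def col_quad_def)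
  then show ?thesis using False \<Gamma>_disjoint[OF v s] \<Gamma>_one_col[OF v s] by auto
qed

lemma \<Gamma>_row_col: "\<Gamma> (row_quad x) (col_quad y) = 0"
  by (rule \<Gamma>_disjoint[OF valid_block_quads(1) valid_block_quads(2)])
     (cases x; cases y; simp add: overlap_def row_quad_def col_quad_def)+

lemma row_sum_embed:
  "expectation (\<lambda>\<omega>. row_sum m K \<omega> * U_sum m n \<omega>) =
     real m * real K * (row_cov * (real m - 1) * real (n choose 2))"
proof -
  have "expectation (\<lambda>\<omega>. row_sum m K \<omega> * U_sum m n \<omega>) =
     (\<Sum>x\<in>{1..m} \<times> {..<K}. \<Sum>q\<in>pairs m \<times> pairs n. \<Gamma> (row_quad x) (embed q))"
    unfolding row_sum_def U_sum_def by (rule H_sums(2)) (auto intro: valid_block_quads valid_quads)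
  also have "\<dots> = (\<Sum>x\<in>{1..m} \<times> {..<K}. row_cov * (real m - 1) * real (n choose 2))"
  proof (rule sum.cong[OF refl])
    fix x assume x: "x \<in> {1..m} \<times> {..<K}"
    then obtain i k where ik: "x = (i, k)" "i \<in> {1..m}" by auto
    have "(\<Sum>q\<in>pairs m \<times> pairs n. \<Gamma> (row_quad x) (embed q)) =
       (\<Sum>(p, r)\<in>pairs m \<times> pairs n. row_cov * (of_bool (i = fst p) + of_bool (i = snd p)))"
      by (rule sum.cong[OF refl]) (auto simp: ik \<Gamma>_embed_row)
    also have "\<dots> = (\<Sum>p\<in>pairs m. \<Sum>r\<in>pairs n. row_cov * (of_bool (i = fst p) + of_bool (i = snd p)))"
      by (rule sum.cartesian_product[symmetric])
    also have "\<dots> = row_cov * (\<Sum>p\<in>pairs m. of_bool (i = fst p) + of_bool (i = snd p)) * real (n choose 2)"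
      by (simp add: card_pairs sum_distrib_left mult_ac)
    also have "\<dots> = row_cov * (real m - 1) * real (n choose 2)"
      by (simp only: sum_pairs_containing[OF ik(2)])
    finally show "(\<Sum>q\<in>pairs m \<times> pairs n. \<Gamma> (row_quad x) (embed q)) = row_cov * (real m - 1) * real (n choose 2)" .
  qed
  also have "\<dots> = real m * real K * (row_cov * (real m - 1) * real (n choose 2))"
    by simp
  finally show ?thesis .
qed

lemma col_sum_embed:
  "expectation (\<lambda>\<omega>. col_sum n K \<omega> * U_sum m n \<omega>) =
     real n * real K * (col_cov * (real n - 1) * real (m choose 2))"
proof -
  have "expectation (\<lambda>\<omega>. col_sum n K \<omega> * U_sum m n \<omega>) =
     (\<Sum>x\<in>{1..n} \<times> {..<K}. \<Sum>q\<in>pairs m \<times> pairs n. \<Gamma> (col_quad x) (embed q))"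
    unfolding col_sum_def U_sum_def by (rule H_sums(2)) (auto intro: valid_block_quads valid_quads)
  also have "\<dots> = (\<Sum>x\<in>{1..n} \<times> {..<K}. col_cov * (real n - 1) * real (m choose 2))"
  proof (rule sum.cong[OF refl])
    fix x assume x: "x \<in> {1..n} \<times> {..<K}"
    then obtain j k where jk: "x = (j, k)" "j \<in> {1..n}" by auto
    have "(\<Sum>q\<in>pairs m \<times> pairs n. \<Gamma> (col_quad x) (embed q)) =
       (\<Sum>(p, r)\<in>pairs m \<times> pairs n. col_cov * (of_bool (j = fst r) + of_bool (j = snd r)))"
      by (rule sum.cong[OF refl]) (auto simp: jk \<Gamma>_embed_col)
    also have "\<dots> = (\<Sum>p\<in>pairs m. \<Sum>r\<in>pairs n. col_cov * (of_bool (j = fst r) + of_bool (j = snd r)))"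
      by (rule sum.cartesian_product[symmetric])
    also have "\<dots> = col_cov * (\<Sum>r\<in>pairs n. of_bool (j = fst r) + of_bool (j = snd r)) * real (m choose 2)"
      by (simp add: card_pairs sum_distrib_left mult_ac)
    also have "\<dots> = col_cov * (real n - 1) * real (m choose 2)"
      by (simp only: sum_pairs_containing[OF jk(2)])
    finally show "(\<Sum>q\<in>pairs m \<times> pairs n. \<Gamma> (col_quad x) (embed q)) = col_cov * (real n - 1) * real (m choose 2)" .
  qed
  also have "\<dots> = real n * real K * (col_cov * (real n - 1) * real (m choose 2))"
    by simp
  finally show ?thesis .
qed

lemma sum_block_diagonal:
  fixes a b :: real and m K :: nat
  assumes "x \<in> {1..m} \<times> {..<K}"
  shows "(\<Sum>y\<in>{1..m} \<times> {..<K}. if fst y = fst x then a + (if snd y = snd x then b else 0) else 0) =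
    real K * a + b"
proof -
  have "(\<Sum>y\<in>{1..m} \<times> {..<K}. if fst y = fst x then a + (if snd y = snd x then b else 0) else 0) =
    (\<Sum>i\<in>{1..m}. \<Sum>k<K. if i = fst x then a + (if k = snd x then b else 0) else 0)"
    by (simp add: sum.cartesian_product split_def)
  also have "\<dots> = (\<Sum>i\<in>{1..m}. if i = fst x then (\<Sum>k<K. a + (if k = snd x then b else 0)) else 0)"
    by (intro sum.cong refl) simp
  also have "\<dots> = (\<Sum>k<K. a + (if k = snd x then b else 0))"
    using assms by (subst sum.delta) auto
  also have "\<dots> = real K * a + b"
    using assms by (auto simp: sum.distrib mem_Times_iff)
  finally show ?thesis .
qed

lemma row_sum_square:
  "expectation (\<lambda>\<omega>. row_sum m K \<omega> * row_sum m K \<omega>) =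
     real m * real K * (real K * row_cov + (kernel_var - row_cov))"
proof -
  have "expectation (\<lambda>\<omega>. row_sum m K \<omega> * row_sum m K \<omega>) =
     (\<Sum>x\<in>{1..m} \<times> {..<K}. \<Sum>y\<in>{1..m} \<times> {..<K}. \<Gamma> (row_quad x) (row_quad y))"
    unfolding row_sum_def by (rule H_sums(2)) (auto intro: valid_block_quads)
  also have "\<dots> = (\<Sum>x\<in>{1..m} \<times> {..<K}. real K * row_cov + (kernel_var - row_cov))"
    by (rule sum.cong[OF refl], subst sum_block_diagonal[symmetric, of _ m K], assumption)
       (auto intro!: sum.cong simp: \<Gamma>_row_row)
  finally show ?thesis by simp
qed

lemma col_sum_square:
  "expectation (\<lambda>\<omega>. col_sum n K \<omega> * col_sum n K \<omega>) =
     real n * real K * (real K * col_cov + (kernel_var - col_cov))"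
proof -
  have "expectation (\<lambda>\<omega>. col_sum n K \<omega> * col_sum n K \<omega>) =
     (\<Sum>x\<in>{1..n} \<times> {..<K}. \<Sum>y\<in>{1..n} \<times> {..<K}. \<Gamma> (col_quad x) (col_quad y))"
    unfolding col_sum_def by (rule H_sums(2)) (auto intro: valid_block_quads)
  also have "\<dots> = (\<Sum>x\<in>{1..n} \<times> {..<K}. real K * col_cov + (kernel_var - col_cov))"
    by (rule sum.cong[OF refl], subst sum_block_diagonal[symmetric, of _ n K], assumption)
       (auto intro!: sum.cong simp: \<Gamma>_col_col)
  finally show ?thesis by simp
qed

lemma row_sum_col_sum: "expectation (\<lambda>\<omega>. row_sum m K \<omega> * col_sum n K \<omega>) = 0"
proof -
  have "expectation (\<lambda>\<omega>. row_sum m K \<omega> * col_sum n K \<omega>) =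
     (\<Sum>x\<in>{1..m} \<times> {..<K}. \<Sum>y\<in>{1..n} \<times> {..<K}. \<Gamma> (row_quad x) (col_quad y))"
    unfolding row_sum_def col_sum_def by (rule H_sums(2)) (auto intro: valid_block_quads)
  then show ?thesis by (simp add: \<Gamma>_row_col)
qed

text \<open>
  Summing the bound of \<open>\<Gamma>_upper\<close> over the second quadruplet uses only the first two
  factorial moments of the overlaps.
\<close>

lemma U_sum_square:
  "expectation (\<lambda>\<omega>. U_sum m n \<omega> * U_sum m n \<omega>) \<le>
     real (m choose 2) * real (n choose 2) *
      (row_cov * (2 * (real m - 1)) * real (n choose 2) + col_cov * (2 * (real n - 1)) * real (m choose 2) +
       3 * kernel_var * (2 * real (n choose 2) + 2 * real (m choose 2) + 2 * (real m - 1) * (2 * (real n - 1))))"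
    (is "_ \<le> _ * ?B")
proof -
  have "expectation (\<lambda>\<omega>. U_sum m n \<omega> * U_sum m n \<omega>) =
     (\<Sum>q\<in>pairs m \<times> pairs n. \<Sum>q'\<in>pairs m \<times> pairs n. \<Gamma> (embed q) (embed q'))"
    unfolding U_sum_def by (rule H_sums(2)) (auto intro: valid_quads)
  also have "\<dots> \<le> (\<Sum>q\<in>pairs m \<times> pairs n. ?B)"
  proof (rule sum_mono)
    fix q assume q: "q \<in> pairs m \<times> pairs n"
    define a where "a p' = overlap (fst q) p'" for p'
    define b where "b r' = overlap (snd q) r'" for r'
    have ov: "overlap (fst (embed q)) (fst (embed q')) = a (fst q')"
      "overlap (snd (embed q)) (snd (embed q')) = b (snd q')" for q'
      by (simp_all add: overlap_def embed_def a_def b_def)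
    have "(\<Sum>q'\<in>pairs m \<times> pairs n. \<Gamma> (embed q) (embed q')) \<le>
      (\<Sum>(p', r')\<in>pairs m \<times> pairs n. row_cov * a p' + col_cov * b r' +
         3 * kernel_var * (a p' * (a p' - 1) + b r' * (b r' - 1) + a p' * b r'))"
      using \<Gamma>_upper[OF valid_quads[OF q] valid_quads, unfolded ov]
      by (intro sum_mono) (simp add: split_def)
    also have "\<dots> = (\<Sum>p'\<in>pairs m. \<Sum>r'\<in>pairs n. row_cov * a p' + col_cov * b r' +
         3 * kernel_var * (a p' * (a p' - 1) + b r' * (b r' - 1) + a p' * b r'))"
      by (rule sum.cartesian_product[symmetric])
    also have "\<dots> = row_cov * (\<Sum>p'\<in>pairs m. a p') * real (n choose 2) +
        col_cov * (\<Sum>r'\<in>pairs n. b r') * real (m choose 2) +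
        3 * kernel_var * ((\<Sum>p'\<in>pairs m. a p' * (a p' - 1)) * real (n choose 2) +
          (\<Sum>r'\<in>pairs n. b r' * (b r' - 1)) * real (m choose 2) +
          (\<Sum>p'\<in>pairs m. a p') * (\<Sum>r'\<in>pairs n. b r'))"
    proof -
      have c1: "(\<Sum>p'\<in>pairs m. \<Sum>r'\<in>pairs n. f p') = (\<Sum>p'\<in>pairs m. f p') * real (n choose 2)" for f :: "_ \<Rightarrow> real"
        by (simp add: card_pairs sum_distrib_right mult.commute)
      have c2: "(\<Sum>p'\<in>pairs m. \<Sum>r'\<in>pairs n. f r') = (\<Sum>r'\<in>pairs n. f r') * real (m choose 2)" for f :: "_ \<Rightarrow> real"
        by (simp add: card_pairs mult.commute)
      have c3: "(\<Sum>p'\<in>pairs m. \<Sum>r'\<in>pairs n. 3 * kernel_var * (a p' * b r')) =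
          3 * kernel_var * ((\<Sum>p'\<in>pairs m. a p') * (\<Sum>r'\<in>pairs n. b r'))"
        unfolding sum_product by (simp add: sum_distrib_left)
      have "(\<Sum>p'\<in>pairs m. \<Sum>r'\<in>pairs n. row_cov * a p' + col_cov * b r' +
          3 * kernel_var * (a p' * (a p' - 1) + b r' * (b r' - 1) + a p' * b r')) =
        (\<Sum>p'\<in>pairs m. \<Sum>r'\<in>pairs n. row_cov * a p') + (\<Sum>p'\<in>pairs m. \<Sum>r'\<in>pairs n. col_cov * b r') +
        ((\<Sum>p'\<in>pairs m. \<Sum>r'\<in>pairs n. 3 * kernel_var * (a p' * (a p' - 1))) +
         (\<Sum>p'\<in>pairs m. \<Sum>r'\<in>pairs n. 3 * kernel_var * (b r' * (b r' - 1))) +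
         (\<Sum>p'\<in>pairs m. \<Sum>r'\<in>pairs n. 3 * kernel_var * (a p' * b r')))"
        by (simp only: sum.distrib distrib_left[of "3 * kernel_var"])
      also have "\<dots> = row_cov * (\<Sum>p'\<in>pairs m. a p') * real (n choose 2) +
          col_cov * (\<Sum>r'\<in>pairs n. b r') * real (m choose 2) +
          (3 * kernel_var * (\<Sum>p'\<in>pairs m. a p' * (a p' - 1)) * real (n choose 2) +
           3 * kernel_var * (\<Sum>r'\<in>pairs n. b r' * (b r' - 1)) * real (m choose 2) +
           3 * kernel_var * ((\<Sum>p'\<in>pairs m. a p') * (\<Sum>r'\<in>pairs n. b r')))"
        unfolding c1[of "\<lambda>p'. row_cov * a p'"] c2[of "\<lambda>r'. col_cov * b r'"] c3
          c1[of "\<lambda>p'. 3 * kernel_var * (a p' * (a p' - 1))"]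
          c2[of "\<lambda>r'. 3 * kernel_var * (b r' * (b r' - 1))"]
        unfolding sum_distrib_left[symmetric] ..
      finally show ?thesis by (simp only: distrib_left mult.assoc)
    qed
    also have "(\<Sum>p'\<in>pairs m. a p') = 2 * (real m - 1)"
      unfolding a_def by (rule sum_overlap) (use q in auto)
    also have "(\<Sum>r'\<in>pairs n. b r') = 2 * (real n - 1)"
      unfolding b_def by (rule sum_overlap) (use q in auto)
    also have "(\<Sum>p'\<in>pairs m. a p' * (a p' - 1)) = 2"
      unfolding a_def by (rule sum_overlap_falling) (use q in auto)
    also have "(\<Sum>r'\<in>pairs n. b r' * (b r' - 1)) = 2"
      unfolding b_def by (rule sum_overlap_falling) (use q in auto)
    finally show "(\<Sum>q'\<in>pairs m \<times> pairs n. \<Gamma> (embed q) (embed q')) \<le> ?B" by simp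
  qed
  also have "\<dots> = real (m choose 2) * real (n choose 2) * ?B"
    by (simp add: card_cartesian_product card_pairs)
  finally show ?thesis .
qed

lemma sums_integrable:
  "integrable M (\<lambda>\<omega>. U_sum m n \<omega> * U_sum m n \<omega>)"
  "integrable M (\<lambda>\<omega>. row_sum m K \<omega> * row_sum m K \<omega>)"
  "integrable M (\<lambda>\<omega>. col_sum n K \<omega> * col_sum n K \<omega>)"
  "integrable M (\<lambda>\<omega>. row_sum m K \<omega> * U_sum m n \<omega>)"
  "integrable M (\<lambda>\<omega>. col_sum n K \<omega> * U_sum m n \<omega>)"
  "integrable M (\<lambda>\<omega>. row_sum m K \<omega> * col_sum n K \<omega>)"
  unfolding U_sum_def row_sum_def col_sum_def
  by (rule H_sums(1); auto intro: valid_block_quads valid_quads)+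

text \<open>
  Up to the first error term, \<open>E U\<^sup>2\<close> is at most \<open>4 row_cov / m + 4 col_cov / n\<close>, which is exactly
  the covariance of \<open>U\<close> with the sum of blocks. The variance of the latter is the same number up to the
  diagonal terms \<open>k = k'\<close>, which are responsible for the error of order \<open>1/(N K)\<close>. So the main terms cancel.
\<close>

lemma block_approx_error:
  assumes m: "m \<ge> 2" and n: "n \<ge> 2" and K: "K \<ge> 1"
  shows "integrable M (\<lambda>\<omega>. (U_centred m n \<omega> - block_approx K m n \<omega>)\<^sup>2)"
    and "expectation (\<lambda>\<omega>. (U_centred m n \<omega> - block_approx K m n \<omega>)\<^sup>2) \<le>
      12 * kernel_var * (1 / (real m * (real m - 1)) + 1 / (real n * (real n - 1)) + 4 / (real m * real n)) +
      8 * kernel_var / real K * (1 / real m + 1 / real n)"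
proof -
  define a where "a = inverse (real (m choose 2)) * inverse (real (n choose 2))"
  define b where "b = 2 / (real m * real K)"
  define d where "d = 2 / (real n * real K)"
  let ?U = "U_sum m n" and ?X = "row_sum m K" and ?Z = "col_sum n K"
  note I = sums_integrable[of m n] sums_integrable[of m K] sums_integrable[of n K]
  have expand: "(U_centred m n \<omega> - block_approx K m n \<omega>)\<^sup>2 =
     a\<^sup>2 * (?U \<omega> * ?U \<omega>) + b\<^sup>2 * (?X \<omega> * ?X \<omega>) + d\<^sup>2 * (?Z \<omega> * ?Z \<omega>)
     - 2 * a * b * (?X \<omega> * ?U \<omega>) - 2 * a * d * (?Z \<omega> * ?U \<omega>) + 2 * b * d * (?X \<omega> * ?Z \<omega>)" for \<omega>
    unfolding U_centred_def block_approx_def a_def[symmetric] b_def[symmetric] d_def[symmetric]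
    by (simp add: power2_eq_square algebra_simps)
  show "integrable M (\<lambda>\<omega>. (U_centred m n \<omega> - block_approx K m n \<omega>)\<^sup>2)"
    unfolding expand using sums_integrable by simp
  have "expectation (\<lambda>\<omega>. (U_centred m n \<omega> - block_approx K m n \<omega>)\<^sup>2) =
     a\<^sup>2 * expectation (\<lambda>\<omega>. ?U \<omega> * ?U \<omega>) + b\<^sup>2 * expectation (\<lambda>\<omega>. ?X \<omega> * ?X \<omega>) +
     d\<^sup>2 * expectation (\<lambda>\<omega>. ?Z \<omega> * ?Z \<omega>)
     - 2 * a * b * expectation (\<lambda>\<omega>. ?X \<omega> * ?U \<omega>) - 2 * a * d * expectation (\<lambda>\<omega>. ?Z \<omega> * ?U \<omega>)
     + 2 * b * d * expectation (\<lambda>\<omega>. ?X \<omega> * ?Z \<omega>)"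
    unfolding expand using sums_integrable by simp
  also have "\<dots> \<le> (4 * row_cov / real m + 4 * col_cov / real n +
      12 * kernel_var * (1 / (real m * (real m - 1)) + 1 / (real n * (real n - 1)) + 4 / (real m * real n)))
     + 4 / (real m * real K) * (real K * row_cov + (kernel_var - row_cov))
     + 4 / (real n * real K) * (real K * col_cov + (kernel_var - col_cov))
     - 8 * row_cov / real m - 8 * col_cov / real n + 0"
  proof (intro add_mono diff_mono)
    have pos: "real m > 0" "real n > 0" "real K > 0" "real m - 1 > 0" "real n - 1 > 0"
      using m n K by auto
    have S: "real (m choose 2) = real m * (real m - 1) / 2" "real (n choose 2) = real n * (real n - 1) / 2"
      by (rule pairs_choose)+
    have "a\<^sup>2 * expectation (\<lambda>\<omega>. ?U \<omega> * ?U \<omega>) \<le> a\<^sup>2 * (real (m choose 2) * real (n choose 2) *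
      (row_cov * (2 * (real m - 1)) * real (n choose 2) + col_cov * (2 * (real n - 1)) * real (m choose 2) +
       3 * kernel_var * (2 * real (n choose 2) + 2 * real (m choose 2) + 2 * (real m - 1) * (2 * (real n - 1)))))"
      by (rule mult_left_mono[OF U_sum_square]) simp
    also have "\<dots> = 4 * row_cov / real m + 4 * col_cov / real n +
      12 * kernel_var * (1 / (real m * (real m - 1)) + 1 / (real n * (real n - 1)) + 4 / (real m * real n))"
    proof -
      have "(inverse (x * x' / 2) * inverse (y * y' / 2))\<^sup>2 * (x * x' / 2 * (y * y' / 2) *
          (r * (2 * x') * (y * y' / 2) + s * (2 * y') * (x * x' / 2) +
           3 * v * (2 * (y * y' / 2) + 2 * (x * x' / 2) + 2 * x' * (2 * y')))) =
        4 * r / x + 4 * s / y + 12 * v * (1 / (x * x') + 1 / (y * y') + 4 / (x * y))"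
        if "x > 0" "x' > 0" "y > 0" "y' > 0" for x x' y y' r s v :: real
        using that by (simp add: field_simps power2_eq_square)
      from this[OF pos(1,4,2,5)] show ?thesis unfolding a_def S .
    qed
    finally show "a\<^sup>2 * expectation (\<lambda>\<omega>. ?U \<omega> * ?U \<omega>) \<le> 4 * row_cov / real m + 4 * col_cov / real n +
      12 * kernel_var * (1 / (real m * (real m - 1)) + 1 / (real n * (real n - 1)) + 4 / (real m * real n))" .
    show "b\<^sup>2 * expectation (\<lambda>\<omega>. ?X \<omega> * ?X \<omega>) \<le> 4 / (real m * real K) * (real K * row_cov + (kernel_var - row_cov))"
      unfolding row_sum_square b_def using pos by (simp add: field_simps power2_eq_square)
    show "d\<^sup>2 * expectation (\<lambda>\<omega>. ?Z \<omega> * ?Z \<omega>) \<le> 4 / (real n * real K) * (real K * col_cov + (kernel_var - col_cov))"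
      unfolding col_sum_square d_def using pos by (simp add: field_simps power2_eq_square)
    show "8 * row_cov / real m \<le> 2 * a * b * expectation (\<lambda>\<omega>. ?X \<omega> * ?U \<omega>)"
    proof -
      have "2 * (inverse (x * x' / 2) * inverse (y * y' / 2)) * (2 / (x * k)) * (x * k * (r * x' * (y * y' / 2))) = 8 * r / x"
        if "x > 0" "x' > 0" "y > 0" "y' > 0" "k > 0" for x x' y y' r k :: real
        using that by (simp add: field_simps)
      from this[OF pos(1,4,2,5,3)] show ?thesis unfolding row_sum_embed a_def b_def S by simp
    qed
    show "8 * col_cov / real n \<le> 2 * a * d * expectation (\<lambda>\<omega>. ?Z \<omega> * ?U \<omega>)"
    proof -
      have "2 * (inverse (x * x' / 2) * inverse (y * y' / 2)) * (2 / (y * k)) * (y * k * (r * y' * (x * x' / 2))) = 8 * r / y"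
        if "x > 0" "x' > 0" "y > 0" "y' > 0" "k > 0" for x x' y y' r k :: real
        using that by (simp add: field_simps)
      from this[OF pos(1,4,2,5,3)] show ?thesis unfolding col_sum_embed a_def d_def S by simp
    qed
    show "2 * b * d * expectation (\<lambda>\<omega>. ?X \<omega> * ?Z \<omega>) \<le> 0"
      unfolding row_sum_col_sum by simp
  qed
  also have "\<dots> \<le> 12 * kernel_var * (1 / (real m * (real m - 1)) + 1 / (real n * (real n - 1)) + 4 / (real m * real n)) +
      8 * kernel_var / real K * (1 / real m + 1 / real n)"
  proof -
    have "- kernel_var \<le> row_cov" "- kernel_var \<le> col_cov"
      using \<Gamma>_bound[of "((1, 2), (1, 2))" "((1, 3), (3, 4))"] \<Gamma>_bound[of "((1, 2), (1, 2))" "((3, 4), (1, 3))"]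
      by (auto simp: row_cov_def col_cov_def abs_le_iff valid_quad_def)
    then have le: "kernel_var - row_cov \<le> 2 * kernel_var" "kernel_var - col_cov \<le> 2 * kernel_var"
      by linarith+
    have "4 / (real m * real K) * (kernel_var - row_cov) \<le> 4 / (real m * real K) * (2 * kernel_var)"
      "4 / (real n * real K) * (kernel_var - col_cov) \<le> 4 / (real n * real K) * (2 * kernel_var)"
      by (rule mult_left_mono[OF le(1)], simp) (rule mult_left_mono[OF le(2)], simp)
    moreover have "real m > 0" "real n > 0" "real K > 0" using m n K by auto
    then have "4 / (real m * real K) * (real K * row_cov) = 4 * row_cov / real m"
      "4 / (real n * real K) * (real K * col_cov) = 4 * col_cov / real n"
      "4 / (real m * real K) * (2 * kernel_var) + 4 / (real n * real K) * (2 * kernel_var) =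
         8 * kernel_var / real K * (1 / real m + 1 / real n)"
      by (simp_all add: field_simps)
    ultimately show ?thesis unfolding distrib_left by linarith
  qed
  finally show "expectation (\<lambda>\<omega>. (U_centred m n \<omega> - block_approx K m n \<omega>)\<^sup>2) \<le>
      12 * kernel_var * (1 / (real m * (real m - 1)) + 1 / (real n * (real n - 1)) + 4 / (real m * real n)) +
      8 * kernel_var / real K * (1 / real m + 1 / real n)" .
qed

end

section \<open>Characteristic functions\<close>

lemma exp_linear_bound:
  fixes x :: real
  assumes "0 \<le> x" "x \<le> 1"
  shows "\<bar>1 - x - exp (- x)\<bar> \<le> x\<^sup>2"
proof -
  have "1 - x \<le> exp (- x)" using exp_ge_add_one_self[of "- x"] by simp
  moreover have "exp (- x) \<le> 1 - x + x\<^sup>2"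
  proof -
    have "1 \<le> (1 - x + x\<^sup>2) * (1 + x)"
      using assms by (simp add: algebra_simps power2_eq_square)
    also have "\<dots> \<le> (1 - x + x\<^sup>2) * exp x"
      using assms exp_ge_add_one_self[of x] by (intro mult_left_mono) auto
    finally show ?thesis by (simp add: exp_minus field_simps)
  qed
  ultimately show ?thesis by simp
qed

text \<open>
  The central limit theorem for identically distributed centred variables in terms of characteristic
  functions, with an arbitrary number of summands \<open>n\<close> and an arbitrary scale \<open>s\<close>. It includes the degenerate case
  of variance \<open>0\<close>, which may occur here for the rows or for the columns. Both the power of the characteristic
  function and the power of \<open>exp (- v s\<^sup>2 / 2)\<close> are compared factor by factor.
\<close>

lemma (in prob_space) char_power_limit:
  fixes X :: "'a \<Rightarrow> real" and n :: "nat \<Rightarrow> nat" and s :: "nat \<Rightarrow> real"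
  assumes X: "X \<in> borel_measurable M" "integrable M X" "integrable M (\<lambda>\<omega>. (X \<omega>)\<^sup>2)" "expectation X = 0"
    and s: "s \<longlonglongrightarrow> 0" and ns: "(\<lambda>N. real (n N) * (s N)\<^sup>2) \<longlonglongrightarrow> \<tau>"
  shows "(\<lambda>N. char (distr M borel X) (s N) ^ n N) \<longlonglongrightarrow>
     complex_of_real (exp (- (expectation (\<lambda>\<omega>. (X \<omega>)\<^sup>2) * \<tau>) / 2))"
proof -
  define v where "v = expectation (\<lambda>\<omega>. (X \<omega>)\<^sup>2)"
  define \<phi> where "\<phi> = char (distr M borel X)"
  note [measurable] = X(1)
  interpret D: real_distribution "distr M borel X" by (rule real_distribution_distr[OF X(1)])
  have v0: "0 \<le> v" unfolding v_def by (rule integral_nonneg_AE) simp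
  define R where "R t = expectation (\<lambda>\<omega>. min (6 * (X \<omega>)\<^sup>2) (\<bar>t\<bar> * \<bar>X \<omega>\<bar> ^ 3))" for t
  have approx: "cmod (\<phi> t - (1 - t\<^sup>2 * v / 2)) \<le> t\<^sup>2 / 6 * R t" for t
    unfolding \<phi>_def R_def
    by (rule char_approx3'[OF X(1,2,3,4) _ refl]) (simp add: X(4) v_def)
  have R: "(\<lambda>N. R (s N)) \<longlonglongrightarrow> 0"
  proof -
    have "(\<lambda>N. R (s N)) \<longlonglongrightarrow> expectation (\<lambda>\<omega>. 0)"
      unfolding R_def
    proof (rule integral_dominated_convergence[where w="\<lambda>\<omega>. 6 * (X \<omega>)\<^sup>2"])
      show "AE \<omega> in M. (\<lambda>N. min (6 * (X \<omega>)\<^sup>2) (\<bar>s N\<bar> * \<bar>X \<omega>\<bar> ^ 3)) \<longlonglongrightarrow> 0"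
      proof (rule AE_I2)
        fix \<omega>
        have "(\<lambda>N. min (6 * (X \<omega>)\<^sup>2) (\<bar>s N\<bar> * \<bar>X \<omega>\<bar> ^ 3)) \<longlonglongrightarrow> min (6 * (X \<omega>)\<^sup>2) (\<bar>0\<bar> * \<bar>X \<omega>\<bar> ^ 3)"
          by (intro tendsto_intros s)
        then show "(\<lambda>N. min (6 * (X \<omega>)\<^sup>2) (\<bar>s N\<bar> * \<bar>X \<omega>\<bar> ^ 3)) \<longlonglongrightarrow> 0" by simp
      qed
    qed (use X(3) in \<open>auto simp: min_def\<close>)
    then show ?thesis by simp
  qed
  have bound: "\<forall>\<^sub>F N in sequentially. cmod (\<phi> (s N) ^ n N - complex_of_real (exp (- (v * (s N)\<^sup>2 / 2))) ^ n N) \<le>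
      real (n N) * (s N)\<^sup>2 * (R (s N) / 6 + v\<^sup>2 * (s N)\<^sup>2 / 4)"
  proof -
    have "(\<lambda>N. v * (s N)\<^sup>2 / 2) \<longlonglongrightarrow> v * 0\<^sup>2 / 2" by (intro tendsto_intros s) simp
    then have "\<forall>\<^sub>F N in sequentially. v * (s N)\<^sup>2 / 2 < 1"
      by (rule order_tendstoD) simp
    then show ?thesis
    proof eventually_elim
      case (elim N)
      let ?t = "s N"
      define x where "x = v * ?t\<^sup>2 / 2"
      have x: "0 \<le> x" "x \<le> 1" using v0 elim by (simp_all add: x_def)
      have "cmod (\<phi> ?t - complex_of_real (exp (- x))) \<le>
          cmod (\<phi> ?t - (1 - ?t\<^sup>2 * v / 2)) + cmod (complex_of_real (1 - x - exp (- x)))"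
      proof -
        have "\<phi> ?t - complex_of_real (exp (- x)) =
            (\<phi> ?t - (1 - ?t\<^sup>2 * v / 2)) + complex_of_real (1 - x - exp (- x))"
          by (simp add: x_def mult.commute)
        then show ?thesis using norm_triangle_ineq by metis
      qed
      also have "cmod (complex_of_real (1 - x - exp (- x))) \<le> x\<^sup>2"
        unfolding norm_of_real by (rule exp_linear_bound[OF x])
      finally have d: "cmod (\<phi> ?t - complex_of_real (exp (- x))) \<le> ?t\<^sup>2 / 6 * R ?t + x\<^sup>2"
        using approx[of ?t] by linarith
      have "cmod (\<phi> ?t ^ n N - complex_of_real (exp (- x)) ^ n N) \<le>
          real (n N) * cmod (\<phi> ?t - complex_of_real (exp (- x)))"
        by (rule norm_power_diff) (use x in \<open>simp_all add: \<phi>_def D.cmod_char_le_1\<close>)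
      also have "\<dots> \<le> real (n N) * (?t\<^sup>2 / 6 * R ?t + x\<^sup>2)"
        by (rule mult_left_mono[OF d]) simp
      also have "\<dots> = real (n N) * ?t\<^sup>2 * (R ?t / 6 + v\<^sup>2 * ?t\<^sup>2 / 4)"
        by (simp add: x_def field_simps power2_eq_square)
      finally show ?case by (simp add: x_def)
    qed
  qed
  have "(\<lambda>N. real (n N) * (s N)\<^sup>2 * (R (s N) / 6 + v\<^sup>2 * (s N)\<^sup>2 / 4)) \<longlonglongrightarrow> \<tau> * (0 / 6 + v\<^sup>2 * 0\<^sup>2 / 4)"
    by (intro tendsto_intros ns R s) simp_all
  then have "(\<lambda>N. real (n N) * (s N)\<^sup>2 * (R (s N) / 6 + v\<^sup>2 * (s N)\<^sup>2 / 4)) \<longlonglongrightarrow> 0" by simp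
  then have diff: "(\<lambda>N. \<phi> (s N) ^ n N - complex_of_real (exp (- (v * (s N)\<^sup>2 / 2))) ^ n N) \<longlonglongrightarrow> 0"
    by (rule Lim_null_comparison[OF bound])
  have "(\<lambda>N. complex_of_real (exp (- (v * (real (n N) * (s N)\<^sup>2)) / 2))) \<longlonglongrightarrow>
      complex_of_real (exp (- (v * \<tau>) / 2))"
    by (intro tendsto_intros ns) simp
  moreover have "complex_of_real (exp (- (v * (real (n N) * (s N)\<^sup>2)) / 2)) =
      complex_of_real (exp (- (v * (s N)\<^sup>2 / 2))) ^ n N" for N
    unfolding of_real_power[symmetric] exp_of_nat_mult[symmetric] by (simp add: field_simps)
  ultimately have "(\<lambda>N. complex_of_real (exp (- (v * (s N)\<^sup>2 / 2))) ^ n N) \<longlonglongrightarrow>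
      complex_of_real (exp (- (v * \<tau>) / 2))" by simp
  from tendsto_add[OF diff this] show ?thesis by (simp add: \<phi>_def v_def)
qed

lemma (in prob_space) char_scale:
  assumes "X \<in> borel_measurable M"
  shows "char (distr M borel (\<lambda>\<omega>. a * X \<omega>)) t = char (distr M borel X) (t * a)"
  using assms by (simp add: char_def integral_distr mult.assoc)

text \<open>
  The function \<open>x \<mapsto> exp (i t x)\<close> is Lipschitz with constant \<open>\<bar>t\<bar>\<close>, and
  \<open>\<bar>x\<bar> \<le> \<eta> / 2 + x\<^sup>2 / (2 \<eta>)\<close> turns the resulting bound into one by the second moment.
\<close>

lemma (in prob_space) char_diff_bound:
  fixes A B :: "'a \<Rightarrow> real"
  assumes m: "A \<in> borel_measurable M" "B \<in> borel_measurable M"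
    and sq: "integrable M (\<lambda>\<omega>. (A \<omega> - B \<omega>)\<^sup>2)" and le: "expectation (\<lambda>\<omega>. (A \<omega> - B \<omega>)\<^sup>2) \<le> \<eta>\<^sup>2"
    and \<eta>: "0 < \<eta>"
  shows "cmod (char (distr M borel A) t - char (distr M borel B) t) \<le> \<bar>t\<bar> * \<eta>"
proof -
  note [measurable] = m
  have D: "integrable M (\<lambda>\<omega>. A \<omega> - B \<omega>)"
    by (rule square_integrable_imp_integrable[OF _ sq]) simp
  have i: "integrable M (\<lambda>\<omega>. iexp (t * A \<omega>))" "integrable M (\<lambda>\<omega>. iexp (t * B \<omega>))"
    by (auto intro!: integrable_iexp)
  have "char (distr M borel A) t - char (distr M borel B) t =
     (CLINT \<omega>|M. iexp (t * A \<omega>) - iexp (t * B \<omega>))"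
    using i by (simp add: char_def integral_distr)
  also have "cmod \<dots> \<le> expectation (\<lambda>\<omega>. cmod (iexp (t * A \<omega>) - iexp (t * B \<omega>)))"
    by (rule integral_norm_bound)
  also have "\<dots> \<le> expectation (\<lambda>\<omega>. \<bar>t\<bar> * (\<eta> / 2 + (A \<omega> - B \<omega>)\<^sup>2 / (2 * \<eta>)))"
  proof (rule integral_mono)
    show "integrable M (\<lambda>\<omega>. cmod (iexp (t * A \<omega>) - iexp (t * B \<omega>)))" using i by auto
    show "integrable M (\<lambda>\<omega>. \<bar>t\<bar> * (\<eta> / 2 + (A \<omega> - B \<omega>)\<^sup>2 / (2 * \<eta>)))" using sq by simp
    fix \<omega>
    have "iexp (t * A \<omega>) - iexp (t * B \<omega>) = iexp (t * B \<omega>) * (iexp (t * (A \<omega> - B \<omega>)) - 1)"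
      by (simp add: right_diff_distrib flip: exp_add)
    then have "cmod (iexp (t * A \<omega>) - iexp (t * B \<omega>)) = cmod (iexp (t * (A \<omega> - B \<omega>)) - 1)"
      by (simp add: norm_mult)
    also have "\<dots> \<le> \<bar>t * (A \<omega> - B \<omega>)\<bar>"
      using iexp_approx1[of "t * (A \<omega> - B \<omega>)" 0] by simp
    also have "\<dots> = \<bar>t\<bar> * \<bar>A \<omega> - B \<omega>\<bar>" by (rule abs_mult)
    also have "\<bar>A \<omega> - B \<omega>\<bar> \<le> \<eta> / 2 + (A \<omega> - B \<omega>)\<^sup>2 / (2 * \<eta>)"
      using \<eta> sum_squares_bound[of "\<eta>" "\<bar>A \<omega> - B \<omega>\<bar>"] by (simp add: field_simps power2_eq_square)
    finally show "cmod (iexp (t * A \<omega>) - iexp (t * B \<omega>)) \<le> \<bar>t\<bar> * (\<eta> / 2 + (A \<omega> - B \<omega>)\<^sup>2 / (2 * \<eta>))"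
      by (simp add: mult_left_mono)
  qed
  also have "\<dots> = \<bar>t\<bar> * (\<eta> / 2 + expectation (\<lambda>\<omega>. (A \<omega> - B \<omega>)\<^sup>2) / (2 * \<eta>))"
    using sq by (simp add: prob_space)
  also have "\<dots> \<le> \<bar>t\<bar> * (\<eta> / 2 + \<eta>\<^sup>2 / (2 * \<eta>))"
    using le \<eta> by (intro mult_left_mono add_left_mono divide_right_mono) auto
  also have "\<dots> = \<bar>t\<bar> * \<eta>" using \<eta> by (simp add: power2_eq_square)
  finally show ?thesis .
qed

lemma tendsto_by_approximation:
  fixes x :: "nat \<Rightarrow> complex"
  assumes "\<And>\<epsilon>. 0 < \<epsilon> \<Longrightarrow> \<exists>z w. (\<forall>\<^sub>F N in sequentially. cmod (x N - z N) \<le> \<epsilon>) \<and> z \<longlonglongrightarrow> w \<and> cmod (w - L) \<le> \<epsilon>"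
  shows "x \<longlonglongrightarrow> L"
proof (rule tendstoI)
  fix e :: real assume e: "0 < e"
  then obtain z w where z: "\<forall>\<^sub>F N in sequentially. cmod (x N - z N) \<le> e / 4" "z \<longlonglongrightarrow> w" "cmod (w - L) \<le> e / 4"
    using assms[of "e / 4"] by auto
  have "\<forall>\<^sub>F N in sequentially. dist (z N) w < e / 4" by (rule tendstoD[OF z(2)]) (use e in simp)
  with z(1) show "\<forall>\<^sub>F N in sequentially. dist (x N) L < e"
  proof eventually_elim
    case (elim N)
    have "dist (x N) L \<le> dist (x N) (z N) + dist (z N) w + dist w L"
      by (meson dist_triangle order_trans add_right_mono)
    with elim z(3) e show ?case by (simp add: dist_norm)
  qed
qed

lemma normal_distribution_char:
  assumes "v > 0"
  shows "real_distribution (normal_distribution 0 v)"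
    and "char (normal_distribution 0 v) t = complex_of_real (exp (- (v * t\<^sup>2) / 2))"
proof -
  interpret S: real_distribution std_normal_distribution by (rule real_dist_normal_dist)
  have "distributed std_normal_distribution lborel (\<lambda>x. x) std_normal_density"
    unfolding distributed_def by (auto intro!: measure_eqI simp: emeasure_distr)
  from S.normal_density_affine[OF this, of "sqrt v" 0]
  have "distr std_normal_distribution lborel (\<lambda>x. sqrt v * x) = normal_distribution 0 v"
    using assms by (simp add: distributed_def normal_distribution_def)
  then have eq: "normal_distribution 0 v = distr std_normal_distribution borel (\<lambda>x. sqrt v * x)"
    by (subst distr_cong[OF refl, of borel lborel]) auto
  show "real_distribution (normal_distribution 0 v)"
    unfolding eq by (rule S.real_distribution_distr) simp
  have "char (normal_distribution 0 v) t = char (distr std_normal_distribution borel (\<lambda>x. x)) (t * sqrt v)"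
    unfolding eq by (rule S.char_scale) simp
  also have "distr std_normal_distribution borel (\<lambda>x. x) = std_normal_distribution"
    by (rule distr_id2) simp
  finally show "char (normal_distribution 0 v) t = complex_of_real (exp (- (v * t\<^sup>2) / 2))"
    using assms by (simp add: char_std_normal_distribution power_mult_distrib mult.commute)
qed

text \<open>
  Independence of two blocks suffices to split off one summand at a time, since the sum of the
  remaining ones is again a functional of a finite block.
\<close>

lemma (in dissociated_rce_matrix) char_block_sum:
  fixes G :: "'t \<Rightarrow> (nat \<Rightarrow> nat \<Rightarrow> real) \<Rightarrow> real"
  assumes "finite T"
    and G: "\<And>t. t \<in> T \<Longrightarrow> block_functional (R t) (C t) borel (G t)"
    and fin: "\<And>t. t \<in> T \<Longrightarrow> finite (R t)" "\<And>t. t \<in> T \<Longrightarrow> finite (C t)"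
    and pos: "\<And>t. t \<in> T \<Longrightarrow> R t \<subseteq> {1..}" "\<And>t. t \<in> T \<Longrightarrow> C t \<subseteq> {1..}"
    and disj: "\<And>t t'. t \<in> T \<Longrightarrow> t' \<in> T \<Longrightarrow> t \<noteq> t' \<Longrightarrow> R t \<inter> R t' = {}"
      "\<And>t t'. t \<in> T \<Longrightarrow> t' \<in> T \<Longrightarrow> t \<noteq> t' \<Longrightarrow> C t \<inter> C t' = {}"
  shows "char (distr M borel (\<lambda>\<omega>. \<Sum>t\<in>T. at_Y (G t) \<omega>)) u = (\<Prod>t\<in>T. char (distr M borel (at_Y (G t))) u)"
  using assms
proof (induction T rule: finite_induct)
  case empty
  then show ?case by (simp add: char_def integral_distr prob_space del: distr_const)
next
  case (insert t T)
  let ?R = "\<Union>t\<in>T. R t" and ?C = "\<Union>t\<in>T. C t"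
  have S: "block_functional ?R ?C borel (\<lambda>y. \<Sum>t\<in>T. G t y)"
    by (rule block_functional_sum, rule block_functional_mono[OF insert.prems(1)]) auto
  have ind: "indep_var borel (at_Y (G t)) borel (at_Y (\<lambda>y. \<Sum>t\<in>T. G t y))"
  proof (rule block_indep[OF insert.prems(1) S])
    show "R t \<inter> ?R = {}" "C t \<inter> ?C = {}"
      using insert.prems(6)[of t] insert.prems(7)[of t] insert.hyps(2) by blast+
    show "?R \<subseteq> {1..}" using insert.prems(4) by blast
    show "?C \<subseteq> {1..}" using insert.prems(5) by blast
  qed (use insert.prems(2-5) insert.hyps(1) in auto)
  have IH: "char (distr M borel (\<lambda>\<omega>. \<Sum>t\<in>T. at_Y (G t) \<omega>)) u = (\<Prod>t\<in>T. char (distr M borel (at_Y (G t))) u)"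
    by (rule insert.IH) (use insert.prems in \<open>simp_all\<close>)
  show ?case
    using char_distr_add[OF ind] insert.hyps by (simp add: IH)
qed

section \<open>The central limit theorem for the blocks and for U-statistics\<close>

text \<open>
  Maps the indices belonging to any block to the corresponding indices of block \<open>i\<close>.
\<close>

definition reindex :: "nat \<Rightarrow> nat \<Rightarrow> nat" where
  "reindex i v = (case prod_decode (v - 1) of (s, r) \<Rightarrow> node s i (snd (prod_decode r)))"

lemma reindex_node [simp]: "reindex i (node s i' k) = node s i k"
  by (simp add: reindex_def node_def)

lemma m_dim_ge_2: "2 \<le> m_dim c N"
  by (simp add: m_dim_def)

lemma m_dim_pos: "0 < real (m_dim c N)"
  by (simp add: m_dim_def)

lemma n_dim_eq_m_dim: "n_dim c N = m_dim (1 - c) N"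
  by (simp add: n_dim_def m_dim_def)

lemma m_dim_bounds:
  assumes "0 < c"
  shows "c * (real N + 1) + 1 \<le> real (m_dim c N)" "real (m_dim c N) \<le> c * (real N + 1) + 2"
proof -
  have "0 \<le> \<lfloor>c * (real N + 1)\<rfloor>" using assms by simp
  then have "real (m_dim c N) = 2 + of_int \<lfloor>c * (real N + 1)\<rfloor>"
    by (simp add: m_dim_def)
  then show "c * (real N + 1) + 1 \<le> real (m_dim c N)" "real (m_dim c N) \<le> c * (real N + 1) + 2"
    by linarith+
qed

lemma ratio_m_dim:
  assumes c: "0 < c"
  shows "(\<lambda>N. real N / real (m_dim c N)) \<longlonglongrightarrow> 1 / c"
proof (rule tendsto_sandwich)
  note b = m_dim_bounds[OF c]
  have pos: "0 < c * (real N + 1) + 1" for N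
    by (rule add_nonneg_pos) (use c in auto)
  show "\<forall>\<^sub>F N in sequentially. real N / (c * (real N + 1) + 2) \<le> real N / real (m_dim c N)"
    by (intro always_eventually allI frac_le b(2) m_dim_pos) simp_all
  show "\<forall>\<^sub>F N in sequentially. real N / real (m_dim c N) \<le> real N / (c * (real N + 1) + 1)"
    by (intro always_eventually allI frac_le b(1) pos) simp_all
  show "(\<lambda>N. real N / (c * (real N + 1) + 2)) \<longlonglongrightarrow> 1 / c" using c by (real_asymp simp: field_simps)
  show "(\<lambda>N. real N / (c * (real N + 1) + 1)) \<longlonglongrightarrow> 1 / c" using c by (real_asymp simp: field_simps)
qed

lemma inverse_m_dim:
  assumes c: "0 < c"
  shows "(\<lambda>N. 1 / real (m_dim c N)) \<longlonglongrightarrow> 0" "(\<lambda>N. 1 / (real (m_dim c N) - 1)) \<longlonglongrightarrow> 0"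
proof -
  note b = m_dim_bounds[OF c]
  have lim: "(\<lambda>N. 1 / (c * (real N + 1))) \<longlonglongrightarrow> 0" using c by real_asymp
  have pos: "0 < c * (real N + 1)" for N by (rule mult_pos_pos) (use c in auto)
  have le: "c * (real N + 1) \<le> real (m_dim c N) - 1" "c * (real N + 1) \<le> real (m_dim c N)" for N
    using b(1)[of N] by auto
  show "(\<lambda>N. 1 / real (m_dim c N)) \<longlonglongrightarrow> 0"
    by (rule tendsto_sandwich[OF _ _ tendsto_const lim], simp,
        intro always_eventually allI frac_le le pos) simp_all
  show "(\<lambda>N. 1 / (real (m_dim c N) - 1)) \<longlonglongrightarrow> 0"
    by (rule tendsto_sandwich[OF _ _ tendsto_const lim],
        simp add: m_dim_def,
        intro always_eventually allI frac_le le pos) simp_all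
qed

context kernel_matrix
begin

text \<open>
  The summand of row \<open>i\<close> in \<open>row_sum\<close>, and below that of column \<open>j\<close> in \<open>col_sum\<close>, as functionals of a
  finite block.
\<close>

definition row_block :: "nat \<Rightarrow> nat \<Rightarrow> (nat \<Rightarrow> nat \<Rightarrow> real) \<Rightarrow> real" where
  "row_block K i y = (\<Sum>k<K. centred (row_quad (i, k)) y)"

definition col_block :: "nat \<Rightarrow> nat \<Rightarrow> (nat \<Rightarrow> nat \<Rightarrow> real) \<Rightarrow> real" where
  "col_block K j y = (\<Sum>k<K. centred (col_quad (j, k)) y)"

lemma block_functional_row_block:
  "block_functional (insert (node 0 i 0) (node 1 i ` {..<K})) (node 1 i ` {..<K} \<union> node 2 i ` {..<K})
     borel (row_block K i)"
  unfolding row_block_def[abs_def]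
  by (intro block_functional_sum block_functional_centred) (auto simp: row_quad_def)

lemma block_functional_col_block:
  "block_functional (node 2 j ` {..<K} \<union> node 3 j ` {..<K}) (insert (node 0 j 0) (node 3 j ` {..<K}))
     borel (col_block K j)"
  unfolding col_block_def[abs_def]
  by (intro block_functional_sum block_functional_centred) (auto simp: col_quad_def)

lemma row_sum_blocks: "row_sum m K \<omega> = (\<Sum>i\<in>{1..m}. at_Y (row_block K i) \<omega>)"
  unfolding row_sum_def row_block_def by (simp add: sum.cartesian_product split_def)

lemma col_sum_blocks: "col_sum n K \<omega> = (\<Sum>j\<in>{1..n}. at_Y (col_block K j) \<omega>)"
  unfolding col_sum_def col_block_def by (simp add: sum.cartesian_product split_def)

lemma row_block_law: "distr M borel (at_Y (row_block K i)) = distr M borel (row_sum 1 K)"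
proof -
  have "distr M borel (at_relabelled (reindex i) (reindex i) (row_block K 1)) =
      distr M borel (at_Y (row_block K 1))"
    by (rule relabel_law[OF block_functional_row_block]) (auto simp: inj_on_def)
  moreover have "at_relabelled (reindex i) (reindex i) (row_block K 1) = at_Y (row_block K i)"
    by (simp add: fun_eq_iff row_block_def centred_def quadruplet_def row_quad_def)
  moreover have "row_sum 1 K = at_Y (row_block K 1)"
    by (simp add: fun_eq_iff row_sum_blocks)
  ultimately show ?thesis by simp
qed

lemma col_block_law: "distr M borel (at_Y (col_block K j)) = distr M borel (col_sum 1 K)"
proof -
  have "distr M borel (at_relabelled (reindex j) (reindex j) (col_block K 1)) =
      distr M borel (at_Y (col_block K 1))"
    by (rule relabel_law[OF block_functional_col_block]) (auto simp: inj_on_def)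
  moreover have "at_relabelled (reindex j) (reindex j) (col_block K 1) = at_Y (col_block K j)"
    by (simp add: fun_eq_iff col_block_def centred_def quadruplet_def col_quad_def)
  moreover have "col_sum 1 K = at_Y (col_block K 1)"
    by (simp add: fun_eq_iff col_sum_blocks)
  ultimately show ?thesis by simp
qed

lemma block_sum_moments:
  "row_sum m K \<in> borel_measurable M" "integrable M (row_sum m K)" "expectation (row_sum m K) = 0"
  "col_sum m K \<in> borel_measurable M" "integrable M (col_sum m K)" "expectation (col_sum m K) = 0"
  "U_sum m n \<in> borel_measurable M"
proof -
  have q: "integrable M (row_sum m K)" "integrable M (col_sum m K)" "integrable M (U_sum m n)"
    unfolding row_sum_def[abs_def] col_sum_def[abs_def] U_sum_def[abs_def]
    by (intro Bochner_Integration.integrable_sum H_moments valid_block_quads valid_quads; assumption)+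
  show "integrable M (row_sum m K)" "integrable M (col_sum m K)" by fact+
  show "row_sum m K \<in> borel_measurable M" "col_sum m K \<in> borel_measurable M" "U_sum m n \<in> borel_measurable M"
    using q by simp_all
  show "expectation (row_sum m K) = 0"
    unfolding row_sum_def[abs_def]
    by (subst Bochner_Integration.integral_sum) (simp_all add: H_moments valid_block_quads)
  show "expectation (col_sum m K) = 0"
    unfolding col_sum_def[abs_def]
    by (subst Bochner_Integration.integral_sum) (simp_all add: H_moments valid_block_quads)
qed

lemma block_approx_char:
  "char (distr M borel (\<lambda>\<omega>. a * block_approx K m n \<omega>)) u =
     char (distr M borel (row_sum 1 K)) (u * (a * (2 / (real m * real K)))) ^ m *
     char (distr M borel (col_sum 1 K)) (u * (a * (2 / (real n * real K)))) ^ n"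
proof -
  define x where "x = a * (2 / (real m * real K))"
  define z where "z = a * (2 / (real n * real K))"
  define T where "T = {1..m} <+> {1..n}"
  define G where "G t = (case t of Inl i \<Rightarrow> (\<lambda>y. x * row_block K i y) | Inr j \<Rightarrow> (\<lambda>y. z * col_block K j y))"
    for t :: "nat + nat"
  define R where "R t = (case t of Inl i \<Rightarrow> insert (node 0 i 0) (node 1 i ` {..<K})
    | Inr j \<Rightarrow> node 2 j ` {..<K} \<union> node 3 j ` {..<K})" for t :: "nat + nat"
  define C where "C t = (case t of Inl i \<Rightarrow> node 1 i ` {..<K} \<union> node 2 i ` {..<K}
    | Inr j \<Rightarrow> insert (node 0 j 0) (node 3 j ` {..<K}))" for t :: "nat + nat"
  have sum: "a * block_approx K m n \<omega> = (\<Sum>t\<in>T. at_Y (G t) \<omega>)" for \<omega>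
  proof -
    have "(\<Sum>t\<in>T. at_Y (G t) \<omega>) = x * row_sum m K \<omega> + z * col_sum n K \<omega>"
      unfolding T_def G_def row_sum_blocks col_sum_blocks
      by (subst sum.Plus) (simp_all add: comp_def sum_distrib_left)
    then show ?thesis by (simp add: block_approx_def x_def z_def distrib_left)
  qed
  have G: "block_functional (R t) (C t) borel (G t)" for t
  proof (cases t)
    case (Inl i)
    show ?thesis unfolding Inl R_def C_def G_def sum.case
      by (rule block_functional_compose[OF block_functional_row_block]) simp
  next
    case (Inr j)
    show ?thesis unfolding Inr R_def C_def G_def sum.case
      by (rule block_functional_compose[OF block_functional_col_block]) simp
  qed
  have row_char: "char (distr M borel (at_Y (G (Inl i)))) u = char (distr M borel (row_sum 1 K)) (u * x)" for i
  proof -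
    have "at_Y (row_block K i) \<in> borel_measurable M"
      by (rule functional_measurable[OF block_functional_row_block]) auto
    from char_scale[OF this, of x u] show ?thesis
      by (simp only: G_def sum.case row_block_law)
  qed
  have col_char: "char (distr M borel (at_Y (G (Inr j)))) u = char (distr M borel (col_sum 1 K)) (u * z)" for j
  proof -
    have "at_Y (col_block K j) \<in> borel_measurable M"
      by (rule functional_measurable[OF block_functional_col_block]) auto
    from char_scale[OF this, of z u] show ?thesis
      by (simp only: G_def sum.case col_block_law)
  qed
  have "char (distr M borel (\<lambda>\<omega>. \<Sum>t\<in>T. at_Y (G t) \<omega>)) u = (\<Prod>t\<in>T. char (distr M borel (at_Y (G t))) u)"
  proof (rule char_block_sum[OF _ G])
    show "finite T" by (simp add: T_def)
    show "finite (R t)" "finite (C t)" for t by (auto simp: R_def C_def split: sum.split)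
    show "R t \<subseteq> {1..}" "C t \<subseteq> {1..}" for t by (auto simp: R_def C_def split: sum.split)
    show "R t \<inter> R t' = {}" "C t \<inter> C t' = {}" if "t \<noteq> t'" for t t'
      using that by (cases t; cases t'; auto simp: R_def C_def)+
  qed
  also have "\<dots> = (\<Prod>i\<in>{1..m}. char (distr M borel (at_Y (G (Inl i)))) u) *
     (\<Prod>j\<in>{1..n}. char (distr M borel (at_Y (G (Inr j)))) u)"
    unfolding T_def by (subst prod.Plus) (simp_all add: comp_def)
  also have "\<dots> = char (distr M borel (row_sum 1 K)) (u * x) ^ m * char (distr M borel (col_sum 1 K)) (u * z) ^ n"
    unfolding row_char col_char by simp
  finally show ?thesis by (simp add: sum x_def z_def)
qed

text \<open>
  Treats rows and columns at once: \<open>X\<close> is the sum over a single row or column block, \<open>\<gamma>\<close> the covariance of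
  two quadruplets in it, and \<open>c\<close> or \<open>1 - c\<close> the asymptotic proportion.
\<close>

lemma block_char_limit:
  assumes c: "0 < c" and K: "K \<ge> 1"
    and X: "X \<in> borel_measurable M" "integrable M X" "integrable M (\<lambda>\<omega>. X \<omega> * X \<omega>)" "expectation X = 0"
    and sq: "expectation (\<lambda>\<omega>. X \<omega> * X \<omega>) = real 1 * real K * (real K * \<gamma> + (kernel_var - \<gamma>))"
  shows "(\<lambda>N. char (distr M borel X) (t * (sqrt (real N) * (2 / (real (m_dim c N) * real K)))) ^ m_dim c N)
    \<longlonglongrightarrow> complex_of_real (exp (- (t\<^sup>2 * (4 / c * (\<gamma> + (kernel_var - \<gamma>) / real K))) / 2))"
proof -
  let ?m = "\<lambda>N. real (m_dim c N)"
  let ?s = "\<lambda>N. t * (sqrt (real N) * (2 / (?m N * real K)))"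
  have m: "?m N > 0" for N using m_dim_ge_2[of c N] by simp
  have K0: "real K > 0" using K by simp
  have "(\<lambda>N. 2 * t / real K * (real N / ?m N) * (1 / sqrt (real N))) \<longlonglongrightarrow> 2 * t / real K * (1 / c) * 0"
    by (intro tendsto_intros ratio_m_dim c) real_asymp
  moreover have "2 * t / real K * (real N / ?m N) * (1 / sqrt (real N)) = ?s N" for N
  proof -
    have "2 * t / real K * (real N / ?m N) * (1 / sqrt (real N)) =
        t * (real N / sqrt (real N) * (2 / (?m N * real K)))"
      by (simp add: mult_ac)
    then show ?thesis by (simp only: real_div_sqrt of_nat_0_le_iff)
  qed
  ultimately have s: "?s \<longlonglongrightarrow> 0" by simp
  have "(\<lambda>N. 4 * t\<^sup>2 / (real K)\<^sup>2 * (real N / ?m N)) \<longlonglongrightarrow> 4 * t\<^sup>2 / (real K)\<^sup>2 * (1 / c)"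
    by (intro tendsto_intros ratio_m_dim c)
  moreover have "4 * t\<^sup>2 / (real K)\<^sup>2 * (real N / ?m N) = ?m N * (?s N)\<^sup>2" for N
    using m[of N] K0 by (simp add: field_simps power2_eq_square)
  ultimately have ns: "(\<lambda>N. ?m N * (?s N)\<^sup>2) \<longlonglongrightarrow> 4 * t\<^sup>2 / (real K)\<^sup>2 * (1 / c)" by simp
  have "expectation (\<lambda>\<omega>. (X \<omega>)\<^sup>2) * (4 * t\<^sup>2 / (real K)\<^sup>2 * (1 / c)) =
      t\<^sup>2 * (4 / c * (\<gamma> + (kernel_var - \<gamma>) / real K))"
    unfolding power2_eq_square[of "X _"] sq using K0 c by (simp add: field_simps power2_eq_square)
  with char_power_limit[OF X(1,2) X(3)[folded power2_eq_square] X(4) s ns] show ?thesis by (simp only:)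
qed

text \<open>
  The variance \<open>V\<close>, perturbed by the diagonal terms of the finitely many quadruplets in a block.
\<close>

definition block_variance :: "real \<Rightarrow> nat \<Rightarrow> real" where
  "block_variance c K = 4 / c * (row_cov + (kernel_var - row_cov) / real K) +
     4 / (1 - c) * (col_cov + (kernel_var - col_cov) / real K)"

lemma block_approx_limit:
  assumes c: "0 < c" "c < 1" and K: "K \<ge> 1"
  shows "(\<lambda>N. char (distr M borel (\<lambda>\<omega>. sqrt (real N) * block_approx K (m_dim c N) (n_dim c N) \<omega>)) t)
    \<longlonglongrightarrow> complex_of_real (exp (- (t\<^sup>2 * block_variance c K) / 2))"
proof -
  have c': "0 < 1 - c" using c by simp
  have "complex_of_real (exp (- (t\<^sup>2 * block_variance c K) / 2)) =
      complex_of_real (exp (- (t\<^sup>2 * (4 / c * (row_cov + (kernel_var - row_cov) / real K))) / 2)) *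
      complex_of_real (exp (- (t\<^sup>2 * (4 / (1 - c) * (col_cov + (kernel_var - col_cov) / real K))) / 2))"
  proof -
    have "- (t\<^sup>2 * (a + b)) / 2 = - (t\<^sup>2 * a) / 2 + - (t\<^sup>2 * b) / 2" for a b :: real
      by (simp add: field_simps)
    then show ?thesis
      unfolding of_real_mult[symmetric] exp_add[symmetric] block_variance_def by (simp only:)
  qed
  then show ?thesis
    unfolding block_approx_char n_dim_eq_m_dim
    using tendsto_mult[OF
      block_char_limit[OF c(1) K block_sum_moments(1,2) sums_integrable(2) block_sum_moments(3) row_sum_square, of t]
      block_char_limit[OF c' K block_sum_moments(4,5) sums_integrable(3) block_sum_moments(6) col_sum_square, of t]]
    by (simp only:)
qed

text \<open>
  The relabelling \<open>i \<mapsto> node 0 i 0\<close> of the \<open>m\<close> rows and \<open>n\<close> columns is injective, so it preserves the law.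
\<close>

lemma U_law:
  assumes m: "m \<ge> 2" and n: "n \<ge> 2"
  shows "distr M borel (\<lambda>\<omega>. a * (U_stat h Y m n \<omega> - kernel_mean)) = distr M borel (\<lambda>\<omega>. a * U_centred m n \<omega>)"
proof -
  let ?\<rho> = "\<lambda>i. node 0 i 0"
  have G: "block_functional {1..m} {1..n} borel (\<lambda>y. a * (U_stat h entries m n y - kernel_mean))"
    by (rule block_functional_compose[OF block_functional_U_stat[OF kernel], of "\<lambda>x. a * (x - kernel_mean)"]) simp
  have "distr M borel (at_relabelled ?\<rho> ?\<rho> (\<lambda>y. a * (U_stat h entries m n y - kernel_mean))) =
      distr M borel (at_Y (\<lambda>y. a * (U_stat h entries m n y - kernel_mean)))"
    by (rule relabel_law[OF G]) (auto simp: inj_on_def)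
  moreover have "U_stat h entries m n (\<lambda>i j. Y (?\<rho> i) (?\<rho> j) \<omega>) - kernel_mean = U_centred m n \<omega>" for \<omega>
  proof -
    let ?S = "inverse (real (m choose 2)) * inverse (real (n choose 2))"
    have S: "?S * (real (m choose 2) * real (n choose 2)) = 1"
    proof -
      have "real (m choose 2) \<noteq> 0" "real (n choose 2) \<noteq> 0" using m n by auto
      then show ?thesis by (simp add: field_simps)
    qed
    have "U_stat h entries m n (\<lambda>i j. Y (?\<rho> i) (?\<rho> j) \<omega>) =
       ?S * (\<Sum>q\<in>pairs m \<times> pairs n. H (embed q) \<omega> + kernel_mean)"
      unfolding U_stat_pairs sum.cartesian_product split_def
      by (simp add: centred_def embed_def quadruplet_def)
    also have "\<dots> = U_centred m n \<omega> + ?S * (real (m choose 2) * real (n choose 2)) * kernel_mean"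
      by (simp add: U_centred_def U_sum_def sum.distrib card_cartesian_product card_pairs distrib_left mult_ac)
    finally show ?thesis unfolding S by simp
  qed
  moreover have "at_Y (U_stat h entries m n) = U_stat h Y m n"
    by (rule ext) (rule U_stat_entries)
  ultimately show ?thesis by (simp add: fun_eq_iff)
qed

text \<open>
  The block size \<open>K\<close> is chosen first, so that both the variance of the blocks and the limit of the
  scaled approximation error are within tolerance; only then \<open>N\<close> tends to infinity.
\<close>

lemma U_char_limit:
  assumes c: "0 < c" "c < 1"
  shows "(\<lambda>N. char (distr M borel (\<lambda>\<omega>. sqrt (real N) * (U_seq c h Y N \<omega> - kernel_mean))) t)
    \<longlonglongrightarrow> complex_of_real (exp (- (t\<^sup>2 * (4 / c * row_cov + 4 / (1 - c) * col_cov)) / 2))"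
proof (rule tendsto_by_approximation)
  fix \<epsilon> :: real assume \<epsilon>: "0 < \<epsilon>"
  let ?m = "m_dim c" and ?n = "n_dim c"
  let ?v = "4 / c * row_cov + 4 / (1 - c) * col_cov"
  have c': "0 < 1 - c" using c by simp
  define \<eta> where "\<eta> = \<epsilon> / (\<bar>t\<bar> + 1)"
  have \<eta>: "0 < \<eta>" "\<bar>t\<bar> * \<eta> \<le> \<epsilon>" using \<epsilon> by (auto simp: \<eta>_def field_simps)
  have inv: "(\<lambda>K. x / real K) \<longlonglongrightarrow> 0" for x by (rule lim_const_over_n)
  have "(\<lambda>K. complex_of_real (exp (- (t\<^sup>2 * block_variance c K) / 2))) \<longlonglongrightarrow>
     complex_of_real (exp (- (t\<^sup>2 * (4 / c * (row_cov + 0) + 4 / (1 - c) * (col_cov + 0))) / 2))"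
    unfolding block_variance_def by (intro tendsto_intros inv) simp
  then have "(\<lambda>K. complex_of_real (exp (- (t\<^sup>2 * block_variance c K) / 2))) \<longlonglongrightarrow>
     complex_of_real (exp (- (t\<^sup>2 * ?v) / 2))" by simp
  from tendstoD[OF this \<epsilon>]
  have e1: "\<forall>\<^sub>F K in sequentially. cmod (complex_of_real (exp (- (t\<^sup>2 * block_variance c K) / 2)) -
     complex_of_real (exp (- (t\<^sup>2 * ?v) / 2))) < \<epsilon>"
    by (simp add: dist_norm)
  have "(\<lambda>K. 8 * kernel_var * (1 / c + 1 / (1 - c)) / real K) \<longlonglongrightarrow> 0" by (rule inv)
  then have e2: "\<forall>\<^sub>F K in sequentially. 8 * kernel_var * (1 / c + 1 / (1 - c)) / real K < \<eta>\<^sup>2"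
    by (rule order_tendstoD) (use \<eta> in simp)
  obtain K where K: "K \<ge> 1" "8 * kernel_var * (1 / c + 1 / (1 - c)) / real K < \<eta>\<^sup>2"
    "cmod (complex_of_real (exp (- (t\<^sup>2 * block_variance c K) / 2)) -
     complex_of_real (exp (- (t\<^sup>2 * ?v) / 2))) < \<epsilon>"
    using eventually_happens[OF eventually_conj[OF eventually_ge_at_top[of 1] eventually_conj[OF e2 e1]]]
    by (auto simp: eventually_sequentially)
  define r where "r N = 12 * kernel_var * (real N / real (?m N) * (1 / (real (?m N) - 1)) +
      real N / real (?n N) * (1 / (real (?n N) - 1)) + 4 * (real N / real (?m N) * (1 / real (?n N)))) +
      8 * kernel_var / real K * (real N / real (?m N) + real N / real (?n N))" for N
  have "r \<longlonglongrightarrow> 12 * kernel_var * (1 / c * 0 + 1 / (1 - c) * 0 + 4 * (1 / c * 0)) +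
      8 * kernel_var / real K * (1 / c + 1 / (1 - c))"
    unfolding r_def n_dim_eq_m_dim
    by (intro tendsto_intros ratio_m_dim inverse_m_dim c(1) c')
  then have "r \<longlonglongrightarrow> 8 * kernel_var * (1 / c + 1 / (1 - c)) / real K" by simp
  then have "\<forall>\<^sub>F N in sequentially. r N < \<eta>\<^sup>2" by (rule order_tendstoD) (rule K(2))
  then have close: "\<forall>\<^sub>F N in sequentially.
      cmod (char (distr M borel (\<lambda>\<omega>. sqrt (real N) * (U_seq c h Y N \<omega> - kernel_mean))) t -
        char (distr M borel (\<lambda>\<omega>. sqrt (real N) * block_approx K (?m N) (?n N) \<omega>)) t) \<le> \<epsilon>"
  proof eventually_elim
    case (elim N)
    have mn: "2 \<le> ?m N" "2 \<le> ?n N" by (simp_all add: m_dim_ge_2 n_dim_eq_m_dim)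
    have law: "distr M borel (\<lambda>\<omega>. sqrt (real N) * (U_seq c h Y N \<omega> - kernel_mean)) =
        distr M borel (\<lambda>\<omega>. sqrt (real N) * U_centred (?m N) (?n N) \<omega>)"
      unfolding U_seq_def by (rule U_law[OF mn])
    note err = block_approx_error[OF mn K(1)]
    have sq: "(sqrt (real N) * U_centred (?m N) (?n N) \<omega> - sqrt (real N) * block_approx K (?m N) (?n N) \<omega>)\<^sup>2 =
        real N * (U_centred (?m N) (?n N) \<omega> - block_approx K (?m N) (?n N) \<omega>)\<^sup>2" for \<omega>
      by (simp flip: right_diff_distrib add: power_mult_distrib)
    have meas: "U_centred (?m N) (?n N) \<in> borel_measurable M" "block_approx K (?m N) (?n N) \<in> borel_measurable M"
      unfolding U_centred_def[abs_def] block_approx_def[abs_def] using block_sum_moments by simp_all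
    have "real N * expectation (\<lambda>\<omega>. (U_centred (?m N) (?n N) \<omega> - block_approx K (?m N) (?n N) \<omega>)\<^sup>2) \<le>
       real N * (12 * kernel_var * (1 / (real (?m N) * (real (?m N) - 1)) + 1 / (real (?n N) * (real (?n N) - 1)) +
          4 / (real (?m N) * real (?n N))) + 8 * kernel_var / real K * (1 / real (?m N) + 1 / real (?n N)))"
      by (rule mult_left_mono[OF err(2)]) simp
    also have "\<dots> = r N" by (simp add: r_def algebra_simps add_divide_distrib)
    finally have "expectation (\<lambda>\<omega>. (sqrt (real N) * U_centred (?m N) (?n N) \<omega> -
        sqrt (real N) * block_approx K (?m N) (?n N) \<omega>)\<^sup>2) \<le> \<eta>\<^sup>2"
      unfolding sq using elim by simp
    then have "cmod (char (distr M borel (\<lambda>\<omega>. sqrt (real N) * U_centred (?m N) (?n N) \<omega>)) t -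
        char (distr M borel (\<lambda>\<omega>. sqrt (real N) * block_approx K (?m N) (?n N) \<omega>)) t) \<le> \<bar>t\<bar> * \<eta>"
      by (intro char_diff_bound) (use err(1) meas \<eta>(1) in \<open>simp_all add: sq\<close>)
    then show ?case unfolding law using \<eta>(2) by linarith
  qed
  show "\<exists>z w. (\<forall>\<^sub>F N in sequentially.
      cmod (char (distr M borel (\<lambda>\<omega>. sqrt (real N) * (U_seq c h Y N \<omega> - kernel_mean))) t - z N) \<le> \<epsilon>) \<and>
      z \<longlonglongrightarrow> w \<and> cmod (w - complex_of_real (exp (- (t\<^sup>2 * ?v) / 2))) \<le> \<epsilon>"
    by (intro exI conjI) (rule close, rule block_approx_limit[OF c K(1)], use K(3) in simp)
qed

section \<open>Conditional covariances\<close>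

lemma kernel_moments:
  assumes "valid_quad ((i, i'), (j, j'))" "valid_quad ((k, k'), (l, l'))"
  shows "integrable M (\<lambda>\<omega>. h (quadruplet Y i i' j j' \<omega>))"
    and "expectation (\<lambda>\<omega>. h (quadruplet Y i i' j j' \<omega>)) = kernel_mean"
    and "integrable M (\<lambda>\<omega>. h (quadruplet Y i i' j j' \<omega>) * h (quadruplet Y k k' l l' \<omega>))"
    and "cov M (\<lambda>\<omega>. h (quadruplet Y i i' j j' \<omega>)) (\<lambda>\<omega>. h (quadruplet Y k k' l l' \<omega>)) =
      \<Gamma> ((i, i'), (j, j')) ((k, k'), (l, l'))"
proof -
  let ?q = "((i, i'), (j, j'))" and ?q' = "((k, k'), (l, l'))"
  have eq: "h (quadruplet Y i i' j j' \<omega>) = H ?q \<omega> + kernel_mean"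
    "h (quadruplet Y k k' l l' \<omega>) = H ?q' \<omega> + kernel_mean" for \<omega>
    by (simp_all add: centred_def quadruplet_def)
  note I = H_moments(1,2)[OF assms(1)] H_moments(1,2)[OF assms(2)] H_product_integrable[OF assms]
  show "integrable M (\<lambda>\<omega>. h (quadruplet Y i i' j j' \<omega>))"
    "expectation (\<lambda>\<omega>. h (quadruplet Y i i' j j' \<omega>)) = kernel_mean"
    unfolding eq using I by (simp_all add: prob_space)
  have prod: "(H ?q \<omega> + kernel_mean) * (H ?q' \<omega> + kernel_mean) =
      H ?q \<omega> * H ?q' \<omega> + kernel_mean * H ?q \<omega> + kernel_mean * H ?q' \<omega> + kernel_mean\<^sup>2" for \<omega>
    by (simp add: algebra_simps power2_eq_square)
  show "integrable M (\<lambda>\<omega>. h (quadruplet Y i i' j j' \<omega>) * h (quadruplet Y k k' l l' \<omega>))"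
    unfolding eq prod using I by simp
  show "cov M (\<lambda>\<omega>. h (quadruplet Y i i' j j' \<omega>)) (\<lambda>\<omega>. h (quadruplet Y k k' l l' \<omega>)) = \<Gamma> ?q ?q'"
    unfolding cov_def eq prod using I by (simp add: prob_space \<Gamma>_def power2_eq_square)
qed

lemma cond_exp_kernel:
  assumes c: "0 < c" "c < 1" and q: "valid_quad ((i, i'), (j, j'))"
  shows "AE \<omega> in M. real_cond_exp M (F_inf M c h Y) (\<lambda>\<omega>. h (quadruplet Y i i' j j' \<omega>)) \<omega> = kernel_mean"
proof -
  define r where "r = i + i' + j + j'"
  have "block_functional {1..r} {1..r} borel (\<lambda>y. h (quadruplet entries i i' j j' y))"
    by (rule block_functional_quadruplet[OF kernel]) (use q in \<open>auto simp: r_def valid_quad_def\<close>)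
  from cond_exp_tail[OF c this] kernel_moments[OF q q] show ?thesis
    by (simp add: quadruplet_entries)
qed

lemma cond_exp_kernel_product:
  assumes c: "0 < c" "c < 1" and q: "valid_quad ((i, i'), (j, j'))" "valid_quad ((k, k'), (l, l'))"
  shows "AE \<omega> in M. real_cond_exp M (F_inf M c h Y)
      (\<lambda>\<omega>. h (quadruplet Y i i' j j' \<omega>) * h (quadruplet Y k k' l l' \<omega>)) \<omega> =
    expectation (\<lambda>\<omega>. h (quadruplet Y i i' j j' \<omega>) * h (quadruplet Y k k' l l' \<omega>))"
proof -
  define r where "r = i + i' + j + j' + k + k' + l + l'"
  have "block_functional {1..r} {1..r} borel
      (\<lambda>y. h (quadruplet entries i i' j j' y) * h (quadruplet entries k k' l l' y))"
    by (intro block_functional_times block_functional_quadruplet[OF kernel])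
       (use q in \<open>auto simp: r_def valid_quad_def\<close>)
  from cond_exp_tail[OF c this] kernel_moments(3)[OF q] show ?thesis
    by (simp add: quadruplet_entries)
qed

lemma cond_cov_kernel:
  assumes c: "0 < c" "c < 1" and q: "valid_quad ((i, i'), (j, j'))" "valid_quad ((k, k'), (l, l'))"
  shows "AE \<omega> in M. cond_cov M (F_inf M c h Y)
      (\<lambda>\<omega>. h (quadruplet Y i i' j j' \<omega>)) (\<lambda>\<omega>. h (quadruplet Y k k' l l' \<omega>)) \<omega> =
    \<Gamma> ((i, i'), (j, j')) ((k, k'), (l, l'))"
  using cond_exp_kernel_product[OF c q] cond_exp_kernel[OF c q(1)] cond_exp_kernel[OF c q(2)]
proof eventually_elim
  case (elim \<omega>)
  then show ?case
    unfolding cond_cov_def kernel_moments(4)[OF q, symmetric] cov_def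
    by (simp add: kernel_moments(2)[OF q] kernel_moments(2)[OF q(2,1)])
qed

end

text \<open>
  The event \<open>V > 0\<close> having positive probability, the constant value of \<open>V\<close> is positive, so that the
  limit is a Gaussian law with a density.
\<close>

theorem theorem2p7:
  fixes M :: "'w measure"
    and Y :: "nat \<Rightarrow> nat \<Rightarrow> 'w \<Rightarrow> real"
    and h :: "real^2^2 \<Rightarrow> real"
    and c :: real
  assumes "prob_space M"
    and "0 < c" and "c < 1" and "c \<notin> \<rat>"
    and "RCE M Y"
    and "quadruplet_kernel h"
    and "integrable M (\<lambda>\<omega>. (h (quadruplet Y 1 2 1 2 \<omega>))\<^sup>2)"
    and "measure M {\<omega> \<in> space M. V_var M c h Y \<omega> > 0} > 0"
    and "dissociated M Y"
  shows "\<exists>u v.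
      (AE \<omega> in M. U_inf M c h Y \<omega> = u) \<and>
      (AE \<omega> in M. V_var M c h Y \<omega> = v) \<and>
      weak_conv_m
        (\<lambda>N. distr M borel (\<lambda>\<omega>. sqrt (real N) * (U_seq c h Y N \<omega> - U_inf M c h Y \<omega>)))
        (normal_distribution 0 v) \<and>
      u = (\<integral>\<omega>. h (quadruplet Y 1 2 1 2 \<omega>) \<partial>M) \<and>
      v = 4 / c * cov M (\<lambda>\<omega>. h (quadruplet Y 1 2 1 2 \<omega>)) (\<lambda>\<omega>. h (quadruplet Y 1 3 3 4 \<omega>))
        + 4 / (1 - c) * cov M (\<lambda>\<omega>. h (quadruplet Y 1 2 1 2 \<omega>)) (\<lambda>\<omega>. h (quadruplet Y 3 4 1 3 \<omega>))"
proof -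
  interpret prob_space M by fact
  interpret kernel_matrix M Y h by unfold_locales fact+
  note c = \<open>0 < c\<close> \<open>c < 1\<close>
  define v where "v = 4 / c * row_cov + 4 / (1 - c) * col_cov"
  have q: "valid_quad ((1, 2), (1, 2))" "valid_quad ((1, 3), (3, 4))" "valid_quad ((3, 4), (1, 3))"
    by (simp_all add: valid_quad_def)
  have U: "AE \<omega> in M. U_inf M c h Y \<omega> = kernel_mean"
    unfolding U_inf_def by (rule cond_exp_kernel[OF c q(1)])
  have V: "AE \<omega> in M. V_var M c h Y \<omega> = v"
    using cond_cov_kernel[OF c q(1,2)] cond_cov_kernel[OF c q(1,3)]
    by eventually_elim (simp add: V_var_def v_def row_cov_def col_cov_def)
  have v_pos: "0 < v"
  proof (rule ccontr)
    assume v: "\<not> 0 < v"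
    from V have AE: "AE \<omega> in M. \<not> V_var M c h Y \<omega> > 0" by eventually_elim (use v in simp)
    have "V_var M c h Y \<in> borel_measurable M"
      unfolding V_var_def[abs_def] cond_cov_def by simp
    then have "{\<omega> \<in> space M. V_var M c h Y \<omega> > 0} \<in> sets M" by measurable
    then have "measure M {\<omega> \<in> space M. V_var M c h Y \<omega> > 0} = 0"
      using AE by (simp add: prob_Collect_eq_0)
    with assms(8) show False by simp
  qed
  have Um: "U_seq c h Y N \<in> borel_measurable M" for N
    using functional_measurable[OF block_functional_U_stat[OF kernel], of "m_dim c N" "n_dim c N"]
    by (simp add: U_seq_def U_stat_entries)
  have Uinf_m: "U_inf M c h Y \<in> borel_measurable M"
    unfolding U_inf_def by simp
  have conv: "weak_conv_m (\<lambda>N. distr M borel (\<lambda>\<omega>. sqrt (real N) * (U_seq c h Y N \<omega> - U_inf M c h Y \<omega>)))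
      (normal_distribution 0 v)"
  proof (rule levy_continuity)
    show "real_distribution (distr M borel (\<lambda>\<omega>. sqrt (real N) * (U_seq c h Y N \<omega> - U_inf M c h Y \<omega>)))" for N
      by (rule real_distribution_distr) (use Um Uinf_m in simp)
    show "real_distribution (normal_distribution 0 v)" by (rule normal_distribution_char(1)[OF v_pos])
    have "distr M borel (\<lambda>\<omega>. sqrt (real N) * (U_seq c h Y N \<omega> - U_inf M c h Y \<omega>)) =
        distr M borel (\<lambda>\<omega>. sqrt (real N) * (U_seq c h Y N \<omega> - kernel_mean))" for N
      by (rule distr_cong_AE) (use U Um Uinf_m in \<open>auto elim!: eventually_mono\<close>)
    then show "(\<lambda>N. char (distr M borel (\<lambda>\<omega>. sqrt (real N) * (U_seq c h Y N \<omega> - U_inf M c h Y \<omega>))) t)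
        \<longlonglongrightarrow> char (normal_distribution 0 v) t" for t
      using U_char_limit[OF c, of t, folded v_def]
      by (simp only: normal_distribution_char(2)[OF v_pos] mult.commute[of v])
  qed
  have v_eq: "v = 4 / c * cov M (\<lambda>\<omega>. h (quadruplet Y 1 2 1 2 \<omega>)) (\<lambda>\<omega>. h (quadruplet Y 1 3 3 4 \<omega>))
        + 4 / (1 - c) * cov M (\<lambda>\<omega>. h (quadruplet Y 1 2 1 2 \<omega>)) (\<lambda>\<omega>. h (quadruplet Y 3 4 1 3 \<omega>))"
    by (simp only: v_def row_cov_def col_cov_def kernel_moments(4)[OF q(1,2)] kernel_moments(4)[OF q(1,3)])
  show ?thesis
    by (rule exI[of _ kernel_mean], rule exI[of _ v]) (intro conjI U V conv kernel_mean_def v_eq)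
qed

end
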